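(* The selection category construction comprises a functor $$\mathcal{S}_{-}\colon\mathbf{Cat}\longrightarrow\mathbb{P}\mathbf{rof}\text{-}\mathbf{Cat}.$$ For each category $\mathcal{C}\in\mathrm{Ob}\,\mathbf{Cat}$, the associated $\mathbb{P}\mathbf{rof}$-enriched category $\mathcal{S}_{\mathcal{C}}$ has objects $\mathrm{Ob}\,\mathcal{S}_{\mathcal{C}}:=\mathrm{Ob}\,\mathbf{Poly}$. Assigned to $p\in\mathbf{Poly}$ is the selection category $\mathcal{S}_{\mathcal{C}}(p)\cong\mathrm{Lan}_p(p\circ k_{\mathcal{C}})$ (the polynomial comonad on the right being identified with its corresponding category), and assigned to each pair of objects $(p,q)$, with $p=\sum_{i\in I}\mathbf{Set}(A_i,-)$ and $q=\sum_{j\in J}\mathbf{Set}(B_j,-)$, is the profunctor $$\mathrm{Hom}_{\mathcal{S}_{\mathcal{C}}}(p,q)\colon\mathcal{S}_{\mathcal{C}}(p)^{\mathrm{op}}\times\mathcal{S}_{\mathcal{C}}(q)\to\mathbf{Set},\qquad \big((i,c),(j,d)\big)\mapsto\prod_{b\in B_j}\sum_{a\in A_i}\mathcal{C}\big(c(a),d(b)\big).$$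
   Context: $\mathbf{Cat}$ is the category of small categories and functors. $\mathbf{Poly}$ is the category of polynomial functors $\mathbf{Set}\to\mathbf{Set}$ (coproducts of representables $\sum_{i\in I}\mathbf{Set}(A_i,-)$) and natural transformations between them. $\mathbb{P}\mathbf{rof}$ is the double category of categories, functors, and profunctors $S\nrightarrow T$, i.e. functors $S^{\mathrm{op}}\times T\to\mathbf{Set}$. $\mathbb{P}\mathbf{rof}\text{-}\mathbf{Cat}$ is the category of small categories enriched in $\mathbb{P}\mathbf{rof}$: such an enriched category $S$ consists of a set $P$ of objects, for each $p\in P$ a category $S(p)$, and for each pair of objects $p,q$ a profunctor $\mathrm{Hom}_S(p,q)\colon S(p)\nrightarrow S(q)$, as well as identity data (maps from the hom profunctor of $S(p)$ to $\mathrm{Hom}_S(p,p)$) and composite data (maps from the composite profunctor of $\mathrm{Hom}_S(p,q)$ and $\mathrm{Hom}_S(q,r)$ to $\mathrm{Hom}_S(p,r)$), unital and associative. A morphism is a $\mathbb{P}\mathbf{rof}$-enriched functor $S\to S'$: a map $p\mapsto Fp$ on objects, functors $F_p\colon S(p)\to S'(Fp)$, and natural maps $\mathrm{Hom}_S(p,q)(x,y)\to\mathrm{Hom}_{S'}(Fp,Fq)(F_px,F_qy)$ respecting identities and composites. Selection category $\mathcal{S}_{\mathcal{C}}(p)$ for a small category $\mathcal{C}$ and $p=\sum_{i\in I}\mathbf{Set}(A_i,-)$: objects are pairs $(i,c)$ with $i\in I$ and $c\colon A_i\to\mathrm{Ob}\,\mathcal{C}$; the hom-set from $(i,c)$ to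 $(i',c')$ is $\prod_{a'\in A_{i'}}\sum_{a\in A_i}\mathcal{C}(c_a,c'_{a'})$, with the obvious identities and compositions (a morphism is a function $A_{i'}\to A_i$ together with morphisms of $\mathcal{C}$, and one composes the functions and the $\mathcal{C}$-morphisms). Comonads: write $\mathcal{C}[c]=\sum_{c'\in\mathrm{Ob}\,\mathcal{C}}\mathcal{C}(c,c')$. The comonad $k_{\mathcal{C}}$ on $\mathbf{Set}$ has underlying functor $X\mapsto\sum_{c\in\mathrm{Ob}\,\mathcal{C}}\mathbf{Set}(\mathcal{C}[c],X)$, counit $(c,x)\mapsto x(\mathrm{id}_c)$, and comultiplication $(c,x)\mapsto\big(c,\ f\mapsto(\mathrm{cod}(f),\ f'\mapsto x(f'\circ f))\big)$. By a theorem of Ahman and Uustalu, categories up to isomorphism are identified in this way with comonads on $\mathbf{Set}$ whose underlying functor is polynomial. $\mathrm{Lan}_q(p)$ is the left Kan extension of $p$ along $q$; maps $\mathrm{Lan}_q(p)\Rightarrow r$ correspond to maps $p\Rightarrow r\circ q$. For a polynomial comonad $(k,\epsilon,\delta)$ and polynomial $p$, the functor $L=\mathrm{Lan}_p(p\circ k)$ is polynomial and is a comonad, with counit corresponding to $p\epsilon\colon pk\Rightarrow p$ and comultiplication corresponding to $pk\xrightarrow{p\delta}pkk\Rightarrow Lpk\Rightarrow LLp$ (the last two maps being induced by the unit $pk\Rightarrow Lp$). *)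

theory Defs
  imports "HOL-Library.FuncSet" "HOL-Library.Nat_Bijection"
begin

section \<open>The universe of sets\<close>

text \<open>
  The category of sets is taken relative to a type whose elements code exactly the small
  sets, in the manner of a Grothendieck universe.  Neither infinity nor foundation is required,
  so that hereditarily finite sets (coded by natural numbers) form an instance; every model of
  second-order ZFC is another one.
\<close>

class set_universe =
  fixes elts :: "'a \<Rightarrow> 'a set"
  assumes inj_elts: "inj elts"
    and pairing: "{x, y} \<in> range elts"
    and union: "(\<Union>y\<in>elts x. elts y) \<in> range elts"
    and powerset: "{y. elts y \<subseteq> elts x} \<in> range elts"
    and separation: "X \<subseteq> elts x \<Longrightarrow> X \<in> range elts"
    and replacement: "f ` elts x \<in> range elts"

instantiation nat :: set_universe
begin

definition elts_nat :: "nat \<Rightarrow> nat set" where "elts_nat = set_decode"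

instance
proof
  have small: "X \<in> range (elts :: nat \<Rightarrow> nat set)" if "finite X" for X :: "nat set"
    using set_encode_inverse[OF that] unfolding elts_nat_def by (metis rangeI)
  have fin: "finite (elts x)" for x :: nat
    by (simp add: elts_nat_def)
  show inj: "inj (elts :: nat \<Rightarrow> nat set)"
    unfolding elts_nat_def by (metis injI set_decode_inverse)
  fix x y :: nat and X :: "nat set" and f :: "nat \<Rightarrow> nat"
  show "{x, y} \<in> range elts" by (rule small) simp
  show "(\<Union>y\<in>elts x. elts y) \<in> range elts" by (rule small) (simp add: fin)
  have "finite (elts ` {y. elts y \<subseteq> elts x})"
    by (rule finite_subset[of _ "Pow (elts x)"]) (auto simp: fin)
  then have "finite {y. elts y \<subseteq> elts x}"
    by (rule finite_imageD) (meson inj inj_on_subset subset_UNIV)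
  then show "{y. elts y \<subseteq> elts x} \<in> range elts" by (rule small)
  show "X \<in> range elts" if "X \<subseteq> elts x"
    by (rule small) (use that fin finite_subset in blast)
  show "f ` elts x \<in> range elts" by (rule small) (simp add: fin)
qed

end

definition small :: "'u::set_universe set \<Rightarrow> bool" where
  "small X \<longleftrightarrow> X \<in> range elts"

definition vset :: "'u::set_universe set \<Rightarrow> 'u" where
  "vset X = (THE x. elts x = X)"

definition vpair :: "'u::set_universe \<Rightarrow> 'u \<Rightarrow> 'u" where
  "vpair x y = vset {vset {x}, vset {x, y}}"

definition vfst :: "'u::set_universe \<Rightarrow> 'u" where
  "vfst t = (THE x. \<exists>y. t = vpair x y)"

definition vsnd :: "'u::set_universe \<Rightarrow> 'u" where
  "vsnd t = (THE y. \<exists>x. t = vpair x y)"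

text \<open>Functions with small domain are coded by their graphs.\<close>

definition vlam :: "'u::set_universe set \<Rightarrow> ('u \<Rightarrow> 'u) \<Rightarrow> 'u" where
  "vlam A f = vset ((\<lambda>x. vpair x (f x)) ` A)"

definition vapp :: "'u::set_universe \<Rightarrow> 'u \<Rightarrow> 'u" where
  "vapp g x = (THE y. vpair x y \<in> elts g)"

definition vSigma :: "'u::set_universe set \<Rightarrow> ('u \<Rightarrow> 'u set) \<Rightarrow> 'u set" where
  "vSigma A B = {vpair a b | a b. a \<in> A \<and> b \<in> B a}"

definition vPi :: "'u::set_universe set \<Rightarrow> ('u \<Rightarrow> 'u set) \<Rightarrow> 'u set" where
  "vPi A B = {vlam A f | f. \<forall>a\<in>A. f a \<in> B a}"

section \<open>Categories, functors, natural transformations\<close>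

text \<open>
  Categories are given by hom-sets, which need not be disjoint; \<open>Comp C a b c g f\<close> is the
  composite of \<open>f : a \<rightarrow> b\<close> and \<open>g : b \<rightarrow> c\<close>.
\<close>

record ('o, 'm) category =
  Obj :: "'o set"
  Hom :: "'o \<Rightarrow> 'o \<Rightarrow> 'm set"
  Ident :: "'o \<Rightarrow> 'm"
  Comp :: "'o \<Rightarrow> 'o \<Rightarrow> 'o \<Rightarrow> 'm \<Rightarrow> 'm \<Rightarrow> 'm"

definition is_category :: "('o, 'm) category \<Rightarrow> bool" where
  "is_category C \<longleftrightarrow>
     (\<forall>a\<in>Obj C. Ident C a \<in> Hom C a a) \<and>
     (\<forall>a\<in>Obj C. \<forall>b\<in>Obj C. \<forall>c\<in>Obj C. \<forall>f\<in>Hom C a b. \<forall>g\<in>Hom C b c.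
        Comp C a b c g f \<in> Hom C a c) \<and>
     (\<forall>a\<in>Obj C. \<forall>b\<in>Obj C. \<forall>f\<in>Hom C a b.
        Comp C a a b f (Ident C a) = f \<and> Comp C a b b (Ident C b) f = f) \<and>
     (\<forall>a\<in>Obj C. \<forall>b\<in>Obj C. \<forall>c\<in>Obj C. \<forall>d\<in>Obj C.
        \<forall>f\<in>Hom C a b. \<forall>g\<in>Hom C b c. \<forall>h\<in>Hom C c d.
        Comp C a c d h (Comp C a b c g f) = Comp C a b d (Comp C b c d h g) f)"

definition op_cat :: "('o, 'm) category \<Rightarrow> ('o, 'm) category" where
  "op_cat C = \<lparr>Obj = Obj C, Hom = (\<lambda>a b. Hom C b a), Ident = Ident C,
     Comp = (\<lambda>a b c g f. Comp C c b a f g)\<rparr>"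

definition prod_cat ::
  "('o, 'm) category \<Rightarrow> ('p, 'n) category \<Rightarrow> ('o \<times> 'p, 'm \<times> 'n) category" where
  "prod_cat C D = \<lparr>Obj = Obj C \<times> Obj D,
     Hom = (\<lambda>(a, b) (a', b'). Hom C a a' \<times> Hom D b b'),
     Ident = (\<lambda>(a, b). (Ident C a, Ident D b)),
     Comp = (\<lambda>(a, b) (a', b') (a'', b'') (g, g') (f, f').
       (Comp C a a' a'' g f, Comp D b b' b'' g' f'))\<rparr>"

definition restrict2 :: "'a set \<Rightarrow> ('a \<Rightarrow> 'a \<Rightarrow> 'b) \<Rightarrow> 'a \<Rightarrow> 'a \<Rightarrow> 'b" where
  "restrict2 A f = (\<lambda>a b. if a \<in> A \<and> b \<in> A then f a b else undefined)"

text \<open>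
  Functors and natural transformations are required to be \<^const>\<open>undefined\<close> off their domains,
  so that equality of functors is equality of HOL values.
\<close>

record ('o, 'm, 'p, 'n) fctr =
  fob :: "'o \<Rightarrow> 'p"
  farr :: "'o \<Rightarrow> 'o \<Rightarrow> 'm \<Rightarrow> 'n"

definition is_functor ::
  "('o, 'm) category \<Rightarrow> ('p, 'n) category \<Rightarrow> ('o, 'm, 'p, 'n) fctr \<Rightarrow> bool" where
  "is_functor C D F \<longleftrightarrow>
     is_category C \<and> is_category D \<and>
     fob F \<in> Obj C \<rightarrow>\<^sub>E Obj D \<and>
     farr F = restrict2 (Obj C) (farr F) \<and>
     (\<forall>a\<in>Obj C. \<forall>b\<in>Obj C. farr F a b \<in> Hom C a b \<rightarrow>\<^sub>E Hom D (fob F a) (fob F b)) \<and>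
     (\<forall>a\<in>Obj C. farr F a a (Ident C a) = Ident D (fob F a)) \<and>
     (\<forall>a\<in>Obj C. \<forall>b\<in>Obj C. \<forall>c\<in>Obj C. \<forall>f\<in>Hom C a b. \<forall>g\<in>Hom C b c.
        farr F a c (Comp C a b c g f)
        = Comp D (fob F a) (fob F b) (fob F c) (farr F b c g) (farr F a b f))"

definition mk_functor ::
  "('o, 'm) category \<Rightarrow> ('o \<Rightarrow> 'p) \<Rightarrow> ('o \<Rightarrow> 'o \<Rightarrow> 'm \<Rightarrow> 'n) \<Rightarrow> ('o, 'm, 'p, 'n) fctr" where
  "mk_functor C F0 F1 = \<lparr>fob = restrict F0 (Obj C),
     farr = restrict2 (Obj C) (\<lambda>a b. restrict (F1 a b) (Hom C a b))\<rparr>"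

definition id_functor :: "('o, 'm) category \<Rightarrow> ('o, 'm, 'o, 'm) fctr" where
  "id_functor C = mk_functor C (\<lambda>a. a) (\<lambda>a b f. f)"

definition comp_functor ::
  "('o, 'm) category \<Rightarrow> ('p, 'n, 'q, 'k) fctr \<Rightarrow> ('o, 'm, 'p, 'n) fctr \<Rightarrow> ('o, 'm, 'q, 'k) fctr" where
  "comp_functor C G F = mk_functor C (\<lambda>a. fob G (fob F a))
     (\<lambda>a b f. farr G (fob F a) (fob F b) (farr F a b f))"

definition nat_trans ::
  "('o, 'm) category \<Rightarrow> ('p, 'n) category \<Rightarrow> ('o, 'm, 'p, 'n) fctr \<Rightarrow> ('o, 'm, 'p, 'n) fctr
    \<Rightarrow> ('o \<Rightarrow> 'n) \<Rightarrow> bool" where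
  "nat_trans C D F G \<alpha> \<longleftrightarrow>
     is_functor C D F \<and> is_functor C D G \<and>
     \<alpha> \<in> (\<Pi>\<^sub>E a\<in>Obj C. Hom D (fob F a) (fob G a)) \<and>
     (\<forall>a\<in>Obj C. \<forall>b\<in>Obj C. \<forall>f\<in>Hom C a b.
        Comp D (fob F a) (fob F b) (fob G b) (\<alpha> b) (farr F a b f)
        = Comp D (fob F a) (fob G a) (fob G b) (farr G a b f) (\<alpha> a))"

definition vcomp ::
  "('o, 'm) category \<Rightarrow> ('p, 'n) category \<Rightarrow> ('o, 'm, 'p, 'n) fctr \<Rightarrow> ('o, 'm, 'p, 'n) fctr
    \<Rightarrow> ('o, 'm, 'p, 'n) fctr \<Rightarrow> ('o \<Rightarrow> 'n) \<Rightarrow> ('o \<Rightarrow> 'n) \<Rightarrow> ('o \<Rightarrow> 'n)" where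
  "vcomp C D F G H \<beta> \<alpha> = (\<lambda>a\<in>Obj C. Comp D (fob F a) (fob G a) (fob H a) (\<beta> a) (\<alpha> a))"

text \<open>\<open>whisker_right A Q \<beta> = \<beta>Q\<close>, and \<open>whisker_left A H F G \<alpha> = H\<alpha>\<close> for \<open>\<alpha> : F \<Rightarrow> G\<close>.\<close>

definition whisker_right ::
  "('o, 'm) category \<Rightarrow> ('o, 'm, 'p, 'n) fctr \<Rightarrow> ('p \<Rightarrow> 'k) \<Rightarrow> ('o \<Rightarrow> 'k)" where
  "whisker_right A Q \<beta> = (\<lambda>a\<in>Obj A. \<beta> (fob Q a))"

definition whisker_left ::
  "('o, 'm) category \<Rightarrow> ('p, 'n, 'q, 'k) fctr \<Rightarrow> ('o, 'm, 'p, 'n) fctr \<Rightarrow> ('o, 'm, 'p, 'n) fctr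
    \<Rightarrow> ('o \<Rightarrow> 'n) \<Rightarrow> ('o \<Rightarrow> 'k)" where
  "whisker_left A H F G \<alpha> = (\<lambda>a\<in>Obj A. farr H (fob F a) (fob G a) (\<alpha> a))"

text \<open>\<open>is_lan A B E Q T L \<eta>\<close>: the functor \<open>L : B \<rightarrow> E\<close> with unit \<open>\<eta> : T \<Rightarrow> L Q\<close> is a left Kan
  extension of \<open>T : A \<rightarrow> E\<close> along \<open>Q : A \<rightarrow> B\<close>.\<close>

definition is_lan ::
  "('a, 'l) category \<Rightarrow> ('b, 'm) category \<Rightarrow> ('e, 'n) category \<Rightarrow> ('a, 'l, 'b, 'm) fctr
    \<Rightarrow> ('a, 'l, 'e, 'n) fctr \<Rightarrow> ('b, 'm, 'e, 'n) fctr \<Rightarrow> ('a \<Rightarrow> 'n) \<Rightarrow> bool" where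
  "is_lan A B E Q T L \<eta> \<longleftrightarrow>
     is_functor A B Q \<and> is_functor A E T \<and> is_functor B E L \<and>
     nat_trans A E T (comp_functor A L Q) \<eta> \<and>
     (\<forall>R \<alpha>. is_functor B E R \<and> nat_trans A E T (comp_functor A R Q) \<alpha> \<longrightarrow>
        (\<exists>!\<beta>. nat_trans B E L R \<beta> \<and>
           vcomp A E T (comp_functor A L Q) (comp_functor A R Q) (whisker_right A Q \<beta>) \<eta> = \<alpha>))"

definition is_small_category :: "('u::set_universe, 'u) category \<Rightarrow> bool" where
  "is_small_category C \<longleftrightarrow>
     is_category C \<and> small (Obj C) \<and> (\<forall>a\<in>Obj C. \<forall>b\<in>Obj C. small (Hom C a b))"

definition Cat :: "(('u::set_universe, 'u) category, ('u, 'u, 'u, 'u) fctr) category" where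
  "Cat = \<lparr>Obj = {C. is_small_category C}, Hom = (\<lambda>C D. {F. is_functor C D F}),
     Ident = id_functor, Comp = (\<lambda>C D E G F. comp_functor C G F)\<rparr>"

definition Set_cat :: "('u::set_universe set, 'u \<Rightarrow> 'u) category" where
  "Set_cat = \<lparr>Obj = {X. small X}, Hom = (\<lambda>X Y. X \<rightarrow>\<^sub>E Y), Ident = (\<lambda>X. \<lambda>x\<in>X. x),
     Comp = (\<lambda>X Y Z g f. compose X g f)\<rparr>"

type_synonym 'u endo = "('u set, 'u \<Rightarrow> 'u, 'u set, 'u \<Rightarrow> 'u) fctr"
type_synonym 'u endo_nat = "'u set \<Rightarrow> ('u \<Rightarrow> 'u)"

section \<open>Polynomial functors and comonads on sets\<close>

text \<open>The record with index set \<open>I\<close> and arities \<open>A\<close> presents \<open>\<Sum>\<^sub>i\<^sub>\<in>\<^sub>I Set(A i, -)\<close>.\<close>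

record 'u polyn =
  Idx :: "'u set"
  Arity :: "'u \<Rightarrow> 'u set"

definition poly_functor :: "'u::set_universe polyn \<Rightarrow> 'u endo" where
  "poly_functor p = mk_functor Set_cat
     (\<lambda>X. vSigma (Idx p) (\<lambda>i. vPi (Arity p i) (\<lambda>_. X)))
     (\<lambda>X Y f. \<lambda>t\<in>vSigma (Idx p) (\<lambda>i. vPi (Arity p i) (\<lambda>_. X)).
        vpair (vfst t) (vlam (Arity p (vfst t)) (\<lambda>a. f (vapp (vsnd t) a))))"

definition Poly :: "('u::set_universe polyn, 'u endo_nat) category" where
  "Poly = \<lparr>Obj = {p. small (Idx p) \<and> Arity p \<in> Idx p \<rightarrow>\<^sub>E {X. small X}},
     Hom = (\<lambda>p q. {\<alpha>. nat_trans Set_cat Set_cat (poly_functor p) (poly_functor q) \<alpha>}),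
     Ident = (\<lambda>p. \<lambda>X\<in>Obj Set_cat. Ident Set_cat (fob (poly_functor p) X)),
     Comp = (\<lambda>p q r. vcomp Set_cat Set_cat (poly_functor p) (poly_functor q) (poly_functor r))\<rparr>"

record 'u comonad =
  cfun :: "'u endo"
  counit :: "'u endo_nat"
  comult :: "'u endo_nat"

definition is_comonad :: "'u::set_universe comonad \<Rightarrow> bool" where
  "is_comonad K \<longleftrightarrow>
     (let k = cfun K; kk = comp_functor Set_cat k k; I = id_functor Set_cat;
          kkk = comp_functor Set_cat k kk; cmp = vcomp Set_cat Set_cat in
      nat_trans Set_cat Set_cat k I (counit K) \<and>
      nat_trans Set_cat Set_cat k kk (comult K) \<and>
      cmp k kk k (whisker_left Set_cat k k I (counit K)) (comult K)
        = (\<lambda>X\<in>Obj Set_cat. Ident Set_cat (fob k X)) \<and>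
      cmp k kk k (whisker_right Set_cat k (counit K)) (comult K)
        = (\<lambda>X\<in>Obj Set_cat. Ident Set_cat (fob k X)) \<and>
      cmp k kk kkk (whisker_left Set_cat k k kk (comult K)) (comult K)
        = cmp k kk kkk (whisker_right Set_cat k (comult K)) (comult K))"

definition comonad_iso :: "'u::set_universe comonad \<Rightarrow> 'u comonad \<Rightarrow> bool" where
  "comonad_iso K M \<longleftrightarrow> is_comonad K \<and> is_comonad M \<and>
     (let k = cfun K; m = cfun M; I = id_functor Set_cat;
          kk = comp_functor Set_cat k k; km = comp_functor Set_cat k m;
          mm = comp_functor Set_cat m m; cmp = vcomp Set_cat Set_cat in
      \<exists>\<phi> \<psi>. nat_trans Set_cat Set_cat k m \<phi> \<and> nat_trans Set_cat Set_cat m k \<psi> \<and>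
        cmp k m k \<psi> \<phi> = (\<lambda>X\<in>Obj Set_cat. Ident Set_cat (fob k X)) \<and>
        cmp m k m \<phi> \<psi> = (\<lambda>X\<in>Obj Set_cat. Ident Set_cat (fob m X)) \<and>
        cmp k m I (counit M) \<phi> = counit K \<and>
        cmp k m mm (comult M) \<phi>
          = cmp k kk mm
              (cmp kk km mm (whisker_right Set_cat m \<phi>) (whisker_left Set_cat k k m \<phi>))
              (comult K))"

text \<open>The set \<open>C[c]\<close> of arrows out of \<open>c\<close>, an arrow being paired with its codomain.\<close>

definition out :: "('u::set_universe, 'u) category \<Rightarrow> 'u \<Rightarrow> 'u set" where
  "out C c = vSigma (Obj C) (\<lambda>c'. Hom C c c')"

definition cat_polyn :: "('u::set_universe, 'u) category \<Rightarrow> 'u polyn" where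
  "cat_polyn C = \<lparr>Idx = Obj C, Arity = restrict (out C) (Obj C)\<rparr>"

definition cat_comonad :: "('u::set_universe, 'u) category \<Rightarrow> 'u comonad" where
  "cat_comonad C = (let k = poly_functor (cat_polyn C) in
     \<lparr>cfun = k,
      counit = (\<lambda>X\<in>Obj Set_cat. \<lambda>t\<in>fob k X. vapp (vsnd t) (vpair (vfst t) (Ident C (vfst t)))),
      comult = (\<lambda>X\<in>Obj Set_cat. \<lambda>t\<in>fob k X. let c = vfst t; x = vsnd t in
        vpair c (vlam (out C c) (\<lambda>f. vpair (vfst f) (vlam (out C (vfst f)) (\<lambda>f'.
          vapp x (vpair (vfst f') (Comp C c (vfst f) (vfst f') (vsnd f') (vsnd f))))))))\<rparr>)"

text \<open>The comonad structure on a left Kan extension \<open>(L, \<eta>)\<close> of \<open>p k\<close> along \<open>p\<close>.\<close>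

definition lan_comonad ::
  "'u::set_universe endo \<Rightarrow> 'u comonad \<Rightarrow> 'u endo \<Rightarrow> 'u endo_nat \<Rightarrow> 'u comonad" where
  "lan_comonad p K L \<eta> =
     (let k = cfun K; I = id_functor Set_cat; cmp = vcomp Set_cat Set_cat;
          kk = comp_functor Set_cat k k; pk = comp_functor Set_cat p k;
          pkk = comp_functor Set_cat p kk; Lp = comp_functor Set_cat L p;
          Lpk = comp_functor Set_cat L pk; LL = comp_functor Set_cat L L;
          LLp = comp_functor Set_cat L Lp in
      \<lparr>cfun = L,
       counit = (THE \<beta>. nat_trans Set_cat Set_cat L I \<beta> \<and>
         cmp pk Lp p (whisker_right Set_cat p \<beta>) \<eta> = whisker_left Set_cat p k I (counit K)),
       comult = (THE \<beta>. nat_trans Set_cat Set_cat L LL \<beta> \<and>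
         cmp pk Lp LLp (whisker_right Set_cat p \<beta>) \<eta>
         = cmp pk Lpk LLp (whisker_left Set_cat L pk Lp \<eta>)
             (cmp pk pkk Lpk (whisker_right Set_cat k \<eta>)
                (whisker_left Set_cat p k kk (comult K))))\<rparr>)"

section \<open>Profunctors\<close>

type_synonym 'u profunctor = "('u \<times> 'u, 'u \<times> 'u, 'u set, 'u \<Rightarrow> 'u) fctr"
type_synonym 'u prof_nat = "'u \<times> 'u \<Rightarrow> ('u \<Rightarrow> 'u)"

definition is_profunctor ::
  "('u::set_universe, 'u) category \<Rightarrow> ('u, 'u) category \<Rightarrow> 'u profunctor \<Rightarrow> bool" where
  "is_profunctor S T P \<longleftrightarrow> is_functor (prod_cat (op_cat S) T) Set_cat P"

definition prof_map ::
  "('u::set_universe, 'u) category \<Rightarrow> ('u, 'u) category \<Rightarrow> 'u profunctor \<Rightarrow> 'u profunctor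
    \<Rightarrow> 'u prof_nat \<Rightarrow> bool" where
  "prof_map S T P Q \<alpha> \<longleftrightarrow> nat_trans (prod_cat (op_cat S) T) Set_cat P Q \<alpha>"

definition hom_prof :: "('u::set_universe, 'u) category \<Rightarrow> 'u profunctor" where
  "hom_prof S = mk_functor (prod_cat (op_cat S) S) (\<lambda>(x, y). Hom S x y)
     (\<lambda>(x, y) (x', y') (u, v). \<lambda>h\<in>Hom S x y. Comp S x' y y' v (Comp S x' x y h u))"

text \<open>\<open>P(F -, G -)\<close>\<close>

definition prof_reindex ::
  "('u::set_universe, 'u) category \<Rightarrow> ('u, 'u) category \<Rightarrow> 'u profunctor
    \<Rightarrow> ('u, 'u, 'u, 'u) fctr \<Rightarrow> ('u, 'u, 'u, 'u) fctr \<Rightarrow> 'u profunctor" where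
  "prof_reindex S T P F G = mk_functor (prod_cat (op_cat S) T)
     (\<lambda>(x, y). fob P (fob F x, fob G y))
     (\<lambda>(x, y) (x', y') (u, v).
        farr P (fob F x, fob G y) (fob F x', fob G y') (farr F x' x u, farr G y y' v))"

text \<open>
  The composite of \<open>P : S \<nrightarrow> T\<close> and \<open>Q : T \<nrightarrow> U\<close> is the coend
  \<open>\<integral>\<^sup>y P(x, y) \<times> Q(y, z)\<close>: the quotient of the set of triples \<open>(y, f, g)\<close> by the equivalence
  relation generated by \<open>(y, f, g \<cdot> u) \<sim> (y', u \<cdot> f, g)\<close> for \<open>u : y \<rightarrow> y'\<close> in \<open>T\<close>.
\<close>

definition coend_pre ::
  "('u::set_universe, 'u) category \<Rightarrow> 'u profunctor \<Rightarrow> 'u profunctor \<Rightarrow> 'u \<Rightarrow> 'u \<Rightarrow> 'u set" where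
  "coend_pre T P Q x z = vSigma (Obj T) (\<lambda>y. vSigma (fob P (x, y)) (\<lambda>_. fob Q (y, z)))"

definition coend_step ::
  "('u::set_universe, 'u) category \<Rightarrow> ('u, 'u) category \<Rightarrow> ('u, 'u) category
    \<Rightarrow> 'u profunctor \<Rightarrow> 'u profunctor \<Rightarrow> 'u \<Rightarrow> 'u \<Rightarrow> ('u \<times> 'u) set" where
  "coend_step S T U P Q x z =
     {(vpair y (vpair f (farr Q (y', z) (y, z) (u, Ident U z) g)),
       vpair y' (vpair (farr P (x, y) (x, y') (Ident S x, u) f) g)) | y y' u f g.
      y \<in> Obj T \<and> y' \<in> Obj T \<and> u \<in> Hom T y y' \<and> f \<in> fob P (x, y) \<and> g \<in> fob Q (y', z)}"

definition coend_class ::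
  "('u::set_universe, 'u) category \<Rightarrow> ('u, 'u) category \<Rightarrow> ('u, 'u) category
    \<Rightarrow> 'u profunctor \<Rightarrow> 'u profunctor \<Rightarrow> 'u \<Rightarrow> 'u \<Rightarrow> 'u \<Rightarrow> 'u \<Rightarrow> 'u \<Rightarrow> 'u" where
  "coend_class S T U P Q x z y f g =
     vset ((coend_step S T U P Q x z \<union> (coend_step S T U P Q x z)\<inverse>)\<^sup>* `` {vpair y (vpair f g)})"

text \<open>Apply a function of a triple to an arbitrary representative of a coend class.\<close>

definition coend_lift :: "('u \<Rightarrow> 'u \<Rightarrow> 'u \<Rightarrow> 'u) \<Rightarrow> 'u::set_universe \<Rightarrow> 'u" where
  "coend_lift h \<kappa> = (let t = (SOME t. t \<in> elts \<kappa>) in h (vfst t) (vfst (vsnd t)) (vsnd (vsnd t)))"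

definition coend ::
  "('u::set_universe, 'u) category \<Rightarrow> ('u, 'u) category \<Rightarrow> ('u, 'u) category
    \<Rightarrow> 'u profunctor \<Rightarrow> 'u profunctor \<Rightarrow> 'u \<Rightarrow> 'u \<Rightarrow> 'u set" where
  "coend S T U P Q x z =
     (\<lambda>t. coend_class S T U P Q x z (vfst t) (vfst (vsnd t)) (vsnd (vsnd t))) ` coend_pre T P Q x z"

definition prof_comp ::
  "('u::set_universe, 'u) category \<Rightarrow> ('u, 'u) category \<Rightarrow> ('u, 'u) category
    \<Rightarrow> 'u profunctor \<Rightarrow> 'u profunctor \<Rightarrow> 'u profunctor" where
  "prof_comp S T U P Q = mk_functor (prod_cat (op_cat S) U)
     (\<lambda>(x, z). coend S T U P Q x z)
     (\<lambda>(x, z) (x', z') (u, v). \<lambda>\<kappa>\<in>coend S T U P Q x z. coend_lift (\<lambda>y f g.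
        coend_class S T U P Q x' z' y
          (farr P (x, y) (x', y) (u, Ident T y) f) (farr Q (y, z) (y, z') (Ident T y, v) g)) \<kappa>)"

section \<open>Categories enriched in the double category of profunctors\<close>

record ('p, 'u) prof_category =
  pob :: "'p set"
  pcat :: "'p \<Rightarrow> ('u, 'u) category"
  phom :: "'p \<Rightarrow> 'p \<Rightarrow> 'u profunctor"
  pid :: "'p \<Rightarrow> 'u prof_nat"
  pcomp :: "'p \<Rightarrow> 'p \<Rightarrow> 'p \<Rightarrow> 'u prof_nat"

text \<open>The composite datum evaluated at the class of \<open>(y, f, g)\<close>.\<close>

definition pmul ::
  "('p, 'u::set_universe) prof_category \<Rightarrow> 'p \<Rightarrow> 'p \<Rightarrow> 'p \<Rightarrow> 'u \<Rightarrow> 'u \<Rightarrow> 'u \<Rightarrow> 'u \<Rightarrow> 'u \<Rightarrow> 'u" where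
  "pmul S p q r x y z f g = pcomp S p q r (x, z)
     (coend_class (pcat S p) (pcat S q) (pcat S r) (phom S p q) (phom S q r) x z y f g)"

text \<open>
  The unit laws say that composing with the identity data agrees with the unitors
  \<open>[x', m, h] \<mapsto> h \<cdot> m\<close> and \<open>[y', h, n] \<mapsto> n \<cdot> h\<close>; the associativity law
  is the associativity square evaluated on triples \<open>(f, g, h)\<close>, whose classes exhaust the
  threefold composite.
\<close>

definition is_prof_category :: "('p, 'u::set_universe) prof_category \<Rightarrow> bool" where
  "is_prof_category S \<longleftrightarrow>
     (\<forall>p\<in>pob S. is_small_category (pcat S p)) \<and>
     (\<forall>p\<in>pob S. \<forall>q\<in>pob S. is_profunctor (pcat S p) (pcat S q) (phom S p q)) \<and>
     (\<forall>p\<in>pob S. prof_map (pcat S p) (pcat S p) (hom_prof (pcat S p)) (phom S p p) (pid S p)) \<and>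
     (\<forall>p\<in>pob S. \<forall>q\<in>pob S. \<forall>r\<in>pob S. prof_map (pcat S p) (pcat S r)
        (prof_comp (pcat S p) (pcat S q) (pcat S r) (phom S p q) (phom S q r))
        (phom S p r) (pcomp S p q r)) \<and>
     (\<forall>p\<in>pob S. \<forall>q\<in>pob S. \<forall>x\<in>Obj (pcat S p). \<forall>x'\<in>Obj (pcat S p). \<forall>y\<in>Obj (pcat S q).
        \<forall>m\<in>Hom (pcat S p) x x'. \<forall>h\<in>fob (phom S p q) (x', y).
        pmul S p p q x x' y (pid S p (x, x') m) h
        = farr (phom S p q) (x', y) (x, y) (m, Ident (pcat S q) y) h) \<and>
     (\<forall>p\<in>pob S. \<forall>q\<in>pob S. \<forall>x\<in>Obj (pcat S p). \<forall>y'\<in>Obj (pcat S q). \<forall>y\<in>Obj (pcat S q).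
        \<forall>h\<in>fob (phom S p q) (x, y'). \<forall>n\<in>Hom (pcat S q) y' y.
        pmul S p q q x y' y h (pid S q (y', y) n)
        = farr (phom S p q) (x, y') (x, y) (Ident (pcat S p) x, n) h) \<and>
     (\<forall>p\<in>pob S. \<forall>q\<in>pob S. \<forall>r\<in>pob S. \<forall>s\<in>pob S. \<forall>x\<in>Obj (pcat S p). \<forall>y\<in>Obj (pcat S q).
        \<forall>z\<in>Obj (pcat S r). \<forall>w\<in>Obj (pcat S s). \<forall>f\<in>fob (phom S p q) (x, y).
        \<forall>g\<in>fob (phom S q r) (y, z). \<forall>h\<in>fob (phom S r s) (z, w).
        pmul S p r s x z w (pmul S p q r x y z f g) h
        = pmul S p q s x y w f (pmul S q r s y z w g h))"

record ('p, 'q, 'u) prof_functor =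
  pfob :: "'p \<Rightarrow> 'q"
  pffun :: "'p \<Rightarrow> ('u, 'u, 'u, 'u) fctr"
  pfhom :: "'p \<Rightarrow> 'p \<Rightarrow> 'u prof_nat"

definition is_prof_functor ::
  "('p, 'u::set_universe) prof_category \<Rightarrow> ('q, 'u) prof_category \<Rightarrow> ('p, 'q, 'u) prof_functor
    \<Rightarrow> bool" where
  "is_prof_functor S S' F \<longleftrightarrow>
     is_prof_category S \<and> is_prof_category S' \<and>
     pfob F \<in> pob S \<rightarrow>\<^sub>E pob S' \<and>
     pffun F \<in> (\<Pi>\<^sub>E p\<in>pob S. {G. is_functor (pcat S p) (pcat S' (pfob F p)) G}) \<and>
     pfhom F = restrict2 (pob S) (pfhom F) \<and>
     (\<forall>p\<in>pob S. \<forall>q\<in>pob S. prof_map (pcat S p) (pcat S q) (phom S p q)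
        (prof_reindex (pcat S p) (pcat S q) (phom S' (pfob F p) (pfob F q)) (pffun F p) (pffun F q))
        (pfhom F p q)) \<and>
     (\<forall>p\<in>pob S. \<forall>x\<in>Obj (pcat S p). \<forall>x'\<in>Obj (pcat S p). \<forall>m\<in>Hom (pcat S p) x x'.
        pfhom F p p (x, x') (pid S p (x, x') m)
        = pid S' (pfob F p) (fob (pffun F p) x, fob (pffun F p) x') (farr (pffun F p) x x' m)) \<and>
     (\<forall>p\<in>pob S. \<forall>q\<in>pob S. \<forall>r\<in>pob S. \<forall>x\<in>Obj (pcat S p). \<forall>y\<in>Obj (pcat S q). \<forall>z\<in>Obj (pcat S r).
        \<forall>f\<in>fob (phom S p q) (x, y). \<forall>g\<in>fob (phom S q r) (y, z).
        pfhom F p r (x, z) (pmul S p q r x y z f g)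
        = pmul S' (pfob F p) (pfob F q) (pfob F r)
            (fob (pffun F p) x) (fob (pffun F q) y) (fob (pffun F r) z)
            (pfhom F p q (x, y) f) (pfhom F q r (y, z) g))"

definition prof_functor_id ::
  "('p, 'u::set_universe) prof_category \<Rightarrow> ('p, 'p, 'u) prof_functor" where
  "prof_functor_id S = \<lparr>pfob = (\<lambda>p\<in>pob S. p), pffun = (\<lambda>p\<in>pob S. id_functor (pcat S p)),
     pfhom = restrict2 (pob S) (\<lambda>p q. \<lambda>xy\<in>Obj (pcat S p) \<times> Obj (pcat S q).
       \<lambda>h\<in>fob (phom S p q) xy. h)\<rparr>"

definition prof_functor_comp ::
  "('p, 'u::set_universe) prof_category \<Rightarrow> ('q, 'r, 'u) prof_functor \<Rightarrow> ('p, 'q, 'u) prof_functor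
    \<Rightarrow> ('p, 'r, 'u) prof_functor" where
  "prof_functor_comp S G F = \<lparr>pfob = (\<lambda>p\<in>pob S. pfob G (pfob F p)),
     pffun = (\<lambda>p\<in>pob S. comp_functor (pcat S p) (pffun G (pfob F p)) (pffun F p)),
     pfhom = restrict2 (pob S) (\<lambda>p q. \<lambda>(x, y)\<in>Obj (pcat S p) \<times> Obj (pcat S q).
       \<lambda>h\<in>fob (phom S p q) (x, y).
         pfhom G (pfob F p) (pfob F q) (fob (pffun F p) x, fob (pffun F q) y)
           (pfhom F p q (x, y) h))\<rparr>"

text \<open>The set of objects of an enriched category may be any HOL set; it is not bounded by the
  universe, since the selection categories have the large set of polynomials as objects.\<close>

definition ProfCat ::
  "(('p, 'u::set_universe) prof_category, ('p, 'p, 'u) prof_functor) category" where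
  "ProfCat = \<lparr>Obj = {S. is_prof_category S}, Hom = (\<lambda>S S'. {F. is_prof_functor S S' F}),
     Ident = prof_functor_id, Comp = (\<lambda>S S' S'' G F. prof_functor_comp S G F)\<rparr>"

section \<open>Selection categories\<close>

definition sel_obj :: "('u::set_universe, 'u) category \<Rightarrow> 'u polyn \<Rightarrow> 'u set" where
  "sel_obj C p = vSigma (Idx p) (\<lambda>i. vPi (Arity p i) (\<lambda>_. Obj C))"

text \<open>For \<open>x = (i, c)\<close> these are \<open>A\<^sub>i\<close> and \<open>c a\<close>.\<close>

definition sel_ar :: "'u::set_universe polyn \<Rightarrow> 'u \<Rightarrow> 'u set" where
  "sel_ar p x = Arity p (vfst x)"

definition sel_at :: "'u::set_universe \<Rightarrow> 'u \<Rightarrow> 'u" where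
  "sel_at x a = vapp (vsnd x) a"

definition sel_hom ::
  "('u::set_universe, 'u) category \<Rightarrow> 'u polyn \<Rightarrow> 'u polyn \<Rightarrow> 'u \<Rightarrow> 'u \<Rightarrow> 'u set" where
  "sel_hom C p q x y =
     vPi (sel_ar q y) (\<lambda>b. vSigma (sel_ar p x) (\<lambda>a. Hom C (sel_at x a) (sel_at y b)))"

definition sel_id :: "('u::set_universe, 'u) category \<Rightarrow> 'u polyn \<Rightarrow> 'u \<Rightarrow> 'u" where
  "sel_id C p x = vlam (sel_ar p x) (\<lambda>a. vpair a (Ident C (sel_at x a)))"

text \<open>\<open>sel_comp C r x y z g f\<close> composes \<open>f\<close> from \<open>x\<close> to \<open>y\<close> with \<open>g\<close> from \<open>y\<close> to \<open>z\<close>, where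
  \<open>z\<close> is an object over \<open>r\<close>; the arities of \<open>x\<close> and \<open>y\<close> do not enter.\<close>

definition sel_comp ::
  "('u::set_universe, 'u) category \<Rightarrow> 'u polyn \<Rightarrow> 'u \<Rightarrow> 'u \<Rightarrow> 'u \<Rightarrow> 'u \<Rightarrow> 'u \<Rightarrow> 'u" where
  "sel_comp C r x y z g f = vlam (sel_ar r z) (\<lambda>k.
     let b = vfst (vapp g k); a = vfst (vapp f b) in
     vpair a (Comp C (sel_at x a) (sel_at y b) (sel_at z k) (vsnd (vapp g k)) (vsnd (vapp f b))))"

definition sel_cat :: "('u::set_universe, 'u) category \<Rightarrow> 'u polyn \<Rightarrow> ('u, 'u) category" where
  "sel_cat C p = \<lparr>Obj = sel_obj C p, Hom = sel_hom C p p, Ident = sel_id C p,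
     Comp = sel_comp C p\<rparr>"

definition sel_prof ::
  "('u::set_universe, 'u) category \<Rightarrow> 'u polyn \<Rightarrow> 'u polyn \<Rightarrow> 'u profunctor" where
  "sel_prof C p q = mk_functor (prod_cat (op_cat (sel_cat C p)) (sel_cat C q))
     (\<lambda>(x, y). sel_hom C p q x y)
     (\<lambda>(x, y) (x', y') (u, v). \<lambda>h\<in>sel_hom C p q x y.
        sel_comp C q x' y y' v (sel_comp C q x' x y h u))"

definition sel_enriched ::
  "('u::set_universe, 'u) category \<Rightarrow> ('u polyn, 'u) prof_category" where
  "sel_enriched C = \<lparr>pob = Obj Poly, pcat = sel_cat C, phom = sel_prof C,
     pid = (\<lambda>p. \<lambda>(x, y)\<in>sel_obj C p \<times> sel_obj C p. \<lambda>h\<in>sel_hom C p p x y. h),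
     pcomp = (\<lambda>p q r. \<lambda>(x, z)\<in>sel_obj C p \<times> sel_obj C r.
       \<lambda>\<kappa>\<in>coend (sel_cat C p) (sel_cat C q) (sel_cat C r) (sel_prof C p q) (sel_prof C q r) x z.
         coend_lift (\<lambda>y f g. sel_comp C r x y z g f) \<kappa>)\<rparr>"

definition sel_map_ob ::
  "('u::set_universe, 'u, 'u, 'u) fctr \<Rightarrow> 'u polyn \<Rightarrow> 'u \<Rightarrow> 'u" where
  "sel_map_ob F p x = vpair (vfst x) (vlam (sel_ar p x) (\<lambda>a. fob F (sel_at x a)))"

definition sel_map_hom ::
  "('u::set_universe, 'u, 'u, 'u) fctr \<Rightarrow> 'u polyn \<Rightarrow> 'u \<Rightarrow> 'u \<Rightarrow> 'u \<Rightarrow> 'u" where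
  "sel_map_hom F q x y h = vlam (sel_ar q y) (\<lambda>b. let a = vfst (vapp h b) in
     vpair a (farr F (sel_at x a) (sel_at y b) (vsnd (vapp h b))))"

definition sel_enriched_map ::
  "('u::set_universe, 'u) category \<Rightarrow> ('u, 'u, 'u, 'u) fctr
    \<Rightarrow> ('u polyn, 'u polyn, 'u) prof_functor" where
  "sel_enriched_map C F = \<lparr>pfob = (\<lambda>p\<in>Obj Poly. p),
     pffun = (\<lambda>p\<in>Obj Poly. mk_functor (sel_cat C p) (sel_map_ob F p) (sel_map_hom F p)),
     pfhom = restrict2 (Obj Poly) (\<lambda>p q. \<lambda>(x, y)\<in>sel_obj C p \<times> sel_obj C q.
       \<lambda>h\<in>sel_hom C p q x y. sel_map_hom F q x y h)\<rparr>"

type_synonym 'u cat_to_prof_cat =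
  "(('u, 'u) category, ('u, 'u, 'u, 'u) fctr,
    ('u polyn, 'u) prof_category, ('u polyn, 'u polyn, 'u) prof_functor) fctr"

definition Selection :: "'u::set_universe cat_to_prof_cat" where
  "Selection = mk_functor Cat sel_enriched (\<lambda>C D F. sel_enriched_map C F)"

end

theory Submission
  imports Defs
begin

text \<open>
  An element of \<open>p (k X)\<close>, for \<open>k\<close> the comonad of a category \<open>C\<close>, is an object \<open>x\<close> of the
  selection category \<open>S\<close> of \<open>p\<close> together with a function \<open>B x \<rightarrow> X\<close>, where \<open>B x\<close> is the set of
  arrows of \<open>C\<close> out of the components of \<open>x\<close>.  The left Kan extension along \<open>p\<close> replaces the
  representing set \<open>B x\<close> by \<open>p (B x)\<close>, and \<open>p (B x)\<close> is the set of arrows out of \<open>x\<close> in \<open>S\<close>.  So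
  the functor underlying the comonad of \<open>S\<close> is itself a left Kan extension of \<open>p k\<close> along \<open>p\<close>;
  its counit and comultiplication satisfy the two equations that characterise those of the Kan
  extension comonad, and uniqueness transports the identification to every other left Kan
  extension.  The enriched structure is composition in \<open>C\<close>, which is constant on coend classes by
  associativity.
\<close>

section \<open>Small sets\<close>

text \<open>Why the Kan extension replaces \<open>B x\<close> by \<open>p (B x)\<close>: the functor
  \<open>p k\<close> is the coproduct over \<open>x\<close> of the representables
  \<open>Set(B x, -)\<close>. By Yoneda a transformation from it to \<open>R p\<close> is a family
  of elements of \<open>R (p (B x))\<close>, and so is a transformation to \<open>R\<close> from the
  coproduct of the \<open>Set(p (B x), -)\<close>. This holds for every endofunctor
  \<open>R\<close>, polynomial or not, as \<open>is_lan\<close> demands. Two obstacles shape the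
  rest. The counit and comultiplication of \<open>lan_comonad\<close> are definite descriptions,
  about which nothing is known until existence and uniqueness are derived from the universal
  property; the comonad laws on \<open>L\<close> are never computed but carried over from the
  selection comonad. And sets, pairs and functions are codes in a universe, while functors and
  transformations are \<open>undefined\<close> off their domains. Elements are therefore brought to
  normal forms such as \<open>vpair i (vlam A g)\<close> with a HOL function \<open>g\<close>, and
  equations of transformations are reduced to elements, so that the actual arguments become
  rewriting of such terms.\<close>

lemma elts_vset [simp]: "small X \<Longrightarrow> elts (vset X) = X"
  unfolding small_def vset_def using inj_elts by (metis (mono_tags, lifting) inj_eq rangeE theI)

lemma vset_inj: "small X \<Longrightarrow> small Y \<Longrightarrow> vset X = vset Y \<longleftrightarrow> X = Y"
  by (metis elts_vset)

lemma smallE: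
  assumes "small X"
  obtains x where "X = elts x"
  using assms unfolding small_def by auto

lemma small_subset: "small Y \<Longrightarrow> X \<subseteq> Y \<Longrightarrow> small X"
  unfolding small_def using separation by (metis imageE)

lemma small_image [simp]: "small X \<Longrightarrow> small (f ` X)" for f :: "'u::set_universe \<Rightarrow> 'u"
  unfolding small_def using replacement by (metis imageE)

lemma small_pair: "small {x, y}"
  unfolding small_def by (rule pairing)

lemma small_singleton [simp]: "small {x}"
  using small_pair[of x x] by simp

lemma small_UN:
  fixes B :: "'u \<Rightarrow> 'u::set_universe set"
  assumes "small A" "\<And>a. a \<in> A \<Longrightarrow> small (B a)"
  shows "small (\<Union>a\<in>A. B a)"
proof -
  \<comment> \<open>The union axiom speaks of a coded family, whereas \<open>B\<close> takes values
    in HOL sets; replacement is therefore applied to the codes \<open>vset (B a)\<close>.\<close>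
  obtain y where y: "(\<lambda>a. vset (B a)) ` A = elts y"
    using assms(1) by (meson small_image smallE)
  have "(\<Union>a\<in>A. B a) = (\<Union>z\<in>elts y. elts z)"
    unfolding y[symmetric] using assms(2) by auto
  then show ?thesis
    using union unfolding small_def by metis
qed

lemma small_codes_of_subsets: "small X \<Longrightarrow> small {y. elts y \<subseteq> X}"
  by (metis powerset smallE small_def)

section \<open>Coded pairs, dependent sums, functions and dependent products\<close>

lemma vpair_eq [simp]: "vpair a b = vpair c d \<longleftrightarrow> a = c \<and> b = d"
proof
  assume "vpair a b = vpair c d"
  then have "{vset {a}, vset {a, b}} = {vset {c}, vset {c, d}}"
    by (simp add: vpair_def vset_inj small_pair)
  moreover have "vset {a} = vset {c} \<longleftrightarrow> {a} = {c}" "vset {a} = vset {c, d} \<longleftrightarrow> {a} = {c, d}"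
    "vset {a, b} = vset {c} \<longleftrightarrow> {a, b} = {c}" "vset {a, b} = vset {c, d} \<longleftrightarrow> {a, b} = {c, d}"
    by (simp_all add: vset_inj small_pair)
  ultimately show "a = c \<and> b = d"
    by (smt (verit) doubleton_eq_iff insert_absorb2)
qed auto

lemma vfst_vpair [simp]: "vfst (vpair a b) = a"
  by (simp add: vfst_def)

lemma vsnd_vpair [simp]: "vsnd (vpair a b) = b"
  by (simp add: vsnd_def)

lemma vpair_in_vSigma [simp]: "vpair a b \<in> vSigma A B \<longleftrightarrow> a \<in> A \<and> b \<in> B a"
  by (auto simp: vSigma_def)

lemma vSigmaE [elim!]:
  assumes "t \<in> vSigma A B"
  obtains a b where "t = vpair a b" "a \<in> A" "b \<in> B a"
  using assms by (auto simp: vSigma_def)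

lemma vfst_in: "t \<in> vSigma A B \<Longrightarrow> vfst t \<in> A"
  and vsnd_in: "t \<in> vSigma A B \<Longrightarrow> vsnd t \<in> B (vfst t)"
  and vpair_vfst_vsnd: "t \<in> vSigma A B \<Longrightarrow> vpair (vfst t) (vsnd t) = t"
  by auto

lemma small_vSigma:
  assumes "small A" "\<And>a. a \<in> A \<Longrightarrow> small (B a)"
  shows "small (vSigma A B)"
proof -
  have "vSigma A B = (\<Union>a\<in>A. vpair a ` B a)"
    by (auto simp: vSigma_def)
  then show ?thesis
    using assms by (simp add: small_UN)
qed

lemma elts_vlam: "small A \<Longrightarrow> elts (vlam A f) = (\<lambda>x. vpair x (f x)) ` A"
  by (simp add: vlam_def)

lemma vapp_vlam [simp]: "small A \<Longrightarrow> a \<in> A \<Longrightarrow> vapp (vlam A f) a = f a"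
  by (auto simp: vapp_def elts_vlam)

text \<open>As a congruence rule it lets the simplifier use membership in the domain while it
  rewrites the body. Almost all later computations with coded functions take place under this
  binder.\<close>

lemma vlam_cong [cong]:
  assumes "A = A'" "\<And>a. a \<in> A' \<Longrightarrow> f a = g a"
  shows "vlam A f = vlam A' g"
proof -
  have "(\<lambda>x. vpair x (f x)) ` A = (\<lambda>x. vpair x (g x)) ` A'"
    by (rule image_cong) (use assms in simp_all)
  then show ?thesis
    by (simp only: vlam_def)
qed

lemma vlam_eq:
  assumes "small A"
  shows "vlam A f = vlam A g \<longleftrightarrow> (\<forall>a\<in>A. f a = g a)"
proof
  assume *: "vlam A f = vlam A g"
  show "\<forall>a\<in>A. f a = g a"
  proof
    fix a assume a: "a \<in> A"
    have "vapp (vlam A f) a = vapp (vlam A g) a"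
      by (simp only: *)
    then show "f a = g a"
      using assms a by simp
  qed
qed (auto intro: vlam_cong)

lemma vlam_in_vPi: "(\<And>a. a \<in> A \<Longrightarrow> f a \<in> B a) \<Longrightarrow> vlam A f \<in> vPi A B"
  by (auto simp: vPi_def)

lemma vlam_in_vPi_iff [simp]: "small A \<Longrightarrow> vlam A f \<in> vPi A B \<longleftrightarrow> (\<forall>a\<in>A. f a \<in> B a)"
  by (auto simp: vPi_def vlam_eq)

lemma vapp_in: "small A \<Longrightarrow> g \<in> vPi A B \<Longrightarrow> a \<in> A \<Longrightarrow> vapp g a \<in> B a"
  by (auto simp: vPi_def)

lemma vlam_vapp: "small A \<Longrightarrow> g \<in> vPi A B \<Longrightarrow> vlam A (vapp g) = g"
  by (auto simp: vPi_def vlam_eq)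

text \<open>A coded function is the code of its graph, a subset of the dependent sum, so the
  powerset axiom bounds the product.\<close>

lemma small_vPi:
  assumes "small A" "\<And>a. a \<in> A \<Longrightarrow> small (B a)"
  shows "small (vPi A B)"
proof (rule small_subset)
  show "small {y. elts y \<subseteq> vSigma A B}"
    by (intro small_codes_of_subsets small_vSigma assms)
  show "vPi A B \<subseteq> {y. elts y \<subseteq> vSigma A B}"
    using assms(1) by (auto simp: vPi_def elts_vlam)
qed

section \<open>Categories and functors\<close>

lemma is_categoryI:
  assumes "\<And>a. a \<in> Obj C \<Longrightarrow> Ident C a \<in> Hom C a a"
    and "\<And>a b c f g. a \<in> Obj C \<Longrightarrow> b \<in> Obj C \<Longrightarrow> c \<in> Obj C \<Longrightarrow> f \<in> Hom C a b \<Longrightarrow> g \<in> Hom C b c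
      \<Longrightarrow> Comp C a b c g f \<in> Hom C a c"
    and "\<And>a b f. a \<in> Obj C \<Longrightarrow> b \<in> Obj C \<Longrightarrow> f \<in> Hom C a b \<Longrightarrow> Comp C a a b f (Ident C a) = f"
    and "\<And>a b f. a \<in> Obj C \<Longrightarrow> b \<in> Obj C \<Longrightarrow> f \<in> Hom C a b \<Longrightarrow> Comp C a b b (Ident C b) f = f"
    and "\<And>a b c d f g h. a \<in> Obj C \<Longrightarrow> b \<in> Obj C \<Longrightarrow> c \<in> Obj C \<Longrightarrow> d \<in> Obj C
      \<Longrightarrow> f \<in> Hom C a b \<Longrightarrow> g \<in> Hom C b c \<Longrightarrow> h \<in> Hom C c d
      \<Longrightarrow> Comp C a c d h (Comp C a b c g f) = Comp C a b d (Comp C b c d h g) f"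
  shows "is_category C"
  using assms by (simp add: is_category_def)

context
  fixes C :: "('o, 'm) category"
  assumes C: "is_category C"
begin

lemma Ident_in: "a \<in> Obj C \<Longrightarrow> Ident C a \<in> Hom C a a"
  using C by (simp add: is_category_def)

lemma Comp_in:
  "f \<in> Hom C a b \<Longrightarrow> g \<in> Hom C b c \<Longrightarrow> a \<in> Obj C \<Longrightarrow> b \<in> Obj C \<Longrightarrow> c \<in> Obj C
    \<Longrightarrow> Comp C a b c g f \<in> Hom C a c"
  using C by (simp add: is_category_def)

lemma Comp_Ident_right:
  "f \<in> Hom C a b \<Longrightarrow> a \<in> Obj C \<Longrightarrow> b \<in> Obj C \<Longrightarrow> Comp C a a b f (Ident C a) = f"
  using C by (simp add: is_category_def)

lemma Comp_Ident_left:
  "f \<in> Hom C a b \<Longrightarrow> a \<in> Obj C \<Longrightarrow> b \<in> Obj C \<Longrightarrow> Comp C a b b (Ident C b) f = f"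
  using C by (simp add: is_category_def)

lemma Comp_assoc:
  "f \<in> Hom C a b \<Longrightarrow> g \<in> Hom C b c \<Longrightarrow> h \<in> Hom C c d
    \<Longrightarrow> a \<in> Obj C \<Longrightarrow> b \<in> Obj C \<Longrightarrow> c \<in> Obj C \<Longrightarrow> d \<in> Obj C
    \<Longrightarrow> Comp C a b d (Comp C b c d h g) f = Comp C a c d h (Comp C a b c g f)"
  using C by (simp add: is_category_def)

end

lemma fob_mk_functor [simp]: "a \<in> Obj C \<Longrightarrow> fob (mk_functor C F0 F1) a = F0 a"
  by (simp add: mk_functor_def)

lemma farr_mk_functor [simp]:
  "a \<in> Obj C \<Longrightarrow> b \<in> Obj C \<Longrightarrow> f \<in> Hom C a b \<Longrightarrow> farr (mk_functor C F0 F1) a b f = F1 a b f"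
  by (simp add: mk_functor_def restrict2_def)

lemma mk_functor_is_functor:
  assumes "is_category C" "is_category D"
    and "\<And>a. a \<in> Obj C \<Longrightarrow> F0 a \<in> Obj D"
    and "\<And>a b f. a \<in> Obj C \<Longrightarrow> b \<in> Obj C \<Longrightarrow> f \<in> Hom C a b \<Longrightarrow> F1 a b f \<in> Hom D (F0 a) (F0 b)"
    and "\<And>a. a \<in> Obj C \<Longrightarrow> F1 a a (Ident C a) = Ident D (F0 a)"
    and "\<And>a b c f g. a \<in> Obj C \<Longrightarrow> b \<in> Obj C \<Longrightarrow> c \<in> Obj C \<Longrightarrow> f \<in> Hom C a b \<Longrightarrow> g \<in> Hom C b c
      \<Longrightarrow> F1 a c (Comp C a b c g f) = Comp D (F0 a) (F0 b) (F0 c) (F1 b c g) (F1 a b f)"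
  shows "is_functor C D (mk_functor C F0 F1)"
  using assms unfolding is_functor_def
  by (auto simp: Ident_in Comp_in mk_functor_def restrict2_def fun_eq_iff)

context
  fixes C :: "('o, 'm) category" and D :: "('p, 'n) category" and F
  assumes F: "is_functor C D F"
begin

lemma functor_dom: "is_category C" and functor_cod: "is_category D"
  using F by (simp_all add: is_functor_def)

lemma fob_in: "a \<in> Obj C \<Longrightarrow> fob F a \<in> Obj D"
  using F by (auto simp: is_functor_def)

lemma farr_in:
  "f \<in> Hom C a b \<Longrightarrow> a \<in> Obj C \<Longrightarrow> b \<in> Obj C \<Longrightarrow> farr F a b f \<in> Hom D (fob F a) (fob F b)"
  using F by (auto simp: is_functor_def)

lemma farr_Ident: "a \<in> Obj C \<Longrightarrow> farr F a a (Ident C a) = Ident D (fob F a)"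
  using F by (simp add: is_functor_def)

lemma farr_Comp:
  "f \<in> Hom C a b \<Longrightarrow> g \<in> Hom C b c \<Longrightarrow> a \<in> Obj C \<Longrightarrow> b \<in> Obj C \<Longrightarrow> c \<in> Obj C
    \<Longrightarrow> farr F a c (Comp C a b c g f)
      = Comp D (fob F a) (fob F b) (fob F c) (farr F b c g) (farr F a b f)"
  using F by (simp add: is_functor_def)

text \<open>Restriction changes nothing, because a functor is already \<open>undefined\<close> off
  its domain. This turns agreement on objects and arrows into equality of records in
  \<open>functor_eqI\<close>.\<close>

lemma functor_as_mk_functor: "F = mk_functor C (fob F) (farr F)"
proof -
  have 1: "fob F = restrict (fob F) (Obj C)"
    using F by (metis PiE_restrict is_functor_def)
  have 2: "farr F = restrict2 (Obj C) (farr F)"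
    using F by (simp add: is_functor_def)
  have 3: "farr F a b = restrict (farr F a b) (Hom C a b)" if "a \<in> Obj C" "b \<in> Obj C" for a b
    using F that unfolding is_functor_def by (intro PiE_restrict[symmetric]) blast
  have "farr F = restrict2 (Obj C) (\<lambda>a b. restrict (farr F a b) (Hom C a b))"
    by (subst 2) (use 3 in \<open>auto simp: restrict2_def fun_eq_iff\<close>)
  with 1 show ?thesis
    by (simp add: mk_functor_def)
qed

end

lemma mk_functor_cong:
  assumes "\<And>a. a \<in> Obj C \<Longrightarrow> F0 a = G0 a"
    and "\<And>a b f. a \<in> Obj C \<Longrightarrow> b \<in> Obj C \<Longrightarrow> f \<in> Hom C a b \<Longrightarrow> F1 a b f = G1 a b f"
  shows "mk_functor C F0 F1 = mk_functor C G0 G1"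
  using assms by (auto simp: mk_functor_def restrict2_def fun_eq_iff)

lemma functor_eqI:
  assumes "is_functor C D F" "is_functor C D' G"
    and "\<And>a. a \<in> Obj C \<Longrightarrow> fob F a = fob G a"
    and "\<And>a b f. a \<in> Obj C \<Longrightarrow> b \<in> Obj C \<Longrightarrow> f \<in> Hom C a b \<Longrightarrow> farr F a b f = farr G a b f"
  shows "F = G"
  by (subst functor_as_mk_functor[OF assms(1)], subst functor_as_mk_functor[OF assms(2)])
    (simp add: assms(3,4) cong: mk_functor_cong)

lemma fob_id_functor [simp]: "a \<in> Obj C \<Longrightarrow> fob (id_functor C) a = a"
  and farr_id_functor [simp]:
    "a \<in> Obj C \<Longrightarrow> b \<in> Obj C \<Longrightarrow> f \<in> Hom C a b \<Longrightarrow> farr (id_functor C) a b f = f"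
  by (simp_all add: id_functor_def)

lemma fob_comp_functor [simp]: "a \<in> Obj C \<Longrightarrow> fob (comp_functor C G F) a = fob G (fob F a)"
  and farr_comp_functor [simp]: "a \<in> Obj C \<Longrightarrow> b \<in> Obj C \<Longrightarrow> f \<in> Hom C a b
    \<Longrightarrow> farr (comp_functor C G F) a b f = farr G (fob F a) (fob F b) (farr F a b f)"
  by (simp_all add: comp_functor_def)

lemma id_functor_is_functor: "is_category C \<Longrightarrow> is_functor C C (id_functor C)"
  unfolding id_functor_def by (rule mk_functor_is_functor) simp_all

lemma comp_functor_is_functor:
  assumes F: "is_functor C D F" and G: "is_functor D E G"
  shows "is_functor C E (comp_functor C G F)"
  unfolding comp_functor_def
  by (rule mk_functor_is_functor)
    (simp_all add: functor_dom[OF F] functor_cod[OF G] fob_in[OF F] fob_in[OF G] farr_in[OF F]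
      farr_in[OF G] farr_Ident[OF F] farr_Ident[OF G] farr_Comp[OF F] farr_Comp[OF G])

lemma comp_functor_id_right: "is_functor C D F \<Longrightarrow> comp_functor C F (id_functor C) = F"
  by (rule functor_eqI[where C = C])
    (auto intro: comp_functor_is_functor id_functor_is_functor functor_dom)

lemma comp_functor_id_left:
  assumes F: "is_functor C D F"
  shows "comp_functor C (id_functor D) F = F"
  by (rule functor_eqI[OF comp_functor_is_functor[OF F id_functor_is_functor[OF functor_cod[OF F]]] F])
    (simp_all add: fob_in[OF F] farr_in[OF F])

lemma comp_functor_assoc:
  assumes F: "is_functor C D F" and G: "is_functor D E G" and H: "is_functor E E' H"
  shows "comp_functor C H (comp_functor C G F) = comp_functor C (comp_functor D H G) F"
  by (rule functor_eqI[OF comp_functor_is_functor[OF comp_functor_is_functor[OF F G] H]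
        comp_functor_is_functor[OF F comp_functor_is_functor[OF G H]]])
    (simp_all add: fob_in[OF F] farr_in[OF F])

section \<open>Opposite and product categories, and the category of small categories\<close>

lemma op_cat_simps [simp]:
  "Obj (op_cat C) = Obj C" "Hom (op_cat C) a b = Hom C b a" "Ident (op_cat C) = Ident C"
  "Comp (op_cat C) a b c g f = Comp C c b a f g"
  by (simp_all add: op_cat_def)

lemma prod_cat_simps [simp]:
  "Obj (prod_cat C D) = Obj C \<times> Obj D"
  "Hom (prod_cat C D) (a, b) (a', b') = Hom C a a' \<times> Hom D b b'"
  "Ident (prod_cat C D) (a, b) = (Ident C a, Ident D b)"
  "Comp (prod_cat C D) (a, b) (a', b') (a'', b'') (g, g') (f, f')
    = (Comp C a a' a'' g f, Comp D b b' b'' g' f')"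
  by (simp_all add: prod_cat_def)

lemma op_cat_is_category: "is_category C \<Longrightarrow> is_category (op_cat C)"
  by (rule is_categoryI)
    (simp_all add: Ident_in Comp_in Comp_Ident_left Comp_Ident_right Comp_assoc)

lemma prod_cat_is_category: "is_category C \<Longrightarrow> is_category D \<Longrightarrow> is_category (prod_cat C D)"
  by (rule is_categoryI)
    (auto simp: Ident_in Comp_in Comp_Ident_left Comp_Ident_right Comp_assoc)

lemma small_category_is_category: "is_small_category C \<Longrightarrow> is_category C"
  by (simp add: is_small_category_def)

lemma Cat_simps [simp]:
  "C \<in> Obj Cat \<longleftrightarrow> is_small_category C" "F \<in> Hom Cat C D \<longleftrightarrow> is_functor C D F"
  "Ident Cat C = id_functor C" "Comp Cat C D E G F = comp_functor C G F"
  by (simp_all add: Cat_def)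

lemma Cat_is_category: "is_category Cat"
  by (rule is_categoryI)
    (auto simp: comp_functor_id_left comp_functor_id_right comp_functor_assoc
      intro: id_functor_is_functor comp_functor_is_functor small_category_is_category)

section \<open>Set-valued functors\<close>

lemma Set_cat_simps [simp]:
  "X \<in> Obj Set_cat \<longleftrightarrow> small X" "Hom Set_cat X Y = X \<rightarrow>\<^sub>E Y" "Ident Set_cat X = (\<lambda>x\<in>X. x)"
  "Comp Set_cat X Y Z g f = compose X g f"
  by (simp_all add: Set_cat_def)

lemma Set_cat_is_category: "is_category Set_cat"
  by (rule is_categoryI) (auto simp: compose_def fun_eq_iff PiE_iff extensional_def)

text \<open>Identities and composites in \<open>Set_cat\<close> are extensional functions, and so is
  each \<open>F1 a b f\<close>; hence the functor laws need checking on elements only.\<close>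

lemma Set_valued_functorI:
  assumes "is_category C"
    and "\<And>a. a \<in> Obj C \<Longrightarrow> small (F0 a)"
    and "\<And>a b f. a \<in> Obj C \<Longrightarrow> b \<in> Obj C \<Longrightarrow> f \<in> Hom C a b \<Longrightarrow> F1 a b f \<in> F0 a \<rightarrow>\<^sub>E F0 b"
    and "\<And>a x. a \<in> Obj C \<Longrightarrow> x \<in> F0 a \<Longrightarrow> F1 a a (Ident C a) x = x"
    and "\<And>a b c f g x. a \<in> Obj C \<Longrightarrow> b \<in> Obj C \<Longrightarrow> c \<in> Obj C \<Longrightarrow> f \<in> Hom C a b \<Longrightarrow> g \<in> Hom C b c
      \<Longrightarrow> x \<in> F0 a \<Longrightarrow> F1 a c (Comp C a b c g f) x = F1 b c g (F1 a b f x)"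
  shows "is_functor C Set_cat (mk_functor C F0 F1)"
proof (rule mk_functor_is_functor)
  fix a assume a: "a \<in> Obj C"
  then have "F1 a a (Ident C a) \<in> F0 a \<rightarrow>\<^sub>E F0 a"
    by (simp add: assms(1,3) Ident_in)
  then show "F1 a a (Ident C a) = Ident Set_cat (F0 a)"
    using assms(4)[OF a] by (auto simp: fun_eq_iff PiE_iff extensional_def)
next
  fix a b c f g
  assume *: "a \<in> Obj C" "b \<in> Obj C" "c \<in> Obj C" "f \<in> Hom C a b" "g \<in> Hom C b c"
  then have "F1 a c (Comp C a b c g f) \<in> F0 a \<rightarrow>\<^sub>E F0 c"
    by (simp add: assms(1,3) Comp_in)
  then show "F1 a c (Comp C a b c g f) = Comp Set_cat (F0 a) (F0 b) (F0 c) (F1 b c g) (F1 a b f)"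
    using assms(5)[OF *] by (auto simp: fun_eq_iff PiE_iff extensional_def compose_def)
qed (use assms in \<open>auto simp: Set_cat_is_category\<close>)

context
  fixes C :: "('o, 'm) category" and F :: "('o, 'm, 'u::set_universe set, 'u \<Rightarrow> 'u) fctr"
  assumes F: "is_functor C Set_cat F"
begin

lemma fob_small: "a \<in> Obj C \<Longrightarrow> small (fob F a)"
  using fob_in[OF F] by simp

lemma farr_PiE:
  "f \<in> Hom C a b \<Longrightarrow> a \<in> Obj C \<Longrightarrow> b \<in> Obj C \<Longrightarrow> farr F a b f \<in> fob F a \<rightarrow>\<^sub>E fob F b"
  using farr_in[OF F] by simp

lemma farr_app_in:
  "f \<in> Hom C a b \<Longrightarrow> x \<in> fob F a \<Longrightarrow> a \<in> Obj C \<Longrightarrow> b \<in> Obj C \<Longrightarrow> farr F a b f x \<in> fob F b"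
  using farr_PiE by blast

lemma farr_Ident_app: "x \<in> fob F a \<Longrightarrow> a \<in> Obj C \<Longrightarrow> farr F a a (Ident C a) x = x"
  by (simp add: farr_Ident[OF F])

lemma farr_Comp_app:
  "f \<in> Hom C a b \<Longrightarrow> g \<in> Hom C b c \<Longrightarrow> x \<in> fob F a \<Longrightarrow> a \<in> Obj C \<Longrightarrow> b \<in> Obj C \<Longrightarrow> c \<in> Obj C
    \<Longrightarrow> farr F a c (Comp C a b c g f) x = farr F b c g (farr F a b f x)"
  by (simp add: farr_Comp[OF F] compose_eq)

end

lemma Set_nat_transI:
  assumes F: "is_functor C Set_cat F" and G: "is_functor C Set_cat G"
    and \<alpha>: "\<alpha> \<in> extensional (Obj C)"
    and ext: "\<And>a. a \<in> Obj C \<Longrightarrow> \<alpha> a \<in> extensional (fob F a)"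
    and app: "\<And>a x. a \<in> Obj C \<Longrightarrow> x \<in> fob F a \<Longrightarrow> \<alpha> a x \<in> fob G a"
    and nat: "\<And>a b f x. a \<in> Obj C \<Longrightarrow> b \<in> Obj C \<Longrightarrow> f \<in> Hom C a b \<Longrightarrow> x \<in> fob F a
      \<Longrightarrow> \<alpha> b (farr F a b f x) = farr G a b f (\<alpha> a x)"
  shows "nat_trans C Set_cat F G \<alpha>"
  unfolding nat_trans_def using assms by (auto simp: compose_def fun_eq_iff PiE_iff)

context
  fixes C :: "('o, 'm) category" and F G :: "('o, 'm, 'u::set_universe set, 'u \<Rightarrow> 'u) fctr" and \<alpha>
  assumes \<alpha>: "nat_trans C Set_cat F G \<alpha>"
begin

lemma nat_trans_dom: "is_functor C Set_cat F" and nat_trans_cod: "is_functor C Set_cat G"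
  using \<alpha> by (simp_all add: nat_trans_def)

lemma nat_trans_ext: "\<alpha> \<in> extensional (Obj C)"
  using \<alpha> by (auto simp: nat_trans_def PiE_iff)

lemma nat_trans_PiE: "a \<in> Obj C \<Longrightarrow> \<alpha> a \<in> fob F a \<rightarrow>\<^sub>E fob G a"
  using \<alpha> by (auto simp: nat_trans_def)

lemma nat_trans_app_in: "x \<in> fob F a \<Longrightarrow> a \<in> Obj C \<Longrightarrow> \<alpha> a x \<in> fob G a"
  using nat_trans_PiE by blast

lemma nat_trans_natural:
  assumes "f \<in> Hom C a b" "x \<in> fob F a" "a \<in> Obj C" "b \<in> Obj C"
  shows "\<alpha> b (farr F a b f x) = farr G a b f (\<alpha> a x)"
proof -
  have "compose (fob F a) (\<alpha> b) (farr F a b f) x = compose (fob F a) (farr G a b f) (\<alpha> a) x"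
    using \<alpha> assms by (simp add: nat_trans_def)
  then show ?thesis
    using assms(2) by (simp add: compose_eq)
qed

end

text \<open>Two layers of extensionality are involved: the family is \<open>undefined\<close> off
  \<open>O'\<close>, and each component is \<open>undefined\<close> off \<open>F a\<close>.\<close>

lemma Set_family_eqI:
  assumes "\<alpha> \<in> extensional O'" "\<beta> \<in> extensional O'"
    and "\<And>a. a \<in> O' \<Longrightarrow> \<alpha> a \<in> extensional (F a)" "\<And>a. a \<in> O' \<Longrightarrow> \<beta> a \<in> extensional (F a)"
    and "\<And>a x. a \<in> O' \<Longrightarrow> x \<in> F a \<Longrightarrow> \<alpha> a x = \<beta> a x"
  shows "\<alpha> = \<beta>"
proof (rule extensionalityI[OF assms(1,2)])
  fix a assume "a \<in> O'"
  then show "\<alpha> a = \<beta> a"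
    using assms(3-5) by (blast intro: extensionalityI)
qed

lemma nat_trans_eqI:
  assumes "nat_trans C Set_cat F G \<alpha>" "nat_trans C Set_cat F G' \<beta>"
    and "\<And>a x. a \<in> Obj C \<Longrightarrow> x \<in> fob F a \<Longrightarrow> \<alpha> a x = \<beta> a x"
  shows "\<alpha> = \<beta>"
  by (rule Set_family_eqI[where F = "fob F" and O' = "Obj C"])
    (use assms nat_trans_PiE[OF assms(1)] nat_trans_PiE[OF assms(2)] in
      \<open>auto simp: nat_trans_ext[OF assms(1)] nat_trans_ext[OF assms(2)] PiE_iff\<close>)

section \<open>Polynomial functors\<close>

lemma Poly_small_Idx: "p \<in> Obj Poly \<Longrightarrow> small (Idx p)"
  and Poly_small_Arity: "p \<in> Obj Poly \<Longrightarrow> i \<in> Idx p \<Longrightarrow> small (Arity p i)"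
  by (auto simp: Poly_def)

lemma fob_poly_functor [simp]:
  "small X \<Longrightarrow> fob (poly_functor p) X = vSigma (Idx p) (\<lambda>i. vPi (Arity p i) (\<lambda>_. X))"
  by (simp add: poly_functor_def)

lemma farr_poly_functor:
  assumes "p \<in> Obj Poly" "small X" "small Y" "f \<in> X \<rightarrow>\<^sub>E Y" "i \<in> Idx p"
    and "\<And>a. a \<in> Arity p i \<Longrightarrow> g a \<in> X"
  shows "farr (poly_functor p) X Y f (vpair i (vlam (Arity p i) g))
    = vpair i (vlam (Arity p i) (\<lambda>a. f (g a)))"
  using assms by (simp add: poly_functor_def Poly_small_Arity)

lemma poly_elemE:
  assumes "t \<in> fob (poly_functor p) X" "small X"
  obtains i g where "t = vpair i (vlam (Arity p i) g)" "i \<in> Idx p" "\<And>a. a \<in> Arity p i \<Longrightarrow> g a \<in> X"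
  using assms by (auto simp: vPi_def)

lemma poly_functor_is_functor:
  assumes p: "p \<in> Obj Poly"
  shows "is_functor Set_cat Set_cat (poly_functor p)"
  unfolding poly_functor_def
proof (rule Set_valued_functorI, goal_cases)
  case 1
  show ?case by (rule Set_cat_is_category)
next
  case (2 X)
  then show ?case
    by (simp add: small_vSigma small_vPi Poly_small_Idx[OF p] Poly_small_Arity[OF p])
next
  case (3 X Y f)
  then show ?case
    by (fastforce intro!: vlam_in_vPi dest: vapp_in[OF Poly_small_Arity[OF p]])
next
  case (4 X t)
  then obtain i g where "t = vpair i g" "i \<in> Idx p" "g \<in> vPi (Arity p i) (\<lambda>_. X)" by auto
  then show ?case
    using vlam_vapp[OF Poly_small_Arity[OF p]] vapp_in[OF Poly_small_Arity[OF p], of i g "\<lambda>_. X"]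
    by simp
next
  case (5 X Y Z f g t)
  then obtain i h where "t = vpair i h" "i \<in> Idx p" "h \<in> vPi (Arity p i) (\<lambda>_. X)" by auto
  moreover have "f x \<in> Y" if "x \<in> X" for x
    using 5 that by auto
  ultimately show ?case
    using vapp_in[OF Poly_small_Arity[OF p], of i h "\<lambda>_. X"] by (simp add: Poly_small_Arity[OF p] compose_eq)
qed

section \<open>Selection categories\<close>

lemma out_small: "is_small_category C \<Longrightarrow> c \<in> Obj C \<Longrightarrow> small (out C c)"
  unfolding out_def by (rule small_vSigma) (auto simp: is_small_category_def)

lemma vpair_in_out [simp]: "vpair c' f \<in> out C c \<longleftrightarrow> c' \<in> Obj C \<and> f \<in> Hom C c c'"
  by (simp add: out_def)

lemma outE:
  assumes "m \<in> out C c"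
  obtains c' f where "m = vpair c' f" "c' \<in> Obj C" "f \<in> Hom C c c'"
  using assms by (auto simp: out_def)

lemma sel_ar_vpair [simp]: "sel_ar p (vpair i c) = Arity p i"
  by (simp add: sel_ar_def)

lemma sel_at_vpair [simp]: "sel_at (vpair i c) a = vapp c a"
  by (simp add: sel_at_def)

lemma small_sel_ar: "p \<in> Obj Poly \<Longrightarrow> x \<in> sel_obj C p \<Longrightarrow> small (sel_ar p x)"
  by (auto simp: sel_obj_def Poly_small_Arity)

lemma sel_at_in: "p \<in> Obj Poly \<Longrightarrow> x \<in> sel_obj C p \<Longrightarrow> a \<in> sel_ar p x \<Longrightarrow> sel_at x a \<in> Obj C"
  by (auto simp: sel_obj_def intro: vapp_in[OF Poly_small_Arity])

lemma sel_obj_eta: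
  "p \<in> Obj Poly \<Longrightarrow> x \<in> sel_obj C p \<Longrightarrow> vpair (vfst x) (vlam (sel_ar p x) (sel_at x)) = x"
  unfolding sel_ar_def sel_at_def sel_obj_def
  by (auto simp: vlam_vapp[OF Poly_small_Arity])

text \<open>An element of the universe need not be a pair, so the conditions on the two projections
  of \<open>h b\<close> come with the statement that \<open>h b\<close> is the pair of them.\<close>

lemma vlam_in_sel_hom:
  "(\<And>b. b \<in> sel_ar q y \<Longrightarrow> vfst (h b) \<in> sel_ar p x \<and> h b = vpair (vfst (h b)) (vsnd (h b))
      \<and> vsnd (h b) \<in> Hom C (sel_at x (vfst (h b))) (sel_at y b))
    \<Longrightarrow> vlam (sel_ar q y) h \<in> sel_hom C p q x y"
  unfolding sel_hom_def by (rule vlam_in_vPi) (metis vpair_in_vSigma)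

context
  fixes C :: "('u::set_universe, 'u) category" and p q :: "'u polyn" and x y h
  assumes q: "q \<in> Obj Poly" and y: "y \<in> sel_obj C q" and h: "h \<in> sel_hom C p q x y"
begin

lemma sel_hom_vapp:
  assumes "b \<in> sel_ar q y"
  shows "vapp h b \<in> vSigma (sel_ar p x) (\<lambda>a. Hom C (sel_at x a) (sel_at y b))"
  using assms h unfolding sel_hom_def by (rule vapp_in[OF small_sel_ar[OF q y], rotated])

lemma sel_hom_fst: "b \<in> sel_ar q y \<Longrightarrow> vfst (vapp h b) \<in> sel_ar p x"
  using sel_hom_vapp by (rule vfst_in)

lemma sel_hom_snd:
  "b \<in> sel_ar q y \<Longrightarrow> vsnd (vapp h b) \<in> Hom C (sel_at x (vfst (vapp h b))) (sel_at y b)"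
  using sel_hom_vapp by (rule vsnd_in)

lemma sel_hom_vpair: "b \<in> sel_ar q y \<Longrightarrow> vpair (vfst (vapp h b)) (vsnd (vapp h b)) = vapp h b"
  using sel_hom_vapp by (rule vpair_vfst_vsnd)

lemma sel_hom_eta: "vlam (sel_ar q y) (vapp h) = h"
  using h unfolding sel_hom_def by (rule vlam_vapp[OF small_sel_ar[OF q y]])

end

section \<open>Identities and composites of selection arrows\<close>

lemma sel_comp_vapp:
  assumes "r \<in> Obj Poly" "z \<in> sel_obj C r" "k \<in> sel_ar r z"
  shows "vapp (sel_comp C r x y z g f) k =
    (let b = vfst (vapp g k); a = vfst (vapp f b) in
     vpair a (Comp C (sel_at x a) (sel_at y b) (sel_at z k) (vsnd (vapp g k)) (vsnd (vapp f b))))"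
  unfolding sel_comp_def using assms by (simp add: small_sel_ar)

lemma sel_id_vapp:
  assumes "p \<in> Obj Poly" "x \<in> sel_obj C p" "a \<in> sel_ar p x"
  shows "vapp (sel_id C p x) a = vpair a (Ident C (sel_at x a))"
  unfolding sel_id_def using assms by (simp add: small_sel_ar)

context
  fixes C :: "('u::set_universe, 'u) category"
  assumes C: "is_category C"
begin

lemma sel_id_in:
  assumes "p \<in> Obj Poly" "x \<in> sel_obj C p"
  shows "sel_id C p x \<in> sel_hom C p p x x"
  unfolding sel_id_def by (rule vlam_in_sel_hom) (simp add: Ident_in[OF C] sel_at_in[OF assms])

text \<open>The three polynomials are independent: when all are equal this is composition inside a
  selection category, when two are equal it is one of the actions on the profunctor, and in general
  it is the enriched composition.\<close>

lemma sel_comp_in: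
  assumes P: "p \<in> Obj Poly" "q \<in> Obj Poly" "r \<in> Obj Poly"
    and x: "x \<in> sel_obj C p" "y \<in> sel_obj C q" "z \<in> sel_obj C r"
    and f: "f \<in> sel_hom C p q x y" and g: "g \<in> sel_hom C q r y z"
  shows "sel_comp C r x y z g f \<in> sel_hom C p r x z"
  unfolding sel_comp_def Let_def
  by (rule vlam_in_sel_hom)
    (simp add: sel_hom_fst[OF P(3) x(3) g] sel_hom_fst[OF P(2) x(2) f]
      Comp_in[OF C] sel_hom_snd[OF P(3) x(3) g] sel_hom_snd[OF P(2) x(2) f]
      sel_at_in[OF P(1) x(1)] sel_at_in[OF P(2) x(2)] sel_at_in[OF P(3) x(3)])

lemma sel_comp_id_right:
  assumes P: "p \<in> Obj Poly" "q \<in> Obj Poly" and x: "x \<in> sel_obj C p" "y \<in> sel_obj C q"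
    and h: "h \<in> sel_hom C p q x y"
  shows "sel_comp C q x x y h (sel_id C p x) = h"
proof -
  have "sel_comp C q x x y h (sel_id C p x) = vlam (sel_ar q y) (vapp h)"
    unfolding sel_comp_def Let_def
    by (rule vlam_cong) (simp_all add: sel_id_vapp[OF P(1) x(1)] sel_hom_fst[OF P(2) x(2) h]
      Comp_Ident_right[OF C sel_hom_snd[OF P(2) x(2) h]]
      sel_at_in[OF P(1) x(1)] sel_at_in[OF P(2) x(2)] sel_hom_vpair[OF P(2) x(2) h])
  then show ?thesis
    by (simp add: sel_hom_eta[OF P(2) x(2) h])
qed

lemma sel_comp_id_left:
  assumes P: "p \<in> Obj Poly" "q \<in> Obj Poly" and x: "x \<in> sel_obj C p" "y \<in> sel_obj C q"
    and h: "h \<in> sel_hom C p q x y"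
  shows "sel_comp C q x y y (sel_id C q y) h = h"
proof -
  have "sel_comp C q x y y (sel_id C q y) h = vlam (sel_ar q y) (vapp h)"
    unfolding sel_comp_def Let_def
    by (rule vlam_cong) (simp_all add: sel_id_vapp[OF P(2) x(2)] sel_hom_fst[OF P(2) x(2) h]
      Comp_Ident_left[OF C sel_hom_snd[OF P(2) x(2) h]]
      sel_at_in[OF P(1) x(1)] sel_at_in[OF P(2) x(2)] sel_hom_vpair[OF P(2) x(2) h])
  then show ?thesis
    by (simp add: sel_hom_eta[OF P(2) x(2) h])
qed

text \<open>Both sides have the same underlying map of arities, read backwards from \<open>w\<close>
  to \<open>x\<close>, and over each index the claim is associativity in \<open>C\<close>. With four
  independent polynomials it serves associativity in the selection categories, bifunctoriality of
  the profunctors, the coend relation and enriched associativity alike.\<close>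

lemma sel_comp_assoc:
  assumes P: "p \<in> Obj Poly" "q \<in> Obj Poly" "r \<in> Obj Poly" "s \<in> Obj Poly"
    and x: "x \<in> sel_obj C p" "y \<in> sel_obj C q" "z \<in> sel_obj C r" "w \<in> sel_obj C s"
    and f: "f \<in> sel_hom C p q x y" and g: "g \<in> sel_hom C q r y z" and h: "h \<in> sel_hom C r s z w"
  shows "sel_comp C s x y w (sel_comp C s y z w h g) f
    = sel_comp C s x z w h (sel_comp C r x y z g f)"
  unfolding sel_comp_def[of C s x y w] sel_comp_def[of C s x z w]
  by (rule vlam_cong)
    (simp_all add: sel_comp_vapp[OF P(3) x(3)] sel_comp_vapp[OF P(4) x(4)] Let_def
      sel_hom_fst[OF P(4) x(4) h] sel_hom_fst[OF P(3) x(3) g] sel_hom_fst[OF P(2) x(2) f]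
      Comp_assoc[OF C] sel_hom_snd[OF P(4) x(4) h] sel_hom_snd[OF P(3) x(3) g]
      sel_hom_snd[OF P(2) x(2) f] sel_at_in[OF P(1) x(1)] sel_at_in[OF P(2) x(2)]
      sel_at_in[OF P(3) x(3)] sel_at_in[OF P(4) x(4)])

end

lemma sel_cat_simps [simp]:
  "Obj (sel_cat C p) = sel_obj C p" "Hom (sel_cat C p) = sel_hom C p p"
  "Ident (sel_cat C p) = sel_id C p" "Comp (sel_cat C p) = sel_comp C p"
  by (simp_all add: sel_cat_def)

lemma small_sel_obj: "small (Obj C) \<Longrightarrow> p \<in> Obj Poly \<Longrightarrow> small (sel_obj C p)"
  unfolding sel_obj_def
  by (simp add: small_vSigma small_vPi Poly_small_Idx Poly_small_Arity)

lemma small_sel_hom: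
  assumes "is_small_category C" "p \<in> Obj Poly" "q \<in> Obj Poly" "x \<in> sel_obj C p" "y \<in> sel_obj C q"
  shows "small (sel_hom C p q x y)"
  unfolding sel_hom_def
proof (intro small_vPi small_vSigma)
  fix b a assume "b \<in> sel_ar q y" "a \<in> sel_ar p x"
  then show "small (Hom C (sel_at x a) (sel_at y b))"
    using assms sel_at_in unfolding is_small_category_def by blast
qed (use assms small_sel_ar in blast)+

lemma sel_cat_is_small_category:
  assumes C: "is_small_category C" and p: "p \<in> Obj Poly"
  shows "is_small_category (sel_cat C p)"
proof -
  note cat = small_category_is_category[OF C]
  have "is_category (sel_cat C p)"
    by (rule is_categoryI)
      (simp_all add: sel_id_in[OF cat p] sel_comp_in[OF cat p p p] sel_comp_id_left[OF cat p p]
        sel_comp_id_right[OF cat p p] sel_comp_assoc[OF cat p p p p])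
  then show ?thesis
    using small_sel_obj[OF _ p] small_sel_hom[OF C p p] C
    by (simp add: is_small_category_def)
qed

section \<open>Endofunctors and comonads on sets, elementwise\<close>

lemmas endo_small = fob_small[where C = Set_cat, simplified]
  and endo_PiE = farr_PiE[where C = Set_cat, simplified]
  and endo_in = farr_app_in[where C = Set_cat, simplified]
  and endo_Ident = farr_Ident_app[where C = Set_cat, simplified]
  and nt_PiE = nat_trans_PiE[where C = Set_cat, simplified]
  and nt_in = nat_trans_app_in[where C = Set_cat, simplified]
  and nt_natural = nat_trans_natural[where C = Set_cat, simplified]
  and ntI = Set_nat_transI[where C = Set_cat, simplified]
  and nt_eqI = nat_trans_eqI[where C = Set_cat, simplified]

text \<open>Functoriality in the form used for diagram chases: \<open>h\<close> may be any
  extensional function that agrees pointwise with \<open>g\<close> after \<open>f\<close>. A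
  commuting square of functions thus gives two factorisations of the same
  \<open>farr\<close>.\<close>

lemma endo_comp:
  assumes F: "is_functor Set_cat Set_cat F" and small: "small X" "small Y" "small Z"
    and f: "f \<in> X \<rightarrow>\<^sub>E Y" "g \<in> Y \<rightarrow>\<^sub>E Z" "h \<in> X \<rightarrow>\<^sub>E Z" and x: "x \<in> fob F X"
    and eq: "\<And>x. x \<in> X \<Longrightarrow> g (f x) = h x"
  shows "farr F Y Z g (farr F X Y f x) = farr F X Z h x"
proof -
  have "h = Comp Set_cat X Y Z g f"
    using f(3) eq by (auto simp: fun_eq_iff compose_def PiE_iff extensional_def)
  then show ?thesis
    using farr_Comp_app[OF F, of f X Y g Z x] small f x by simp
qed

lemma comp_functor_Set_simps [simp]:
  "small X \<Longrightarrow> fob (comp_functor Set_cat G F) X = fob G (fob F X)"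
  "small X \<Longrightarrow> small Y \<Longrightarrow> f \<in> X \<rightarrow>\<^sub>E Y
    \<Longrightarrow> farr (comp_functor Set_cat G F) X Y f = farr G (fob F X) (fob F Y) (farr F X Y f)"
  by simp_all

lemma id_functor_Set_simps [simp]:
  "small X \<Longrightarrow> fob (id_functor Set_cat) X = X"
  "small X \<Longrightarrow> small Y \<Longrightarrow> f \<in> X \<rightarrow>\<^sub>E Y \<Longrightarrow> farr (id_functor Set_cat) X Y f = f"
  by simp_all

lemma whisker_Set_simps [simp]:
  "small X \<Longrightarrow> whisker_right Set_cat Q \<beta> X = \<beta> (fob Q X)"
  "small X \<Longrightarrow> whisker_left Set_cat H F G \<alpha> X = farr H (fob F X) (fob G X) (\<alpha> X)"
  by (simp_all add: whisker_right_def whisker_left_def)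

lemma vcomp_app [simp]:
  "small X \<Longrightarrow> x \<in> fob F X \<Longrightarrow> vcomp Set_cat Set_cat F G H \<beta> \<alpha> X x = \<beta> X (\<alpha> X x)"
  by (simp add: vcomp_def compose_eq)

lemma vcomp_extensional:
  "vcomp Set_cat Set_cat F G H \<beta> \<alpha> \<in> extensional (Obj Set_cat)"
  "small X \<Longrightarrow> vcomp Set_cat Set_cat F G H \<beta> \<alpha> X \<in> extensional (fob F X)"
  by (simp_all add: vcomp_def compose_def)

text \<open>The equations in the definitions of comonads and Kan extensions are equalities of doubly
  extensional functions. This lemma and the next two reduce them to elements.\<close>

lemma vcomp_eq_iff:
  assumes "\<gamma> \<in> extensional (Obj Set_cat)" "\<And>X. small X \<Longrightarrow> \<gamma> X \<in> extensional (fob F X)"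
  shows "vcomp Set_cat Set_cat F G H \<beta> \<alpha> = \<gamma> \<longleftrightarrow>
    (\<forall>X x. small X \<longrightarrow> x \<in> fob F X \<longrightarrow> \<beta> X (\<alpha> X x) = \<gamma> X x)"
    (is "?L = \<gamma> \<longleftrightarrow> ?R")
proof
  assume ?R
  then show "?L = \<gamma>"
    by (intro Set_family_eqI[where F = "fob F" and O' = "Obj Set_cat"])
      (simp_all add: assms vcomp_extensional)
qed (auto simp flip: vcomp_app)

lemma vcomp_eq_Ident_iff:
  "vcomp Set_cat Set_cat F G H \<beta> \<alpha> = (\<lambda>X\<in>Obj Set_cat. Ident Set_cat (fob F X)) \<longleftrightarrow>
    (\<forall>X x. small X \<longrightarrow> x \<in> fob F X \<longrightarrow> \<beta> X (\<alpha> X x) = x)"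
  by (subst vcomp_eq_iff) auto

lemma vcomp_eq_vcomp_iff:
  "vcomp Set_cat Set_cat F G H \<beta> \<alpha> = vcomp Set_cat Set_cat F G' H' \<beta>' \<alpha>' \<longleftrightarrow>
    (\<forall>X x. small X \<longrightarrow> x \<in> fob F X \<longrightarrow> \<beta> X (\<alpha> X x) = \<beta>' X (\<alpha>' X x))"
  by (subst vcomp_eq_iff) (auto simp: vcomp_extensional)

lemma vcomp_nt:
  assumes \<alpha>: "nat_trans Set_cat Set_cat F G \<alpha>" and \<beta>: "nat_trans Set_cat Set_cat G H \<beta>"
  shows "nat_trans Set_cat Set_cat F H (vcomp Set_cat Set_cat F G H \<beta> \<alpha>)"
proof (rule ntI)
  show "is_functor Set_cat Set_cat F" "is_functor Set_cat Set_cat H"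
    using nat_trans_dom[OF \<alpha>] nat_trans_cod[OF \<beta>] .
qed (simp_all add: vcomp_extensional nt_in[OF \<alpha>] nt_in[OF \<beta>] nt_natural[OF \<alpha>] nt_natural[OF \<beta>]
    endo_in[OF nat_trans_dom[OF \<alpha>]] vcomp_extensional(1)[simplified])

lemma whisker_right_nt:
  assumes Q: "is_functor Set_cat Set_cat Q" and \<alpha>: "nat_trans Set_cat Set_cat F G \<alpha>"
  shows "nat_trans Set_cat Set_cat (comp_functor Set_cat F Q) (comp_functor Set_cat G Q)
    (whisker_right Set_cat Q \<alpha>)"
proof (rule ntI)
  show "is_functor Set_cat Set_cat (comp_functor Set_cat F Q)"
    "is_functor Set_cat Set_cat (comp_functor Set_cat G Q)"
    using comp_functor_is_functor[OF Q] nat_trans_dom[OF \<alpha>] nat_trans_cod[OF \<alpha>] by auto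
  show "whisker_right Set_cat Q \<alpha> \<in> extensional (Obj Set_cat)"
    by (simp add: whisker_right_def)
qed (use nt_PiE[OF \<alpha>] in \<open>simp_all add: endo_small[OF Q] endo_PiE[OF Q] nt_in[OF \<alpha>]
    nt_natural[OF \<alpha>] PiE_iff[of "\<alpha> _"]\<close>)

lemma whisker_left_nt:
  fixes F G H :: "'u::set_universe endo"
  assumes H: "is_functor Set_cat Set_cat H" and \<alpha>: "nat_trans Set_cat Set_cat F G \<alpha>"
  shows "nat_trans Set_cat Set_cat (comp_functor Set_cat H F) (comp_functor Set_cat H G)
    (whisker_left Set_cat H F G \<alpha>)"
proof -
  note F = nat_trans_dom[OF \<alpha>] and G = nat_trans_cod[OF \<alpha>]
  note simps = endo_small[OF F] endo_small[OF G] nt_PiE[OF \<alpha>] endo_PiE[OF F] endo_PiE[OF G]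
  show ?thesis
  proof (rule ntI)
    show "is_functor Set_cat Set_cat (comp_functor Set_cat H F)"
      "is_functor Set_cat Set_cat (comp_functor Set_cat H G)"
      by (rule comp_functor_is_functor[OF F H] comp_functor_is_functor[OF G H])+
    show "whisker_left Set_cat H F G \<alpha> \<in> extensional (Obj Set_cat)"
      by (simp add: whisker_left_def)
    fix X :: "'u set" assume X: "small X"
    then show "whisker_left Set_cat H F G \<alpha> X \<in> extensional (fob (comp_functor Set_cat H F) X)"
      using endo_PiE[OF H nt_PiE[OF \<alpha> X]] by (simp add: simps(1,2) PiE_iff)
    fix x assume x: "x \<in> fob (comp_functor Set_cat H F) X"
    then show "whisker_left Set_cat H F G \<alpha> X x \<in> fob (comp_functor Set_cat H G) X"
      using X by (simp add: simps endo_in[OF H])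
    fix Y :: "'u set" and f assume Y: "small Y" and f: "f \<in> X \<rightarrow>\<^sub>E Y"
    \<comment> \<open>The diagonal of the naturality square of \<alpha>. Going round the image of
      the square under \<open>H\<close> either way factors \<open>H\<close> of this
      diagonal.\<close>
    let ?h = "\<lambda>x\<in>fob F X. farr G X Y f (\<alpha> X x)"
    have h: "?h \<in> fob F X \<rightarrow>\<^sub>E fob G Y"
      using X Y f by (simp add: endo_in[OF G] nt_in[OF \<alpha>])
    have "farr H (fob F Y) (fob G Y) (\<alpha> Y) (farr H (fob F X) (fob F Y) (farr F X Y f) x)
        = farr H (fob F X) (fob G Y) ?h x"
      by (rule endo_comp[OF H]) (use X Y f h x in \<open>simp_all add: simps nt_natural[OF \<alpha>]\<close>)
    also have "\<dots> = farr H (fob G X) (fob G Y) (farr G X Y f) (farr H (fob F X) (fob G X) (\<alpha> X) x)"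
      by (rule endo_comp[OF H, symmetric]) (use X Y f h x in \<open>simp_all add: simps\<close>)
    finally show "whisker_left Set_cat H F G \<alpha> Y (farr (comp_functor Set_cat H F) X Y f x)
        = farr (comp_functor Set_cat H G) X Y f (whisker_left Set_cat H F G \<alpha> X x)"
      using X Y f x by (simp add: simps)
  qed
qed

lemma is_comonad_iff:
  "is_comonad K \<longleftrightarrow>
    nat_trans Set_cat Set_cat (cfun K) (id_functor Set_cat) (counit K) \<and>
    nat_trans Set_cat Set_cat (cfun K) (comp_functor Set_cat (cfun K) (cfun K)) (comult K) \<and>
    (\<forall>X t. small X \<longrightarrow> t \<in> fob (cfun K) X \<longrightarrow>
      farr (cfun K) (fob (cfun K) X) X (counit K X) (comult K X t) = t \<and>
      counit K (fob (cfun K) X) (comult K X t) = t \<and>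
      farr (cfun K) (fob (cfun K) X) (fob (cfun K) (fob (cfun K) X)) (comult K X) (comult K X t)
      = comult K (fob (cfun K) X) (comult K X t))"
  unfolding is_comonad_def Let_def vcomp_eq_Ident_iff vcomp_eq_vcomp_iff
  by (auto simp: whisker_right_def whisker_left_def)

section \<open>Transport of a comonad structure along an isomorphism of functors\<close>

context
  fixes K :: "'u::set_universe comonad" and m :: "'u endo" and \<epsilon> \<delta> \<phi> \<psi> :: "'u endo_nat"
  assumes K: "is_comonad K"
    and \<phi>: "nat_trans Set_cat Set_cat (cfun K) m \<phi>" and \<psi>: "nat_trans Set_cat Set_cat m (cfun K) \<psi>"
    and \<psi>\<phi>: "\<And>X t. small X \<Longrightarrow> t \<in> fob (cfun K) X \<Longrightarrow> \<psi> X (\<phi> X t) = t"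
    and \<phi>\<psi>: "\<And>X t. small X \<Longrightarrow> t \<in> fob m X \<Longrightarrow> \<phi> X (\<psi> X t) = t"
    and \<epsilon>: "nat_trans Set_cat Set_cat m (id_functor Set_cat) \<epsilon>"
    and \<delta>: "nat_trans Set_cat Set_cat m (comp_functor Set_cat m m) \<delta>"
    and \<epsilon>\<phi>: "\<And>X t. small X \<Longrightarrow> t \<in> fob (cfun K) X \<Longrightarrow> \<epsilon> X (\<phi> X t) = counit K X t"
    and \<delta>\<phi>: "\<And>X t. small X \<Longrightarrow> t \<in> fob (cfun K) X \<Longrightarrow> \<delta> X (\<phi> X t)
      = \<phi> (fob m X) (farr (cfun K) (fob (cfun K) X) (fob m X) (\<phi> X) (comult K X t))"
begin

text \<open>Every element of \<open>m X\<close> is \<phi> of some element, so each comonad law for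
  \<open>m\<close> can be checked on such images, where \<open>\<epsilon>\<phi>\<close> and
  \<open>\<delta>\<phi>\<close> reduce it to the law for \<open>K\<close>.\<close>

lemma comonad_transport: "comonad_iso K \<lparr>cfun = m, counit = \<epsilon>, comult = \<delta>\<rparr>"
proof -
  let ?k = "cfun K" and ?\<epsilon> = "counit K" and ?\<delta> = "comult K"
  note k = nat_trans_dom[OF \<phi>] and m = nat_trans_cod[OF \<phi>]
  have \<epsilon>K: "nat_trans Set_cat Set_cat ?k (id_functor Set_cat) ?\<epsilon>"
    and \<delta>K: "nat_trans Set_cat Set_cat ?k (comp_functor Set_cat ?k ?k) ?\<delta>"
    using K by (simp_all add: is_comonad_iff)
  have law: "farr ?k (fob ?k X) X (?\<epsilon> X) (?\<delta> X t) = t" "?\<epsilon> (fob ?k X) (?\<delta> X t) = t"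
    "farr ?k (fob ?k X) (fob ?k (fob ?k X)) (?\<delta> X) (?\<delta> X t) = ?\<delta> (fob ?k X) (?\<delta> X t)"
    if "small X" "t \<in> fob ?k X" for X t
    using K that by (simp_all add: is_comonad_iff)
  have law': "farr m (fob m X) X (\<epsilon> X) (\<delta> X s) = s" "\<epsilon> (fob m X) (\<delta> X s) = s"
    "farr m (fob m X) (fob m (fob m X)) (\<delta> X) (\<delta> X s) = \<delta> (fob m X) (\<delta> X s)"
    if X: "small X" and s: "s \<in> fob m X" for X s
  proof -
    define t where "t = \<psi> X s"
    have t: "t \<in> fob ?k X" and s_eq: "s = \<phi> X t"
      using X s by (simp_all add: t_def nt_in[OF \<psi>] \<phi>\<psi>)
    let ?kX = "fob ?k X" and ?kkX = "fob ?k (fob ?k X)" and ?mX = "fob m X"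
      and ?mmX = "fob m (fob m X)" and ?kmX = "fob ?k (fob m X)"
    have small: "small ?kX" "small ?kkX" "small ?mX" "small ?mmX" "small ?kmX"
      using X by (simp_all add: endo_small[OF k] endo_small[OF m])
    define u where "u = ?\<delta> X t"
    have u: "u \<in> ?kkX"
      using nt_in[OF \<delta>K t X] X by (simp add: u_def)
    \<comment> \<open>The inner layer of \<open>u\<close>, which lies in \<open>k (k X)\<close>, is
      moved to \<open>m X\<close>. A further \<phi> on the outer layer produces the comultiplication
      of \<open>s\<close>.\<close>
    define v where "v = farr ?k ?kX ?mX (\<phi> X) u"
    have \<phi>X: "\<phi> X \<in> ?kX \<rightarrow>\<^sub>E ?mX"
      using nt_PiE[OF \<phi> X] .
    have v: "v \<in> ?kmX"
      unfolding v_def by (rule endo_in[OF k]) (use small \<phi>X u in simp_all)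
    have \<delta>s: "\<delta> X s = \<phi> ?mX v"
      by (simp add: s_eq \<delta>\<phi>[OF X t] v_def u_def)
    have \<epsilon>X: "\<epsilon> X \<in> ?mX \<rightarrow>\<^sub>E X" and \<epsilon>KX: "?\<epsilon> X \<in> ?kX \<rightarrow>\<^sub>E X"
      using nt_PiE[OF \<epsilon> X] nt_PiE[OF \<epsilon>K X] X by simp_all
    have \<delta>X: "\<delta> X \<in> ?mX \<rightarrow>\<^sub>E ?mmX" and \<delta>KX: "?\<delta> X \<in> ?kX \<rightarrow>\<^sub>E ?kkX"
      using nt_PiE[OF \<delta> X] nt_PiE[OF \<delta>K X] X by simp_all
    have "farr m ?mX X (\<epsilon> X) (\<phi> ?mX v) = \<phi> X (farr ?k ?mX X (\<epsilon> X) v)"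
      by (rule nt_natural[OF \<phi>, symmetric]) (use small X \<epsilon>X v in simp_all)
    also have "farr ?k ?mX X (\<epsilon> X) v = farr ?k ?kX X (?\<epsilon> X) u"
      unfolding v_def by (rule endo_comp[OF k])
        (use small X \<epsilon>X \<epsilon>KX \<phi>X u in \<open>simp_all add: \<epsilon>\<phi>\<close>)
    also have "\<dots> = t"
      unfolding u_def by (rule law(1)[OF X t])
    finally show "farr m ?mX X (\<epsilon> X) (\<delta> X s) = s"
      by (simp only: \<delta>s s_eq[symmetric])
    have "\<epsilon> ?mX (\<phi> ?mX v) = ?\<epsilon> ?mX v"
      by (rule \<epsilon>\<phi>) (use small v in simp_all)
    also have "\<dots> = \<phi> X (?\<epsilon> ?kX u)"
      using nt_natural[OF \<epsilon>K \<phi>X u] small X \<phi>X by (simp add: v_def)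
    also have "\<dots> = \<phi> X t"
      unfolding u_def by (simp add: law(2)[OF X t])
    finally show "\<epsilon> ?mX (\<delta> X s) = s"
      by (simp only: \<delta>s s_eq[symmetric])
    let ?k\<phi> = "farr ?k ?kX ?mX (\<phi> X)"
    have k\<phi>: "?k\<phi> \<in> ?kkX \<rightarrow>\<^sub>E ?kmX"
      by (rule endo_PiE[OF k]) (use small \<phi>X in simp_all)
    have \<phi>mX: "\<phi> ?mX \<in> ?kmX \<rightarrow>\<^sub>E ?mmX"
      by (rule nt_PiE[OF \<phi>]) (use small in simp_all)
    define w where "w = ?\<delta> ?mX v"
    have w: "w \<in> fob ?k ?kmX"
      using nt_in[OF \<delta>K v] small by (simp add: w_def)
    have \<delta>\<phi>X: "(\<lambda>t\<in>?kX. \<delta> X (\<phi> X t)) \<in> ?kX \<rightarrow>\<^sub>E ?mmX"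
      using \<delta>X \<phi>X by auto
    have k\<phi>\<delta>: "(\<lambda>t\<in>?kX. ?k\<phi> (?\<delta> X t)) \<in> ?kX \<rightarrow>\<^sub>E ?kmX"
      using \<delta>KX k\<phi> by auto
    \<comment> \<open>Naturality of \<open>?\<delta>\<close> at \<open>\<phi> X\<close>, followed by
      coassociativity of \<open>K\<close>, expresses \<open>w\<close> as \<open>k\<close> of one
      function applied to \<open>u\<close>. The other side of the coassociativity law for
      \<open>m\<close> takes the same form, and the two functions are compared by
      \<open>\<delta>\<phi>\<close> inside \<open>k\<close>.\<close>
    have w_eq: "w = farr ?k ?kX ?kmX (\<lambda>t\<in>?kX. ?k\<phi> (?\<delta> X t)) u"
    proof -
      have "w = farr ?k ?kkX ?kmX ?k\<phi> (?\<delta> ?kX u)"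
        using nt_natural[OF \<delta>K \<phi>X u] small X \<phi>X by (simp add: v_def w_def)
      also have "?\<delta> ?kX u = farr ?k ?kX ?kkX (?\<delta> X) u"
        unfolding u_def using law(3)[OF X t] by simp
      also have "farr ?k ?kkX ?kmX ?k\<phi> (farr ?k ?kX ?kkX (?\<delta> X) u)
          = farr ?k ?kX ?kmX (\<lambda>t\<in>?kX. ?k\<phi> (?\<delta> X t)) u"
        by (rule endo_comp[OF k]) (use small X k\<phi> \<delta>KX k\<phi>\<delta> u in simp_all)
      finally show ?thesis .
    qed
    have "farr m ?mX ?mmX (\<delta> X) (\<phi> ?mX v) = \<phi> ?mmX (farr ?k ?mX ?mmX (\<delta> X) v)"
      by (rule nt_natural[OF \<phi>, symmetric]) (use small X \<delta>X v in simp_all)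
    also have "farr ?k ?mX ?mmX (\<delta> X) v = farr ?k ?kX ?mmX (\<lambda>t\<in>?kX. \<delta> X (\<phi> X t)) u"
      unfolding v_def by (rule endo_comp[OF k]) (use small X \<delta>X \<phi>X \<delta>\<phi>X u in simp_all)
    also have "\<dots> = farr ?k ?kmX ?mmX (\<phi> ?mX) w"
      unfolding w_eq by (rule endo_comp[OF k, symmetric])
        (use small X \<phi>mX k\<phi>\<delta> \<delta>\<phi>X u in \<open>simp_all add: \<delta>\<phi>\<close>)
    also have "\<phi> ?mmX \<dots> = \<delta> ?mX (\<phi> ?mX v)"
      unfolding w_def by (rule \<delta>\<phi>[symmetric]) (use small v in simp_all)
    finally show "farr m ?mX ?mmX (\<delta> X) (\<delta> X s) = \<delta> ?mX (\<delta> X s)"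
      by (simp add: \<delta>s)
  qed
  have "is_comonad \<lparr>cfun = m, counit = \<epsilon>, comult = \<delta>\<rparr>"
    using \<epsilon> \<delta> law' by (simp add: is_comonad_iff)
  \<comment> \<open>Phrased exactly as \<open>comonad_iso\<close> reads once its equations, except
    the one for the counit, have been turned into statements about elements.\<close>
  moreover have "\<exists>\<phi> \<psi>. nat_trans Set_cat Set_cat ?k m \<phi> \<and> nat_trans Set_cat Set_cat m ?k \<psi> \<and>
      (\<forall>X t. small X \<longrightarrow> t \<in> fob ?k X \<longrightarrow> \<psi> X (\<phi> X t) = t) \<and>
      (\<forall>X t. small X \<longrightarrow> t \<in> fob m X \<longrightarrow> \<phi> X (\<psi> X t) = t) \<and>
      vcomp Set_cat Set_cat ?k m (id_functor Set_cat) \<epsilon> \<phi> = ?\<epsilon> \<and>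
      (\<forall>X t. small X \<longrightarrow> t \<in> fob ?k X \<longrightarrow> \<delta> X (\<phi> X t) =
        vcomp Set_cat Set_cat (comp_functor Set_cat ?k ?k) (comp_functor Set_cat ?k m)
          (comp_functor Set_cat m m) (whisker_right Set_cat m \<phi>) (whisker_left Set_cat ?k ?k m \<phi>)
          X (?\<delta> X t))"
  proof (intro exI conjI allI impI)
    show "vcomp Set_cat Set_cat ?k m (id_functor Set_cat) \<epsilon> \<phi> = ?\<epsilon>"
      using \<epsilon>\<phi> by (rule nt_eqI[OF vcomp_nt[OF \<phi> \<epsilon>] \<epsilon>K, simplified vcomp_app]) simp_all
    fix X t assume X: "small X" and t: "t \<in> fob ?k X"
    then show "\<delta> X (\<phi> X t) =
        vcomp Set_cat Set_cat (comp_functor Set_cat ?k ?k) (comp_functor Set_cat ?k m)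
          (comp_functor Set_cat m m) (whisker_right Set_cat m \<phi>) (whisker_left Set_cat ?k ?k m \<phi>)
          X (?\<delta> X t)"
      using nt_in[OF \<delta>K t X] by (simp add: \<delta>\<phi>)
  qed (use \<phi> \<psi> \<psi>\<phi> \<phi>\<psi> in auto)
  ultimately show ?thesis
    using K unfolding comonad_iso_def Let_def vcomp_eq_Ident_iff vcomp_eq_vcomp_iff by simp
qed

end

section \<open>Comonads on left Kan extensions\<close>

lemma lan_universal:
  fixes p T L R :: "'u::set_universe endo"
  assumes L: "is_lan Set_cat Set_cat Set_cat p T L \<eta>" and R: "is_functor Set_cat Set_cat R"
    and \<alpha>: "nat_trans Set_cat Set_cat T (comp_functor Set_cat R p) \<alpha>"
  shows "\<exists>!\<beta>. nat_trans Set_cat Set_cat L R \<beta> \<and>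
    (\<forall>X t. small X \<longrightarrow> t \<in> fob T X \<longrightarrow> \<beta> (fob p X) (\<eta> X t) = \<alpha> X t)"
proof -
  have *: "vcomp Set_cat Set_cat T (comp_functor Set_cat L p) (comp_functor Set_cat R p)
      (whisker_right Set_cat p \<beta>) \<eta> = \<alpha> \<longleftrightarrow>
    (\<forall>X t. small X \<longrightarrow> t \<in> fob T X \<longrightarrow> \<beta> (fob p X) (\<eta> X t) = \<alpha> X t)" for \<beta>
    by (subst vcomp_eq_iff) (use nat_trans_ext[OF \<alpha>] nt_PiE[OF \<alpha>] in \<open>auto simp: PiE_iff\<close>)
  show ?thesis
    unfolding *[symmetric] using L R \<alpha> unfolding is_lan_def by blast
qed

text \<open>The uniqueness half of the universal property, for the problem posed by the restriction
  of \<beta> along the unit: by assumption \<beta>' solves it too.\<close>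

lemma lan_unique:
  fixes p T L R :: "'u::set_universe endo"
  assumes L: "is_lan Set_cat Set_cat Set_cat p T L \<eta>"
    and \<beta>: "nat_trans Set_cat Set_cat L R \<beta>" and \<beta>': "nat_trans Set_cat Set_cat L R \<beta>'"
    and eq: "\<And>X t. small X \<Longrightarrow> t \<in> fob T X \<Longrightarrow> \<beta> (fob p X) (\<eta> X t) = \<beta>' (fob p X) (\<eta> X t)"
  shows "\<beta> = \<beta>'"
proof -
  have p: "is_functor Set_cat Set_cat p" and \<eta>: "nat_trans Set_cat Set_cat T (comp_functor Set_cat L p) \<eta>"
    using L by (simp_all add: is_lan_def)
  let ?\<alpha> = "vcomp Set_cat Set_cat T (comp_functor Set_cat L p) (comp_functor Set_cat R p)
    (whisker_right Set_cat p \<beta>) \<eta>"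
  have \<alpha>: "nat_trans Set_cat Set_cat T (comp_functor Set_cat R p) ?\<alpha>"
    by (rule vcomp_nt[OF \<eta> whisker_right_nt[OF p \<beta>]])
  have \<alpha>_app: "?\<alpha> X t = \<beta> (fob p X) (\<eta> X t)" if "small X" "t \<in> fob T X" for X t
    using that by simp
  show ?thesis
    by (rule ex1E[OF lan_universal[OF L nat_trans_cod[OF \<beta>] \<alpha>]]) (metis \<beta> \<beta>' eq \<alpha>_app)
qed

context
  fixes p :: "'u::set_universe endo" and K :: "'u comonad" and L :: "'u endo" and \<eta> :: "'u endo_nat"
  assumes K: "is_comonad K"
    and L: "is_lan Set_cat Set_cat Set_cat p (comp_functor Set_cat p (cfun K)) L \<eta>"
begin

lemma cfun_lan_comonad [simp]: "cfun (lan_comonad p K L \<eta>) = L"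
  by (simp add: lan_comonad_def Let_def)

text \<open>The definite description becomes usable through the universal property with the identity
  functor as target, since \<open>p\<close> is equal to its composite with the identity.\<close>

lemma lan_comonad_counit:
  "nat_trans Set_cat Set_cat L (id_functor Set_cat) (counit (lan_comonad p K L \<eta>)) \<and>
    (\<forall>X t. small X \<longrightarrow> t \<in> fob p (fob (cfun K) X) \<longrightarrow>
      counit (lan_comonad p K L \<eta>) (fob p X) (\<eta> X t) = farr p (fob (cfun K) X) X (counit K X) t)"
proof -
  let ?N = "nat_trans Set_cat Set_cat L (id_functor Set_cat)"
    and ?E = "\<lambda>\<beta>. \<forall>X t. small X \<longrightarrow> t \<in> fob p (fob (cfun K) X) \<longrightarrow>
      \<beta> (fob p X) (\<eta> X t) = farr p (fob (cfun K) X) X (counit K X) t"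
  let ?I = "id_functor Set_cat :: 'u endo" and ?k = "cfun K"
  let ?\<alpha> = "whisker_left Set_cat p ?k ?I (counit K)"
  have p: "is_functor Set_cat Set_cat p"
    using L by (simp add: is_lan_def)
  have I: "is_functor Set_cat Set_cat ?I"
    by (rule id_functor_is_functor[OF Set_cat_is_category])
  have \<alpha>: "nat_trans Set_cat Set_cat (comp_functor Set_cat p ?k) p ?\<alpha>"
    using whisker_left_nt[OF p, of ?k ?I] K
    by (simp add: is_comonad_iff comp_functor_id_right[OF p])
  have "vcomp Set_cat Set_cat (comp_functor Set_cat p ?k) (comp_functor Set_cat L p) p
      (whisker_right Set_cat p \<beta>) \<eta> = ?\<alpha> \<longleftrightarrow>
    (\<forall>X t. small X \<longrightarrow> t \<in> fob (comp_functor Set_cat p ?k) X \<longrightarrow> \<beta> (fob p X) (\<eta> X t) = ?\<alpha> X t)" for \<beta>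
    by (subst vcomp_eq_iff) (use nat_trans_ext[OF \<alpha>] nt_PiE[OF \<alpha>] in \<open>auto simp: PiE_iff\<close>)
  then have *: "vcomp Set_cat Set_cat (comp_functor Set_cat p ?k) (comp_functor Set_cat L p) p
      (whisker_right Set_cat p \<beta>) \<eta> = ?\<alpha> \<longleftrightarrow> ?E \<beta>" for \<beta>
    by simp
  have "\<exists>!\<beta>. ?N \<beta> \<and> ?E \<beta>"
    using lan_universal[OF L I, of ?\<alpha>] \<alpha> by (simp add: comp_functor_id_left[OF p])
  from theI'[OF this] show ?thesis
    by (simp add: lan_comonad_def Let_def *)
qed

text \<open>The same method with \<open>L L\<close> as target. What has to be shown is that the
  prescribed composite, built by whiskering, is a natural transformation into
  \<open>L L p\<close>.\<close>

lemma lan_comonad_comult: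
  "nat_trans Set_cat Set_cat L (comp_functor Set_cat L L) (comult (lan_comonad p K L \<eta>)) \<and>
    (\<forall>X t. small X \<longrightarrow> t \<in> fob p (fob (cfun K) X) \<longrightarrow>
      comult (lan_comonad p K L \<eta>) (fob p X) (\<eta> X t)
      = farr L (fob p (fob (cfun K) X)) (fob L (fob p X)) (\<eta> X)
          (\<eta> (fob (cfun K) X) (farr p (fob (cfun K) X) (fob (cfun K) (fob (cfun K) X)) (comult K X) t)))"
proof -
  let ?N = "nat_trans Set_cat Set_cat L (comp_functor Set_cat L L)"
    and ?E = "\<lambda>\<beta>. \<forall>X t. small X \<longrightarrow> t \<in> fob p (fob (cfun K) X) \<longrightarrow>
      \<beta> (fob p X) (\<eta> X t) = farr L (fob p (fob (cfun K) X)) (fob L (fob p X)) (\<eta> X)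
        (\<eta> (fob (cfun K) X) (farr p (fob (cfun K) X) (fob (cfun K) (fob (cfun K) X)) (comult K X) t))"
  let ?k = "cfun K"
  let ?pk = "comp_functor Set_cat p ?k" and ?Lp = "comp_functor Set_cat L p"
    and ?LL = "comp_functor Set_cat L L" and ?kk = "comp_functor Set_cat ?k ?k"
  let ?pkk = "comp_functor Set_cat p ?kk" and ?Lpk = "comp_functor Set_cat L ?pk"
    and ?LLp = "comp_functor Set_cat L ?Lp"
  let ?\<gamma> = "vcomp Set_cat Set_cat ?pk ?pkk ?Lpk (whisker_right Set_cat ?k \<eta>)
    (whisker_left Set_cat p ?k ?kk (comult K))"
  let ?\<alpha> = "vcomp Set_cat Set_cat ?pk ?Lpk ?LLp (whisker_left Set_cat L ?pk ?Lp \<eta>) ?\<gamma>"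
  have p: "is_functor Set_cat Set_cat p" and L': "is_functor Set_cat Set_cat L"
    and \<eta>: "nat_trans Set_cat Set_cat ?pk ?Lp \<eta>"
    using L by (simp_all add: is_lan_def)
  have k: "is_functor Set_cat Set_cat ?k"
    and \<delta>: "nat_trans Set_cat Set_cat ?k ?kk (comult K)"
    using K nat_trans_dom by (auto simp: is_comonad_iff)
  have LL: "is_functor Set_cat Set_cat ?LL"
    by (rule comp_functor_is_functor[OF L' L'])
  \<comment> \<open>Composition of functors is associative as an equality of records, so the
    different bracketings produced by whiskering can be exchanged by rewriting.\<close>
  have assoc: "comp_functor Set_cat ?pk ?k = ?pkk" "comp_functor Set_cat ?Lp ?k = ?Lpk"
    "comp_functor Set_cat ?LL p = ?LLp"
    using comp_functor_assoc[OF k k p] comp_functor_assoc[OF k p L'] comp_functor_assoc[OF p L' L']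
    by simp_all
  have \<gamma>: "nat_trans Set_cat Set_cat ?pk ?Lpk ?\<gamma>"
    by (rule vcomp_nt[OF whisker_left_nt[OF p \<delta>] whisker_right_nt[OF k \<eta>, unfolded assoc]])
  have \<alpha>: "nat_trans Set_cat Set_cat ?pk ?LLp ?\<alpha>"
    by (rule vcomp_nt[OF \<gamma> whisker_left_nt[OF L' \<eta>]])
  have \<alpha>_app: "?\<alpha> X t = farr L (fob p (fob ?k X)) (fob L (fob p X)) (\<eta> X)
      (\<eta> (fob ?k X) (farr p (fob ?k X) (fob ?k (fob ?k X)) (comult K X) t))"
    if "small X" "t \<in> fob p (fob ?k X)" for X t
    using that by (simp add: endo_small[OF k])
  have *: "vcomp Set_cat Set_cat ?pk ?Lp ?LLp (whisker_right Set_cat p \<beta>) \<eta> = ?\<alpha> \<longleftrightarrow> ?E \<beta>" for \<beta>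
    unfolding vcomp_eq_vcomp_iff by (simp add: endo_small[OF k])
  have "\<exists>!\<beta>. ?N \<beta> \<and> ?E \<beta>"
    using lan_universal[OF L LL, of ?\<alpha>] \<alpha> by (simp add: assoc(3) \<alpha>_app del: vcomp_app)
  from theI'[OF this] show ?thesis
    by (simp add: lan_comonad_def Let_def *)
qed

end

text \<open>Any two left Kan extensions are isomorphic over their units, and the two defining
  conditions determine counit and comultiplication on the image of the unit.\<close>

lemma lan_comonad_iso:
  fixes p :: "'u::set_universe endo"
  assumes K: "is_comonad K"
    and M: "is_comonad M"
    and M_lan: "is_lan Set_cat Set_cat Set_cat p (comp_functor Set_cat p (cfun K)) (cfun M) \<eta>\<^sub>0"
    and M_counit: "\<And>X t. small X \<Longrightarrow> t \<in> fob p (fob (cfun K) X) \<Longrightarrow>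
      counit M (fob p X) (\<eta>\<^sub>0 X t) = farr p (fob (cfun K) X) X (counit K X) t"
    and M_comult: "\<And>X t. small X \<Longrightarrow> t \<in> fob p (fob (cfun K) X) \<Longrightarrow>
      comult M (fob p X) (\<eta>\<^sub>0 X t)
      = farr (cfun M) (fob p (fob (cfun K) X)) (fob (cfun M) (fob p X)) (\<eta>\<^sub>0 X)
          (\<eta>\<^sub>0 (fob (cfun K) X) (farr p (fob (cfun K) X) (fob (cfun K) (fob (cfun K) X)) (comult K X) t))"
    and L_lan: "is_lan Set_cat Set_cat Set_cat p (comp_functor Set_cat p (cfun K)) L \<eta>"
  shows "comonad_iso M (lan_comonad p K L \<eta>)"
proof -
  let ?k = "cfun K" and ?m = "cfun M" and ?N = "lan_comonad p K L \<eta>"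
  let ?pk = "comp_functor Set_cat p ?k" and ?I = "id_functor Set_cat :: 'u endo"
  have p: "is_functor Set_cat Set_cat p" and L: "is_functor Set_cat Set_cat L"
    and \<eta>: "nat_trans Set_cat Set_cat ?pk (comp_functor Set_cat L p) \<eta>"
    using L_lan by (simp_all add: is_lan_def)
  have m: "is_functor Set_cat Set_cat ?m"
    and \<eta>\<^sub>0: "nat_trans Set_cat Set_cat ?pk (comp_functor Set_cat ?m p) \<eta>\<^sub>0"
    using M_lan by (simp_all add: is_lan_def)
  have k: "is_functor Set_cat Set_cat ?k"
    and \<delta>K: "nat_trans Set_cat Set_cat ?k (comp_functor Set_cat ?k ?k) (comult K)"
    using K nat_trans_dom by (auto simp: is_comonad_iff)
  have \<epsilon>M: "nat_trans Set_cat Set_cat ?m ?I (counit M)"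
    and \<delta>M: "nat_trans Set_cat Set_cat ?m (comp_functor Set_cat ?m ?m) (comult M)"
    using M by (simp_all add: is_comonad_iff)
  obtain \<phi> where \<phi>: "nat_trans Set_cat Set_cat ?m L \<phi>"
    and \<phi>_eq: "\<And>X t. small X \<Longrightarrow> t \<in> fob p (fob ?k X) \<Longrightarrow> \<phi> (fob p X) (\<eta>\<^sub>0 X t) = \<eta> X t"
    using lan_universal[OF M_lan L \<eta>] by auto
  obtain \<psi> where \<psi>: "nat_trans Set_cat Set_cat L ?m \<psi>"
    and \<psi>_eq: "\<And>X t. small X \<Longrightarrow> t \<in> fob p (fob ?k X) \<Longrightarrow> \<psi> (fob p X) (\<eta> X t) = \<eta>\<^sub>0 X t"
    using lan_universal[OF L_lan m \<eta>\<^sub>0] by auto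
  have Id: "nat_trans Set_cat Set_cat F F (\<lambda>X\<in>Obj Set_cat. Ident Set_cat (fob F X))"
    if F: "is_functor Set_cat Set_cat F" for F :: "'u endo"
    by (rule ntI[OF F F restrict_extensional]) (simp_all add: endo_in[OF F])
  have \<eta>_in: "\<eta> X t \<in> fob L (fob p X)" and \<eta>\<^sub>0_in: "\<eta>\<^sub>0 X t \<in> fob ?m (fob p X)"
    if "small X" "t \<in> fob p (fob ?k X)" for X t
    using nt_in[OF \<eta> _ that(1), of t] nt_in[OF \<eta>\<^sub>0 _ that(1), of t] that by simp_all
  note small = endo_small[OF p] endo_small[OF k] endo_small[OF L] endo_small[OF m]
  have "vcomp Set_cat Set_cat ?m L ?m \<psi> \<phi> = (\<lambda>X\<in>Obj Set_cat. Ident Set_cat (fob ?m X))"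
    by (rule lan_unique[OF M_lan vcomp_nt[OF \<phi> \<psi>] Id[OF m]])
      (simp add: small \<phi>_eq \<psi>_eq \<eta>\<^sub>0_in)
  then have \<psi>\<phi>: "\<psi> X (\<phi> X t) = t" if "small X" "t \<in> fob ?m X" for X t
    using that unfolding vcomp_eq_Ident_iff by blast
  have "vcomp Set_cat Set_cat L ?m L \<phi> \<psi> = (\<lambda>X\<in>Obj Set_cat. Ident Set_cat (fob L X))"
    by (rule lan_unique[OF L_lan vcomp_nt[OF \<psi> \<phi>] Id[OF L]])
      (simp add: small \<phi>_eq \<psi>_eq \<eta>_in)
  then have \<phi>\<psi>: "\<phi> X (\<psi> X t) = t" if "small X" "t \<in> fob L X" for X t
    using that unfolding vcomp_eq_Ident_iff by blast
  have \<epsilon>N: "nat_trans Set_cat Set_cat L ?I (counit ?N)"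
    and N_counit: "\<And>X t. small X \<Longrightarrow> t \<in> fob p (fob ?k X) \<Longrightarrow>
      counit ?N (fob p X) (\<eta> X t) = farr p (fob ?k X) X (counit K X) t"
    using lan_comonad_counit[OF K L_lan] by simp_all
  have \<delta>N: "nat_trans Set_cat Set_cat L (comp_functor Set_cat L L) (comult ?N)"
    and N_comult: "\<And>X t. small X \<Longrightarrow> t \<in> fob p (fob ?k X) \<Longrightarrow> comult ?N (fob p X) (\<eta> X t)
      = farr L (fob p (fob ?k X)) (fob L (fob p X)) (\<eta> X)
          (\<eta> (fob ?k X) (farr p (fob ?k X) (fob ?k (fob ?k X)) (comult K X) t))"
    using lan_comonad_comult[OF K L_lan] by simp_all
  have "vcomp Set_cat Set_cat ?m L ?I (counit ?N) \<phi> = counit M"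
    by (rule lan_unique[OF M_lan vcomp_nt[OF \<phi> \<epsilon>N] \<epsilon>M])
      (simp add: small \<phi>_eq \<eta>\<^sub>0_in N_counit M_counit)
  then have \<epsilon>\<phi>: "counit ?N X (\<phi> X t) = counit M X t" if "small X" "t \<in> fob ?m X" for X t
    using that by (metis vcomp_app)
  let ?mm = "comp_functor Set_cat ?m ?m" and ?mL = "comp_functor Set_cat ?m L"
    and ?LL = "comp_functor Set_cat L L"
  let ?\<phi>\<phi> = "vcomp Set_cat Set_cat ?mm ?mL ?LL (whisker_right Set_cat L \<phi>)
    (whisker_left Set_cat ?m ?m L \<phi>)"
  have \<phi>\<phi>: "nat_trans Set_cat Set_cat ?mm ?LL ?\<phi>\<phi>"
    by (rule vcomp_nt[OF whisker_left_nt[OF m \<phi>] whisker_right_nt[OF L \<phi>]])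
  \<comment> \<open>Compatibility with comultiplication compares two transformations out of the Kan
    extension \<open>cfun M\<close>, so it is enough to compare them after the unit
    \<open>\<eta>\<^sub>0\<close>.\<close>
  have "vcomp Set_cat Set_cat ?m L ?LL (comult ?N) \<phi> = vcomp Set_cat Set_cat ?m ?mm ?LL ?\<phi>\<phi> (comult M)"
  proof (rule lan_unique[OF M_lan vcomp_nt[OF \<phi> \<delta>N] vcomp_nt[OF \<delta>M \<phi>\<phi>]])
    fix X t assume X: "small X" and "t \<in> fob ?pk X"
    then have t: "t \<in> fob p (fob ?k X)"
      by simp
    let ?kX = "fob ?k X" and ?pX = "fob p X" and ?pkX = "fob p (fob ?k X)"
    have \<eta>X: "\<eta> X \<in> ?pkX \<rightarrow>\<^sub>E fob L ?pX" and \<eta>\<^sub>0X: "\<eta>\<^sub>0 X \<in> ?pkX \<rightarrow>\<^sub>E fob ?m ?pX"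
      using nt_PiE[OF \<eta> X] nt_PiE[OF \<eta>\<^sub>0 X] X by simp_all
    have \<phi>pX: "\<phi> ?pX \<in> fob ?m ?pX \<rightarrow>\<^sub>E fob L ?pX"
      by (rule nt_PiE[OF \<phi>]) (simp add: small X)
    define s where "s = farr p ?kX (fob ?k ?kX) (comult K X) t"
    have s: "s \<in> fob p (fob ?k ?kX)"
      unfolding s_def using endo_in[OF p] nt_PiE[OF \<delta>K X] X t by (simp add: small)
    have "comult M ?pX (\<eta>\<^sub>0 X t) = farr ?m ?pkX (fob ?m ?pX) (\<eta>\<^sub>0 X) (\<eta>\<^sub>0 ?kX s)"
      unfolding s_def by (rule M_comult[OF X t])
    \<comment> \<open>The comultiplication of \<open>M\<close> on a unit contains
      \<open>\<eta>\<^sub>0\<close> twice. Here \<phi> turns the occurrence under \<open>m\<close>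
      into \<eta>; naturality of \<phi> then exposes the remaining one.\<close>
    then have "farr ?m (fob ?m ?pX) (fob L ?pX) (\<phi> ?pX) (comult M ?pX (\<eta>\<^sub>0 X t))
        = farr ?m ?pkX (fob L ?pX) (\<eta> X) (\<eta>\<^sub>0 ?kX s)"
      using endo_comp[OF m, of ?pkX "fob ?m ?pX" "fob L ?pX" "\<eta>\<^sub>0 X" "\<phi> ?pX" "\<eta> X"]
      by (simp add: small X \<eta>X \<eta>\<^sub>0X \<phi>pX \<phi>_eq \<eta>\<^sub>0_in s)
    then have "\<phi> (fob L ?pX) (farr ?m (fob ?m ?pX) (fob L ?pX) (\<phi> ?pX) (comult M ?pX (\<eta>\<^sub>0 X t)))
        = farr L ?pkX (fob L ?pX) (\<eta> X) (\<phi> ?pkX (\<eta>\<^sub>0 ?kX s))"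
      using nt_natural[OF \<phi> \<eta>X \<eta>\<^sub>0_in[OF _ s]] by (simp add: small X)
    also have "\<dots> = comult ?N ?pX (\<eta> X t)"
      using X t s by (simp add: small \<phi>_eq N_comult flip: s_def)
    finally show "vcomp Set_cat Set_cat ?m L ?LL (comult ?N) \<phi> (fob p X) (\<eta>\<^sub>0 X t)
        = vcomp Set_cat Set_cat ?m ?mm ?LL ?\<phi>\<phi> (comult M) (fob p X) (\<eta>\<^sub>0 X t)"
      using X t nt_in[OF \<delta>M \<eta>\<^sub>0_in[OF X t]] by (simp add: small \<eta>\<^sub>0_in \<phi>_eq)
  qed
  then have \<delta>\<phi>: "comult ?N X (\<phi> X t)
      = \<phi> (fob L X) (farr ?m (fob ?m X) (fob L X) (\<phi> X) (comult M X t))"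
    if X: "small X" and t: "t \<in> fob ?m X" for X t
    unfolding vcomp_eq_vcomp_iff using X t nt_in[OF \<delta>M t X] by (simp add: small)
  have "?N = \<lparr>cfun = L, counit = counit ?N, comult = comult ?N\<rparr>"
    by (rule comonad.equality) (simp_all add: cfun_lan_comonad[OF K L_lan])
  then show ?thesis
    using comonad_transport[OF M \<phi> \<psi> \<psi>\<phi> \<phi>\<psi> \<epsilon>N \<delta>N \<epsilon>\<phi> \<delta>\<phi>] by simp
qed

section \<open>The comonad of a category\<close>

lemma vfst_out: "m \<in> out C c \<Longrightarrow> vfst m \<in> Obj C"
  and vsnd_out: "m \<in> out C c \<Longrightarrow> vsnd m \<in> Hom C c (vfst m)"
  and vpair_out: "m \<in> out C c \<Longrightarrow> vpair (vfst m) (vsnd m) = m"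
  by (auto elim: outE)

lemma cfun_cat_comonad [simp]: "cfun (cat_comonad C) = poly_functor (cat_polyn C)"
  by (simp add: cat_comonad_def Let_def)

context
  fixes C :: "('u::set_universe, 'u) category"
  assumes C: "is_small_category C"
begin

lemma cat_polyn_in_Poly: "cat_polyn C \<in> Obj Poly"
  using C out_small[OF C] by (auto simp: Poly_def cat_polyn_def is_small_category_def)

lemma cat_comonad_functor: "is_functor Set_cat Set_cat (poly_functor (cat_polyn C))"
  by (rule poly_functor_is_functor[OF cat_polyn_in_Poly])

text \<open>Membership test on normal forms. From here on \<open>fob_poly_functor\<close> is mostly
  removed from the simpset, since unfolding to a \<open>vSigma\<close> would destroy the shapes that
  this rule and its companions match.\<close>

lemma vpair_in_cat_comonad:
  "small X \<Longrightarrow> vpair c (vlam (out C c) g) \<in> fob (poly_functor (cat_polyn C)) X \<longleftrightarrow>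
    c \<in> Obj C \<and> (\<forall>m\<in>out C c. g m \<in> X)"
  by (auto simp: cat_polyn_def out_small[OF C])

lemma cat_comonad_elemE:
  assumes "t \<in> fob (poly_functor (cat_polyn C)) X" "small X"
  obtains c g where "t = vpair c (vlam (out C c) g)" "c \<in> Obj C" "\<And>m. m \<in> out C c \<Longrightarrow> g m \<in> X"
  using assms by (rule poly_elemE) (auto simp: cat_polyn_def)

lemma farr_cat_comonad:
  assumes "small X" "small Y" "f \<in> X \<rightarrow>\<^sub>E Y" "c \<in> Obj C" "\<And>m. m \<in> out C c \<Longrightarrow> g m \<in> X"
  shows "farr (poly_functor (cat_polyn C)) X Y f (vpair c (vlam (out C c) g))
    = vpair c (vlam (out C c) (\<lambda>m. f (g m)))"
  using farr_poly_functor[OF cat_polyn_in_Poly assms(1-3), of c g] assms(4,5)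
  by (simp add: cat_polyn_def)

lemma counit_cat_comonad:
  assumes "small X" "c \<in> Obj C" "\<And>m. m \<in> out C c \<Longrightarrow> g m \<in> X"
  shows "counit (cat_comonad C) X (vpair c (vlam (out C c) g)) = g (vpair c (Ident C c))"
  using assms vpair_in_cat_comonad[OF assms(1), of c g]
  by (simp add: cat_comonad_def Let_def out_small[OF C] Ident_in[OF small_category_is_category[OF C]]
      del: fob_poly_functor)

lemma comult_cat_comonad:
  assumes "small X" "c \<in> Obj C" "\<And>m. m \<in> out C c \<Longrightarrow> g m \<in> X"
  shows "comult (cat_comonad C) X (vpair c (vlam (out C c) g))
    = vpair c (vlam (out C c) (\<lambda>f. vpair (vfst f) (vlam (out C (vfst f)) (\<lambda>f'.
        g (vpair (vfst f') (Comp C c (vfst f) (vfst f') (vsnd f') (vsnd f)))))))"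
  using assms vpair_in_cat_comonad[OF assms(1), of c g]
  by (simp add: cat_comonad_def Let_def out_small[OF C] vfst_out vsnd_out
      Comp_in[OF small_category_is_category[OF C]] del: fob_poly_functor)

text \<open>On normal forms the counit evaluates at an identity and the comultiplication
  precomposes, so the counit laws are the unit laws of \<open>C\<close> and coassociativity is
  associativity of composition.\<close>

lemma cat_comonad_is_comonad: "is_comonad (cat_comonad C)"
proof -
  let ?k = "poly_functor (cat_polyn C)"
  note cat = small_category_is_category[OF C] and k = cat_comonad_functor
  note simps = endo_small[OF k] vpair_in_cat_comonad farr_cat_comonad counit_cat_comonad
    comult_cat_comonad out_small[OF C] vfst_out vsnd_out vpair_out
    Ident_in[OF cat] Comp_in[OF cat] Comp_Ident_left[OF cat] Comp_Ident_right[OF cat]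
    Comp_assoc[OF cat]
  have ext: "counit (cat_comonad C) X \<in> extensional (fob ?k X)"
    "comult (cat_comonad C) X \<in> extensional (fob ?k X)" if "small X" for X
    using that by (simp_all add: cat_comonad_def Let_def)
  have \<epsilon>_in: "counit (cat_comonad C) X t \<in> X" if "small X" "t \<in> fob ?k X" for X t
    by (rule cat_comonad_elemE[OF that(2,1)]) (simp add: that(1) simps)
  have \<delta>_in: "comult (cat_comonad C) X t \<in> fob ?k (fob ?k X)" if "small X" "t \<in> fob ?k X" for X t
    by (rule cat_comonad_elemE[OF that(2,1)]) (simp add: that(1) simps del: fob_poly_functor)
  have \<epsilon>X: "counit (cat_comonad C) X \<in> fob ?k X \<rightarrow>\<^sub>E X"
    and \<delta>X: "comult (cat_comonad C) X \<in> fob ?k X \<rightarrow>\<^sub>E fob ?k (fob ?k X)" if "small X" for X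
    using ext[OF that] \<epsilon>_in[OF that] \<delta>_in[OF that] by (simp_all add: PiE_iff del: fob_poly_functor)
  have "nat_trans Set_cat Set_cat ?k (id_functor Set_cat) (counit (cat_comonad C))"
  proof (rule ntI[OF k id_functor_is_functor[OF Set_cat_is_category]])
    show "counit (cat_comonad C) \<in> extensional (Obj Set_cat)"
      by (simp add: cat_comonad_def Let_def)
    fix X Y :: "'u set" and f t
    assume *: "small X" "small Y" "f \<in> X \<rightarrow>\<^sub>E Y" "t \<in> fob ?k X"
    have fX: "f x \<in> Y" if "x \<in> X" for x
      using *(3) that by auto
    show "counit (cat_comonad C) Y (farr ?k X Y f t)
        = farr (id_functor Set_cat) X Y f (counit (cat_comonad C) X t)"
      by (rule cat_comonad_elemE[OF *(4,1)])
        (use * fX in \<open>simp add: simps del: fob_poly_functor\<close>)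
  qed (simp_all add: ext \<epsilon>_in del: fob_poly_functor)
  moreover have "nat_trans Set_cat Set_cat ?k (comp_functor Set_cat ?k ?k) (comult (cat_comonad C))"
  proof (rule ntI[OF k comp_functor_is_functor[OF k k]])
    show "comult (cat_comonad C) \<in> extensional (Obj Set_cat)"
      by (simp add: cat_comonad_def Let_def)
    fix X Y :: "'u set" and f t
    assume *: "small X" "small Y" "f \<in> X \<rightarrow>\<^sub>E Y" "t \<in> fob ?k X"
    have fX: "f x \<in> Y" if "x \<in> X" for x
      using *(3) that by auto
    have kf: "farr ?k X Y f \<in> fob ?k X \<rightarrow>\<^sub>E fob ?k Y"
      by (rule endo_PiE[OF k *(3,1,2)])
    show "comult (cat_comonad C) Y (farr ?k X Y f t)
        = farr (comp_functor Set_cat ?k ?k) X Y f (comult (cat_comonad C) X t)"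
      by (rule cat_comonad_elemE[OF *(4,1)])
        (use * fX kf in \<open>simp add: simps del: fob_poly_functor\<close>)
  qed (simp_all add: ext \<delta>_in del: fob_poly_functor)
  moreover have "farr ?k (fob ?k X) X (counit (cat_comonad C) X) (comult (cat_comonad C) X t) = t"
      "counit (cat_comonad C) (fob ?k X) (comult (cat_comonad C) X t) = t"
      "farr ?k (fob ?k X) (fob ?k (fob ?k X)) (comult (cat_comonad C) X) (comult (cat_comonad C) X t)
        = comult (cat_comonad C) (fob ?k X) (comult (cat_comonad C) X t)"
    if X: "small X" and t: "t \<in> fob ?k X" for X t
  proof -
    obtain c g where t: "t = vpair c (vlam (out C c) g)" and c: "c \<in> Obj C"
      and g: "\<And>m. m \<in> out C c \<Longrightarrow> g m \<in> X"
      using cat_comonad_elemE[OF t X] by blast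
    show "farr ?k (fob ?k X) X (counit (cat_comonad C) X) (comult (cat_comonad C) X t) = t"
      "counit (cat_comonad C) (fob ?k X) (comult (cat_comonad C) X t) = t"
      "farr ?k (fob ?k X) (fob ?k (fob ?k X)) (comult (cat_comonad C) X) (comult (cat_comonad C) X t)
        = comult (cat_comonad C) (fob ?k X) (comult (cat_comonad C) X t)"
      unfolding t using \<epsilon>X[OF X] \<delta>X[OF X] c g by (simp_all add: X simps del: fob_poly_functor)
  qed
  ultimately show ?thesis
    by (simp add: is_comonad_iff del: fob_poly_functor)
qed

end

section \<open>Selection categories as left Kan extensions\<close>

text \<open>\<open>fan C p x\<close> is the set \<open>B x\<close> representing the elements of \<open>p k\<close> over \<open>x\<close>; \<open>shape\<close> and
  \<open>fill\<close> are the two components of such an element, and \<open>generic C p x\<close> is the universal one.\<close>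

definition fan :: "('u::set_universe, 'u) category \<Rightarrow> 'u polyn \<Rightarrow> 'u \<Rightarrow> 'u set" where
  "fan C p x = vSigma (sel_ar p x) (\<lambda>a. out C (sel_at x a))"

definition shape :: "'u::set_universe polyn \<Rightarrow> 'u \<Rightarrow> 'u" where
  "shape p t = vpair (vfst t) (vlam (Arity p (vfst t)) (\<lambda>a. vfst (vapp (vsnd t) a)))"

definition fill :: "('u::set_universe, 'u) category \<Rightarrow> 'u polyn \<Rightarrow> 'u \<Rightarrow> 'u \<Rightarrow> 'u" where
  "fill C p t = (\<lambda>s\<in>fan C p (shape p t). vapp (vsnd (vapp (vsnd t) (vfst s))) (vsnd s))"

definition generic :: "('u::set_universe, 'u) category \<Rightarrow> 'u polyn \<Rightarrow> 'u \<Rightarrow> 'u" where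
  "generic C p x = vpair (vfst x) (vlam (sel_ar p x) (\<lambda>a.
     vpair (sel_at x a) (vlam (out C (sel_at x a)) (\<lambda>f. vpair a f))))"

text \<open>The arrows out of \<open>x\<close> in the selection category correspond to the elements of
  \<open>p (fan C p x)\<close>, by moving codomains into the components.\<close>

definition sel_split :: "'u::set_universe polyn \<Rightarrow> 'u \<Rightarrow> 'u" where
  "sel_split p m = vpair (vfst (vfst m)) (vlam (Arity p (vfst (vfst m))) (\<lambda>b.
     vpair (vfst (vapp (vsnd m) b)) (vpair (sel_at (vfst m) b) (vsnd (vapp (vsnd m) b)))))"

definition sel_merge :: "'u::set_universe polyn \<Rightarrow> 'u \<Rightarrow> 'u" where
  "sel_merge p s = vpair
     (vpair (vfst s) (vlam (Arity p (vfst s)) (\<lambda>b. vfst (vsnd (vapp (vsnd s) b)))))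
     (vlam (Arity p (vfst s)) (\<lambda>b. vpair (vfst (vapp (vsnd s) b)) (vsnd (vsnd (vapp (vsnd s) b)))))"

text \<open>On the summand of \<open>x\<close> this is the map from functions
  \<open>B x \<rightarrow> X\<close> to functions \<open>p (B x) \<rightarrow> p X\<close> given by
  the action of \<open>p\<close>; \<open>sel_split\<close> reads an arrow out of \<open>x\<close> as
  an element of \<open>p (B x)\<close>.\<close>

definition sel_unit :: "('u::set_universe, 'u) category \<Rightarrow> 'u polyn \<Rightarrow> 'u endo_nat" where
  "sel_unit C p = (\<lambda>X\<in>Obj Set_cat. \<lambda>t\<in>fob (poly_functor p) (fob (poly_functor (cat_polyn C)) X).
     vpair (shape p t) (vlam (out (sel_cat C p) (shape p t)) (\<lambda>m.
       farr (poly_functor p) (fan C p (shape p t)) X (fill C p t) (sel_split p m))))"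

context
  fixes C :: "('u::set_universe, 'u) category" and p :: "'u polyn"
  assumes C: "is_small_category C" and p: "p \<in> Obj Poly"
begin

private lemmas cat = small_category_is_category[OF C]
  and P = poly_functor_is_functor[OF p]
  and k = cat_comonad_functor[OF C]
  and S = sel_cat_is_small_category[OF C p]
  and small_ar = Poly_small_Arity[OF p]

lemma pk_functor:
  "is_functor Set_cat Set_cat (comp_functor Set_cat (poly_functor p) (poly_functor (cat_polyn C)))"
  by (rule comp_functor_is_functor[OF k P])

lemma small_fan: "x \<in> sel_obj C p \<Longrightarrow> small (fan C p x)"
  unfolding fan_def by (intro small_vSigma out_small[OF C] small_sel_ar[OF p] sel_at_in[OF p])

section \<open>Normal forms of selection objects and of elements of \<open>p (k X)\<close>\<close>

lemma vpair_in_sel_obj: "vpair i (vlam (Arity p i) c) \<in> sel_obj C p \<longleftrightarrow>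
    i \<in> Idx p \<and> (\<forall>a\<in>Arity p i. c a \<in> Obj C)"
  by (auto simp: sel_obj_def small_ar)

lemma sel_objE:
  assumes "x \<in> sel_obj C p"
  obtains i c where "x = vpair i (vlam (Arity p i) c)" "i \<in> Idx p" "\<And>a. a \<in> Arity p i \<Longrightarrow> c a \<in> Obj C"
  using assms unfolding sel_obj_def by (auto simp: vPi_def)

lemma poly_elem_iff: "small X \<Longrightarrow> vpair i (vlam (Arity p i) g) \<in> fob (poly_functor p) X \<longleftrightarrow>
    i \<in> Idx p \<and> (\<forall>a\<in>Arity p i. g a \<in> X)"
  by (auto simp: small_ar)

lemma pk_elemE:
  assumes t: "t \<in> fob (poly_functor p) (fob (poly_functor (cat_polyn C)) X)" and X: "small X"
  obtains i c \<phi> where "t = vpair i (vlam (Arity p i) (\<lambda>a. vpair (c a) (vlam (out C (c a)) (\<phi> a))))"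
    "i \<in> Idx p" "\<And>a. a \<in> Arity p i \<Longrightarrow> c a \<in> Obj C"
    "\<And>a f. a \<in> Arity p i \<Longrightarrow> f \<in> out C (c a) \<Longrightarrow> \<phi> a f \<in> X"
proof -
  obtain i g where t_eq: "t = vpair i (vlam (Arity p i) g)" and i: "i \<in> Idx p"
    and g: "\<And>a. a \<in> Arity p i \<Longrightarrow> g a \<in> fob (poly_functor (cat_polyn C)) X"
    using poly_elemE[OF t endo_small[OF k X]] by blast
  \<comment> \<open>The object and the filling over \<open>a\<close> are projections of
    \<open>g a\<close>, hence given uniformly in \<open>a\<close>; this yields the functions
    \<open>c\<close> and \<phi> directly.\<close>
  have "g a = vpair (vfst (g a)) (vlam (out C (vfst (g a))) (vapp (vsnd (g a)))) \<and>
      vfst (g a) \<in> Obj C \<and> (\<forall>f\<in>out C (vfst (g a)). vapp (vsnd (g a)) f \<in> X)" if "a \<in> Arity p i" for a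
    by (rule cat_comonad_elemE[OF C g[OF that] X]) (simp add: out_small[OF C])
  note g' = this
  show ?thesis
  proof (rule that)
    show "t = vpair i (vlam (Arity p i) (\<lambda>a. vpair (vfst (g a)) (vlam (out C (vfst (g a))) (vapp (vsnd (g a))))))"
      unfolding t_eq using vlam_cong[OF refl g'[THEN conjunct1]] by (rule arg_cong)
  qed (use i g' in blast)+
qed

lemma shape_vpair:
  "i \<in> Idx p \<Longrightarrow> shape p (vpair i (vlam (Arity p i) (\<lambda>a. vpair (c a) (h a))))
    = vpair i (vlam (Arity p i) c)"
  by (simp add: shape_def small_ar)

lemma fan_vpair: "i \<in> Idx p \<Longrightarrow> fan C p (vpair i (vlam (Arity p i) c)) = vSigma (Arity p i) (\<lambda>a. out C (c a))"
  by (auto simp: fan_def small_ar)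

lemma fill_vpair:
  "i \<in> Idx p \<Longrightarrow> (\<And>a. a \<in> Arity p i \<Longrightarrow> c a \<in> Obj C)
    \<Longrightarrow> fill C p (vpair i (vlam (Arity p i) (\<lambda>a. vpair (c a) (vlam (out C (c a)) (\<phi> a)))))
      = (\<lambda>s\<in>vSigma (Arity p i) (\<lambda>a. out C (c a)). \<phi> (vfst s) (vsnd s))"
  unfolding fill_def
  by (auto simp: shape_vpair fan_vpair small_ar out_small[OF C] fun_eq_iff restrict_def)

lemma shape_in:
  assumes "t \<in> fob (poly_functor p) (fob (poly_functor (cat_polyn C)) X)" "small X"
  shows "shape p t \<in> sel_obj C p"
  by (rule pk_elemE[OF assms]) (simp add: shape_vpair vpair_in_sel_obj)

lemma fill_in:
  assumes "t \<in> fob (poly_functor p) (fob (poly_functor (cat_polyn C)) X)" "small X"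
  shows "fill C p t \<in> fan C p (shape p t) \<rightarrow>\<^sub>E X"
  by (rule pk_elemE[OF assms]) (auto simp: fill_vpair shape_vpair fan_vpair)

lemma farr_pk:
  assumes X: "small X" "small Y" and f: "f \<in> X \<rightarrow>\<^sub>E Y" and i: "i \<in> Idx p"
    and c: "\<And>a. a \<in> Arity p i \<Longrightarrow> c a \<in> Obj C"
    and \<phi>: "\<And>a m. a \<in> Arity p i \<Longrightarrow> m \<in> out C (c a) \<Longrightarrow> \<phi> a m \<in> X"
  shows "farr (comp_functor Set_cat (poly_functor p) (poly_functor (cat_polyn C))) X Y f
      (vpair i (vlam (Arity p i) (\<lambda>a. vpair (c a) (vlam (out C (c a)) (\<phi> a)))))
    = vpair i (vlam (Arity p i) (\<lambda>a. vpair (c a) (vlam (out C (c a)) (\<lambda>m. f (\<phi> a m)))))"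
  using X f c \<phi>
  by (simp add: farr_poly_functor[OF p _ _ _ i] endo_small[OF k] endo_PiE[OF k]
      vpair_in_cat_comonad[OF C] farr_cat_comonad[OF C] del: fob_poly_functor)

text \<open>Together with \<open>fill_farr\<close>: acting by \<open>f\<close> keeps the summand and
  postcomposes the filling. This is the naturality of the decomposition of \<open>p k\<close> into
  the representables \<open>Set(fan C p x, -)\<close>.\<close>

lemma shape_farr:
  assumes t: "t \<in> fob (poly_functor p) (fob (poly_functor (cat_polyn C)) X)"
    and X: "small X" "small Y" and f: "f \<in> X \<rightarrow>\<^sub>E Y"
  shows "shape p (farr (comp_functor Set_cat (poly_functor p) (poly_functor (cat_polyn C))) X Y f t) = shape p t"
  by (rule pk_elemE[OF t X(1)]) (simp add: farr_pk[OF X f] shape_vpair del: farr_comp_functor comp_functor_Set_simps)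

lemma fill_farr:
  assumes t: "t \<in> fob (poly_functor p) (fob (poly_functor (cat_polyn C)) X)"
    and X: "small X" "small Y" and f: "f \<in> X \<rightarrow>\<^sub>E Y" and s: "s \<in> fan C p (shape p t)"
  shows "fill C p (farr (comp_functor Set_cat (poly_functor p) (poly_functor (cat_polyn C))) X Y f t) s
    = f (fill C p t s)"
  by (rule pk_elemE[OF t X(1)])
    (use s in \<open>simp add: farr_pk[OF X f] shape_vpair fan_vpair fill_vpair
      del: farr_comp_functor comp_functor_Set_simps\<close>)

lemma generic_vpair:
  "i \<in> Idx p \<Longrightarrow> generic C p (vpair i (vlam (Arity p i) c))
    = vpair i (vlam (Arity p i) (\<lambda>a. vpair (c a) (vlam (out C (c a)) (\<lambda>f. vpair a f))))"
  by (simp add: generic_def small_ar)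

lemma generic_in:
  assumes x: "x \<in> sel_obj C p"
  shows "generic C p x \<in> fob (poly_functor p) (fob (poly_functor (cat_polyn C)) (fan C p x))"
  by (rule sel_objE[OF x])
    (use small_fan[OF x] in \<open>simp add: generic_vpair poly_elem_iff endo_small[OF k]
      vpair_in_cat_comonad[OF C] fan_vpair del: fob_poly_functor\<close>)

lemma shape_generic: "x \<in> sel_obj C p \<Longrightarrow> shape p (generic C p x) = x"
  by (erule sel_objE) (simp add: generic_vpair shape_vpair)

lemma fill_generic:
  assumes x: "x \<in> sel_obj C p" and s: "s \<in> fan C p x"
  shows "fill C p (generic C p x) s = s"
  by (rule sel_objE[OF x]) (use s in \<open>auto simp: generic_vpair fill_vpair fan_vpair\<close>)

text \<open>The Yoneda step: an element is the image of the generic element of its shape under its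
  own filling. A natural transformation out of \<open>p k\<close> is therefore determined by its
  values on generic elements.\<close>

lemma farr_fill_generic:
  assumes t: "t \<in> fob (poly_functor p) (fob (poly_functor (cat_polyn C)) X)" and X: "small X"
  shows "farr (comp_functor Set_cat (poly_functor p) (poly_functor (cat_polyn C)))
    (fan C p (shape p t)) X (fill C p t) (generic C p (shape p t)) = t"
proof (rule pk_elemE[OF t X])
  fix i c \<phi>
  assume t_eq: "t = vpair i (vlam (Arity p i) (\<lambda>a. vpair (c a) (vlam (out C (c a)) (\<phi> a))))"
    and i: "i \<in> Idx p" and c: "\<And>a. a \<in> Arity p i \<Longrightarrow> c a \<in> Obj C"
    and \<phi>: "\<And>a f. a \<in> Arity p i \<Longrightarrow> f \<in> out C (c a) \<Longrightarrow> \<phi> a f \<in> X"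
  have shape: "shape p t = vpair i (vlam (Arity p i) c)"
    unfolding t_eq by (rule shape_vpair[OF i])
  have "generic C p (shape p t) = vpair i (vlam (Arity p i) (\<lambda>a. vpair (c a) (vlam (out C (c a)) (vpair a))))"
    unfolding shape by (rule generic_vpair[OF i])
  moreover have "vpair a f \<in> fan C p (shape p t)" if "a \<in> Arity p i" "f \<in> out C (c a)" for a f
    using that by (simp add: shape fan_vpair i)
  ultimately show ?thesis
    using farr_pk[OF small_fan[OF shape_in[OF t X]] X fill_in[OF t X] i c, where \<phi> = vpair]
    by (simp add: t_eq fill_vpair[OF i c] del: farr_comp_functor comp_functor_Set_simps)
qed

section \<open>Arrows out of \<open>x\<close> as elements of \<open>p (fan C p x)\<close>\<close>

context
  fixes x assumes x: "x \<in> sel_obj C p"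
begin

lemma sel_split_in:
  assumes m: "m \<in> out (sel_cat C p) x"
  shows "sel_split p m \<in> fob (poly_functor p) (fan C p x)"
proof -
  obtain y h where m_eq: "m = vpair y h" and y: "y \<in> sel_obj C p" and h: "h \<in> sel_hom C p p x y"
    using m by (auto elim: outE)
  have "vfst y \<in> Idx p"
    using y by (auto simp: sel_obj_def)
  moreover have "vpair (vfst (vapp h b)) (vpair (sel_at y b) (vsnd (vapp h b))) \<in> fan C p x"
    if "b \<in> Arity p (vfst y)" for b
    using that sel_hom_fst[OF p y h] sel_hom_snd[OF p y h] sel_at_in[OF p y]
    by (simp add: fan_def flip: sel_ar_def)
  ultimately show ?thesis
    by (simp add: sel_split_def m_eq poly_elem_iff small_fan[OF x] del: fob_poly_functor)
qed

lemma sel_merge_in: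
  assumes s: "s \<in> fob (poly_functor p) (fan C p x)"
  shows "sel_merge p s \<in> out (sel_cat C p) x"
proof (rule poly_elemE[OF s small_fan[OF x]])
  fix i g assume s_eq: "s = vpair i (vlam (Arity p i) g)" and i: "i \<in> Idx p"
    and g: "\<And>a. a \<in> Arity p i \<Longrightarrow> g a \<in> fan C p x"
  have g': "vfst (g a) \<in> sel_ar p x \<and> vfst (vsnd (g a)) \<in> Obj C \<and>
      vsnd (vsnd (g a)) \<in> Hom C (sel_at x (vfst (g a))) (vfst (vsnd (g a)))" if "a \<in> Arity p i" for a
    using g[OF that] by (auto simp: fan_def elim: outE)
  \<comment> \<open>The codomain of the arrow is assembled from the codomains stored with the
    individual arrows of \<open>C\<close>.\<close>
  let ?y = "vpair i (vlam (Arity p i) (\<lambda>b. vfst (vsnd (g b))))"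
  have "vlam (sel_ar p ?y) (\<lambda>b. vpair (vfst (g b)) (vsnd (vsnd (g b)))) \<in> sel_hom C p p x ?y"
    by (rule vlam_in_sel_hom) (use g' in \<open>simp add: small_ar[OF i]\<close>)
  then show ?thesis
    using g' by (simp add: sel_merge_def s_eq small_ar[OF i] vpair_in_sel_obj i)
qed

lemma sel_merge_split:
  assumes m: "m \<in> out (sel_cat C p) x"
  shows "sel_merge p (sel_split p m) = m"
proof -
  obtain y h where m_eq: "m = vpair y h" and y: "y \<in> sel_obj C p" and h: "h \<in> sel_hom C p p x y"
    using m by (auto elim: outE)
  have "vfst y \<in> Idx p"
    using y by (auto simp: sel_obj_def)
  moreover have "vpair (vfst y) (vlam (Arity p (vfst y)) (sel_at y)) = y"
    "vlam (Arity p (vfst y)) (vapp h) = h"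
    using sel_obj_eta[OF p y] sel_hom_eta[OF p y h] by (simp_all add: sel_ar_def)
  ultimately show ?thesis
    using sel_hom_vpair[OF p y h]
    by (simp add: sel_merge_def sel_split_def m_eq sel_ar_def small_ar)
qed

lemma sel_split_merge:
  assumes s: "s \<in> fob (poly_functor p) (fan C p x)"
  shows "sel_split p (sel_merge p s) = s"
proof (rule poly_elemE[OF s small_fan[OF x]])
  fix i g assume s_eq: "s = vpair i (vlam (Arity p i) g)" and i: "i \<in> Idx p"
    and g: "\<And>a. a \<in> Arity p i \<Longrightarrow> g a \<in> fan C p x"
  have "vpair (vfst (g a)) (vpair (vfst (vsnd (g a))) (vsnd (vsnd (g a)))) = g a" if "a \<in> Arity p i" for a
    using g[OF that] by (auto simp: fan_def elim: outE)
  then show ?thesis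
    by (simp add: sel_merge_def sel_split_def s_eq small_ar[OF i])
qed

end

lemma sel_unit_eq:
  assumes "t \<in> fob (poly_functor p) (fob (poly_functor (cat_polyn C)) X)" "small X"
  shows "sel_unit C p X t = vpair (shape p t) (vlam (out (sel_cat C p) (shape p t)) (\<lambda>m.
       farr (poly_functor p) (fan C p (shape p t)) X (fill C p t) (sel_split p m)))"
  using assms by (simp add: sel_unit_def del: fob_poly_functor)

lemma sel_unit_nat_trans:
  "nat_trans Set_cat Set_cat (comp_functor Set_cat (poly_functor p) (poly_functor (cat_polyn C)))
    (comp_functor Set_cat (poly_functor (cat_polyn (sel_cat C p))) (poly_functor p)) (sel_unit C p)"
proof (rule ntI[OF pk_functor comp_functor_is_functor[OF P cat_comonad_functor[OF S]]])
  show "sel_unit C p \<in> extensional (Obj Set_cat)"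
    by (simp add: sel_unit_def)
  let ?pk = "comp_functor Set_cat (poly_functor p) (poly_functor (cat_polyn C))"
    and ?P = "poly_functor p" and ?L = "poly_functor (cat_polyn (sel_cat C p))"
  fix X :: "'u set" assume X: "small X"
  then show "sel_unit C p X \<in> extensional (fob ?pk X)"
    by (simp add: sel_unit_def del: fob_poly_functor)
  fix t assume "t \<in> fob ?pk X"
  then have t: "t \<in> fob ?P (fob (poly_functor (cat_polyn C)) X)"
    using X by (simp del: fob_poly_functor)
  note x = shape_in[OF t X]
  have app: "farr ?P (fan C p (shape p t)) X (fill C p t) (sel_split p m) \<in> fob ?P X"
    if "m \<in> out (sel_cat C p) (shape p t)" for m
    using endo_in[OF P fill_in[OF t X] sel_split_in[OF x that] small_fan[OF x] X] .
  then show "sel_unit C p X t \<in> fob (comp_functor Set_cat ?L ?P) X"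
    using X x by (simp add: sel_unit_eq[OF t X] endo_small[OF P] vpair_in_cat_comonad[OF S]
        del: fob_poly_functor)
  fix Y :: "'u set" and f assume Y: "small Y" and f: "f \<in> X \<rightarrow>\<^sub>E Y"
  have ft: "farr ?pk X Y f t \<in> fob ?P (fob (poly_functor (cat_polyn C)) Y)"
    using endo_in[OF pk_functor f _ X Y, of t] t X Y by (simp del: fob_poly_functor)
  \<comment> \<open>The filling of the image of \<open>t\<close> is \<open>f\<close> after the
    filling of \<open>t\<close>, and \<open>p\<close> preserves this composite.\<close>
  have "farr ?P (fan C p (shape p t)) Y (fill C p (farr ?pk X Y f t)) (sel_split p m)
      = farr ?P X Y f (farr ?P (fan C p (shape p t)) X (fill C p t) (sel_split p m))"
    if m: "m \<in> out (sel_cat C p) (shape p t)" for m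
    by (rule endo_comp[OF P small_fan[OF x] X Y fill_in[OF t X] f _ sel_split_in[OF x m], symmetric])
      (use fill_in[OF ft Y] fill_farr[OF t X Y f] shape_farr[OF t X Y f] in simp_all)
  moreover have "farr (comp_functor Set_cat ?L ?P) X Y f = farr ?L (fob ?P X) (fob ?P Y) (farr ?P X Y f)"
    using X Y f by (rule comp_functor_Set_simps(2))
  ultimately show "sel_unit C p Y (farr ?pk X Y f t)
      = farr (comp_functor Set_cat ?L ?P) X Y f (sel_unit C p X t)"
    using farr_cat_comonad[OF S endo_small[OF P X] endo_small[OF P Y] endo_PiE[OF P f X Y]] x app
    by (simp add: sel_unit_eq[OF ft Y] sel_unit_eq[OF t X] shape_farr[OF t X Y f] X Y f
        del: fob_poly_functor comp_functor_Set_simps farr_comp_functor)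
qed

text \<open>Both hom-sets of the universal property are computed by Yoneda: on either side a
  transformation amounts to one element of \<open>R (p (fan C p x))\<close> for each
  \<open>x\<close>, and \<open>sel_unit\<close> matches the two descriptions.\<close>

lemma sel_cat_is_lan:
  "is_lan Set_cat Set_cat Set_cat (poly_functor p)
    (comp_functor Set_cat (poly_functor p) (poly_functor (cat_polyn C)))
    (poly_functor (cat_polyn (sel_cat C p))) (sel_unit C p)"
proof -
  let ?P = "poly_functor p" and ?k = "poly_functor (cat_polyn C)"
    and ?L = "poly_functor (cat_polyn (sel_cat C p))" and ?S = "sel_cat C p"
  let ?pk = "comp_functor Set_cat ?P ?k" and ?\<eta> = "sel_unit C p" and ?B = "fan C p"
  note L = cat_comonad_functor[OF S]
  have "\<exists>!\<beta>. nat_trans Set_cat Set_cat ?L R \<beta> \<and>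
      (\<forall>X t. small X \<longrightarrow> t \<in> fob ?pk X \<longrightarrow> \<beta> (fob ?P X) (?\<eta> X t) = \<alpha> X t)"
    if R: "is_functor Set_cat Set_cat R" and \<alpha>: "nat_trans Set_cat Set_cat ?pk (comp_functor Set_cat R ?P) \<alpha>"
    for R \<alpha>
  proof -
    \<comment> \<open>Transports a function on the arrows out of \<open>x\<close> to
      \<open>p (fan C p x)\<close>, so that \<open>R\<close> can be applied to it.\<close>
    define hat where "hat x g = (\<lambda>s\<in>fob ?P (?B x). vapp g (sel_merge p s))" for x g
    \<comment> \<open>The transformation that Yoneda assigns to the elements obtained by applying
      \<alpha> to the generic elements.\<close>
    define \<beta> where "\<beta> = (\<lambda>X\<in>Obj Set_cat. \<lambda>l\<in>fob ?L X.
      farr R (fob ?P (?B (vfst l))) X (hat (vfst l) (vsnd l)) (\<alpha> (?B (vfst l)) (generic C p (vfst l))))"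
    have \<beta>_eq: "\<beta> X (vpair x (vlam (out ?S x) g)) = farr R (fob ?P (?B x)) X
        (hat x (vlam (out ?S x) g)) (\<alpha> (?B x) (generic C p x))"
      if "small X" "x \<in> sel_obj C p" "\<forall>m\<in>out ?S x. g m \<in> X" for X x g
      using that by (simp add: \<beta>_def vpair_in_cat_comonad[OF S] del: fob_poly_functor)
    have hat_eq: "hat x (vlam (out ?S x) g) = (\<lambda>s\<in>fob ?P (?B x). g (sel_merge p s))"
      if x: "x \<in> sel_obj C p" for x g
      unfolding hat_def using sel_merge_in[OF x] out_small[OF S] x
      by (simp add: fun_eq_iff restrict_def del: fob_poly_functor)
    have hat_in: "hat x (vlam (out ?S x) g) \<in> fob ?P (?B x) \<rightarrow>\<^sub>E X"
      if x: "x \<in> sel_obj C p" and g: "\<forall>m\<in>out ?S x. g m \<in> X" for X x g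
      unfolding hat_eq[OF x] using sel_merge_in[OF x] g by (simp del: fob_poly_functor)
    have \<alpha>_in: "\<alpha> (?B x) (generic C p x) \<in> fob R (fob ?P (?B x))"
      if x: "x \<in> sel_obj C p" for x
      using nt_in[OF \<alpha> _ small_fan[OF x], of "generic C p x"] generic_in[OF x] small_fan[OF x]
      by (simp del: fob_poly_functor)
    have elem: "\<exists>x g. l = vpair x (vlam (out ?S x) g) \<and> x \<in> sel_obj C p \<and> (\<forall>m\<in>out ?S x. g m \<in> X)"
      if "small X" "l \<in> fob ?L X" for X l
      by (rule cat_comonad_elemE[OF S that(2,1)]) auto
    have smallP: "small (fob ?P (?B x))" if "x \<in> sel_obj C p" for x
      by (rule endo_small[OF P small_fan[OF that]])
    have \<beta>: "nat_trans Set_cat Set_cat ?L R \<beta>"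
    proof (rule ntI[OF L R])
      show "\<beta> \<in> extensional (Obj Set_cat)"
        by (simp add: \<beta>_def)
      fix X :: "'u set" assume X: "small X"
      then show "\<beta> X \<in> extensional (fob ?L X)"
        by (simp add: \<beta>_def del: fob_poly_functor)
      fix l assume "l \<in> fob ?L X"
      with X elem obtain x g where l: "l = vpair x (vlam (out ?S x) g)" and x: "x \<in> sel_obj C p"
        and g: "\<forall>m\<in>out ?S x. g m \<in> X"
        by blast
      show "\<beta> X l \<in> fob R X"
        unfolding l \<beta>_eq[OF X x g] by (rule endo_in[OF R hat_in[OF x g] \<alpha>_in[OF x] smallP[OF x] X])
      fix Y :: "'u set" and f assume Y: "small Y" and f: "f \<in> X \<rightarrow>\<^sub>E Y"
      have fg: "\<forall>m\<in>out ?S x. f (g m) \<in> Y"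
        using f g by auto
      have "farr R X Y f (farr R (fob ?P (?B x)) X (hat x (vlam (out ?S x) g)) (\<alpha> (?B x) (generic C p x)))
        = farr R (fob ?P (?B x)) Y (hat x (vlam (out ?S x) (\<lambda>m. f (g m)))) (\<alpha> (?B x) (generic C p x))"
        by (rule endo_comp[OF R smallP[OF x] X Y hat_in[OF x g] f hat_in[OF x fg] \<alpha>_in[OF x]])
          (simp_all add: hat_eq[OF x] del: fob_poly_functor)
      then show "\<beta> Y (farr ?L X Y f l) = farr R X Y f (\<beta> X l)"
        using x g by (simp add: l \<beta>_eq[OF X x g] farr_cat_comonad[OF S X Y f] \<beta>_eq[OF Y x fg])
    qed
    have \<beta>\<eta>: "\<beta> (fob ?P X) (?\<eta> X t) = \<alpha> X t" if X: "small X" and t: "t \<in> fob ?P (fob ?k X)" for X t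
    proof -
      let ?x = "shape p t"
      note x = shape_in[OF t X]
      let ?g = "\<lambda>m. farr ?P (?B ?x) X (fill C p t) (sel_split p m)"
      have g: "\<forall>m\<in>out ?S ?x. ?g m \<in> fob ?P X"
        using endo_in[OF P fill_in[OF t X] sel_split_in[OF x] small_fan[OF x] X] by blast
      have Pf: "farr ?P (?B ?x) X (fill C p t) \<in> fob ?P (?B ?x) \<rightarrow>\<^sub>E fob ?P X"
        by (rule endo_PiE[OF P fill_in[OF t X] small_fan[OF x] X])
      \<comment> \<open>Splitting and merging cancel, so what remains is \<open>p\<close> of the
        filling. Naturality of \<alpha> then moves this filling inside, where it rebuilds
        \<open>t\<close> from the generic element.\<close>
      have "hat ?x (vlam (out ?S ?x) ?g) = farr ?P (?B ?x) X (fill C p t)"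
        unfolding hat_eq[OF x] using Pf sel_split_merge[OF x]
        by (auto simp: fun_eq_iff PiE_iff extensional_def restrict_def simp del: fob_poly_functor)
      then have "\<beta> (fob ?P X) (?\<eta> X t)
          = farr R (fob ?P (?B ?x)) (fob ?P X) (farr ?P (?B ?x) X (fill C p t)) (\<alpha> (?B ?x) (generic C p ?x))"
        by (simp only: sel_unit_eq[OF t X] \<beta>_eq[OF endo_small[OF P X] x g])
      also have "\<dots> = \<alpha> X (farr ?pk (?B ?x) X (fill C p t) (generic C p ?x))"
        using nt_natural[OF \<alpha> fill_in[OF t X] _ small_fan[OF x] X] generic_in[OF x] small_fan[OF x] X
          fill_in[OF t X]
        by (simp del: fob_poly_functor)
      also have "\<dots> = \<alpha> X t"
        by (simp only: farr_fill_generic[OF t X])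
      finally show ?thesis .
    qed
    show ?thesis
    proof (rule ex1I[of _ \<beta>])
      show "nat_trans Set_cat Set_cat ?L R \<beta> \<and>
        (\<forall>X t. small X \<longrightarrow> t \<in> fob ?pk X \<longrightarrow> \<beta> (fob ?P X) (?\<eta> X t) = \<alpha> X t)"
        using \<beta> \<beta>\<eta> by (simp del: fob_poly_functor)
      fix \<beta>'
      assume "nat_trans Set_cat Set_cat ?L R \<beta>' \<and>
        (\<forall>X t. small X \<longrightarrow> t \<in> fob ?pk X \<longrightarrow> \<beta>' (fob ?P X) (?\<eta> X t) = \<alpha> X t)"
      then have \<beta>': "nat_trans Set_cat Set_cat ?L R \<beta>'"
        and \<beta>'\<eta>: "\<And>X t. small X \<Longrightarrow> t \<in> fob ?P (fob ?k X) \<Longrightarrow> \<beta>' (fob ?P X) (?\<eta> X t) = \<alpha> X t"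
        by (simp_all del: fob_poly_functor)
      show "\<beta>' = \<beta>"
      proof (rule nt_eqI[OF \<beta>' \<beta>])
        fix X :: "'u set" and l assume X: "small X" and "l \<in> fob ?L X"
        with elem obtain x g where l: "l = vpair x (vlam (out ?S x) g)" and x: "x \<in> sel_obj C p"
          and g: "\<forall>m\<in>out ?S x. g m \<in> X"
          by blast
        let ?h = "hat x (vlam (out ?S x) g)" and ?u = "generic C p x"
        \<comment> \<open>The filling of the generic element is an identity, hence so is its image
          under \<open>p\<close>. The unit therefore sends the generic element to
          \<open>(x, sel_split)\<close>, the universal element of \<open>L\<close> over
          \<open>x\<close>.\<close>
        have "farr ?P (?B x) (?B x) (fill C p ?u) s = s" if "s \<in> fob ?P (?B x)" for s
        proof -
          have "fill C p ?u = (\<lambda>s\<in>?B x. s)"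
            using fill_in[OF generic_in[OF x] small_fan[OF x]] fill_generic[OF x]
            by (auto simp: fun_eq_iff shape_generic[OF x] PiE_iff extensional_def restrict_def)
          then show ?thesis
            using endo_Ident[OF P that small_fan[OF x]] by simp
        qed
        then have \<eta>u: "?\<eta> (?B x) ?u = vpair x (vlam (out ?S x) (sel_split p))"
          using sel_split_in[OF x]
          by (simp add: sel_unit_eq[OF generic_in[OF x] small_fan[OF x]] shape_generic[OF x]
              del: fob_poly_functor)
        have u: "?\<eta> (?B x) ?u \<in> fob ?L (fob ?P (?B x))"
          unfolding \<eta>u using sel_split_in[OF x] x
          by (simp add: vpair_in_cat_comonad[OF S smallP[OF x]] del: fob_poly_functor)
        \<comment> \<open>Since \<open>?h\<close> merges what \<open>sel_split\<close> splits,
          \<open>l\<close> is the image of the universal element. Naturality then forces the value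
          of \<beta>' at \<open>l\<close>.\<close>
        have "farr ?L (fob ?P (?B x)) X ?h (?\<eta> (?B x) ?u)
            = vpair x (vlam (out ?S x) (\<lambda>m. ?h (sel_split p m)))"
          unfolding \<eta>u by (rule farr_cat_comonad[OF S smallP[OF x] X hat_in[OF x g]])
            (use x sel_split_in[OF x] in \<open>simp_all del: fob_poly_functor\<close>)
        also have "\<dots> = l"
          unfolding l using sel_split_in[OF x] sel_merge_split[OF x]
          by (simp add: hat_eq[OF x] del: fob_poly_functor)
        finally have "\<beta>' X l = farr R (fob ?P (?B x)) X ?h (\<beta>' (fob ?P (?B x)) (?\<eta> (?B x) ?u))"
          using nt_natural[OF \<beta>' hat_in[OF x g] u smallP[OF x] X] by simp
        then show "\<beta>' X l = \<beta> X l"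
          by (simp add: l \<beta>_eq[OF X x g] \<beta>'\<eta>[OF small_fan[OF x] generic_in[OF x]] del: fob_poly_functor)
      qed
    qed
  qed
  moreover have "vcomp Set_cat Set_cat ?pk (comp_functor Set_cat ?L ?P) (comp_functor Set_cat R ?P)
      (whisker_right Set_cat ?P \<beta>) ?\<eta> = \<alpha> \<longleftrightarrow>
      (\<forall>X t. small X \<longrightarrow> t \<in> fob ?pk X \<longrightarrow> \<beta> (fob ?P X) (?\<eta> X t) = \<alpha> X t)"
    if \<alpha>: "nat_trans Set_cat Set_cat ?pk (comp_functor Set_cat R ?P) \<alpha>" for R \<alpha> \<beta>
    by (subst vcomp_eq_iff) (use nat_trans_ext[OF \<alpha>] nt_PiE[OF \<alpha>] in
        \<open>auto simp: PiE_iff simp del: fob_poly_functor\<close>)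
  ultimately show ?thesis
    unfolding is_lan_def using P pk_functor L sel_unit_nat_trans by simp
qed

text \<open>The counit of the selection comonad evaluates at the identity of the shape. Splitting
  that identity gives, over each index \<open>b\<close>, the identity of \<open>c b\<close>, and the
  filling there is what the counit of \<open>C\<close> extracts.\<close>

lemma sel_unit_counit:
  assumes X: "small X" and t: "t \<in> fob (poly_functor p) (fob (poly_functor (cat_polyn C)) X)"
  shows "counit (cat_comonad (sel_cat C p)) (fob (poly_functor p) X) (sel_unit C p X t)
    = farr (poly_functor p) (fob (poly_functor (cat_polyn C)) X) X (counit (cat_comonad C) X) t"
proof -
  have *: "counit (cat_comonad (sel_cat C p)) (fob (poly_functor p) X) (sel_unit C p X t)
    = farr (poly_functor p) (fan C p (shape p t)) X (fill C p t)
        (sel_split p (vpair (shape p t) (sel_id C p (shape p t))))"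
    unfolding sel_unit_eq[OF t X]
    by (subst counit_cat_comonad[OF S endo_small[OF P X]])
      (use shape_in[OF t X] endo_in[OF P fill_in[OF t X] sel_split_in[OF shape_in[OF t X]]
          small_fan[OF shape_in[OF t X]] X] in \<open>simp_all del: fob_poly_functor\<close>)
  obtain i c \<phi> where t_eq: "t = vpair i (vlam (Arity p i) (\<lambda>a. vpair (c a) (vlam (out C (c a)) (\<phi> a))))"
    and i: "i \<in> Idx p" and c: "\<And>a. a \<in> Arity p i \<Longrightarrow> c a \<in> Obj C"
    and \<phi>: "\<And>a f. a \<in> Arity p i \<Longrightarrow> f \<in> out C (c a) \<Longrightarrow> \<phi> a f \<in> X"
    using pk_elemE[OF t X] by blast
  note x = shape_in[OF t X, unfolded t_eq shape_vpair[OF i]]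
  have split: "sel_split p (vpair (vpair i (vlam (Arity p i) c)) (sel_id C p (vpair i (vlam (Arity p i) c))))
    = vpair i (vlam (Arity p i) (\<lambda>b. vpair b (vpair (c b) (Ident C (c b)))))"
    by (simp add: sel_split_def sel_id_vapp[OF p x] small_ar[OF i])
  have \<epsilon>X: "counit (cat_comonad C) X \<in> fob (poly_functor (cat_polyn C)) X \<rightarrow>\<^sub>E X"
    using cat_comonad_is_comonad[OF C] X
      nt_PiE[of "poly_functor (cat_polyn C)" "id_functor Set_cat" "counit (cat_comonad C)" X]
    by (simp add: is_comonad_iff cfun_cat_comonad del: fob_poly_functor)
  have "farr (poly_functor p) (fan C p (shape p t)) X (fill C p t)
      (vpair i (vlam (Arity p i) (\<lambda>b. vpair b (vpair (c b) (Ident C (c b))))))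
    = vpair i (vlam (Arity p i) (\<lambda>b. fill C p t (vpair b (vpair (c b) (Ident C (c b))))))"
    by (rule farr_poly_functor[OF p small_fan[OF shape_in[OF t X]] X fill_in[OF t X] i])
      (simp add: t_eq shape_vpair[OF i] fan_vpair[OF i] c Ident_in[OF cat])
  also have "\<dots> = vpair i (vlam (Arity p i) (\<lambda>b. \<phi> b (vpair (c b) (Ident C (c b)))))"
    by (simp add: t_eq fill_vpair[OF i c] c Ident_in[OF cat])
  also have "\<dots> = farr (poly_functor p) (fob (poly_functor (cat_polyn C)) X) X (counit (cat_comonad C) X) t"
    unfolding t_eq
    by (subst farr_poly_functor[OF p endo_small[OF k X] X \<epsilon>X i])
      (simp_all add: vpair_in_cat_comonad[OF C X] counit_cat_comonad[OF C X] c \<phi> del: fob_poly_functor)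
  finally show ?thesis
    unfolding * by (simp add: t_eq shape_vpair[OF i] split)
qed

text \<open>Both sides keep the shape \<open>x\<close> and send an arrow \<open>m\<close> out of
  \<open>x\<close>, followed by an arrow \<open>m'\<close> out of its codomain, to the filling of
  \<open>t\<close> carried along the composite of \<open>m\<close> and \<open>m'\<close>. On the
  right this composite is formed one index at a time, by the comultiplication of \<open>C\<close>,
  which agrees with composition in the selection category.\<close>

lemma sel_unit_comult:
  assumes X: "small X" and t: "t \<in> fob (poly_functor p) (fob (poly_functor (cat_polyn C)) X)"
  shows "comult (cat_comonad (sel_cat C p)) (fob (poly_functor p) X) (sel_unit C p X t)
    = farr (poly_functor (cat_polyn (sel_cat C p))) (fob (poly_functor p) (fob (poly_functor (cat_polyn C)) X))
        (fob (poly_functor (cat_polyn (sel_cat C p))) (fob (poly_functor p) X)) (sel_unit C p X)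
        (sel_unit C p (fob (poly_functor (cat_polyn C)) X)
          (farr (poly_functor p) (fob (poly_functor (cat_polyn C)) X)
            (fob (poly_functor (cat_polyn C)) (fob (poly_functor (cat_polyn C)) X))
            (comult (cat_comonad C) X) t))"
proof -
  let ?P = "poly_functor p" and ?k = "poly_functor (cat_polyn C)"
    and ?L = "poly_functor (cat_polyn (sel_cat C p))" and ?S = "sel_cat C p"
  let ?kX = "fob ?k X" and ?kkX = "fob ?k (fob ?k X)"
  obtain i c \<phi> where t_eq: "t = vpair i (vlam (Arity p i) (\<lambda>a. vpair (c a) (vlam (out C (c a)) (\<phi> a))))"
    and i: "i \<in> Idx p" and c: "\<And>a. a \<in> Arity p i \<Longrightarrow> c a \<in> Obj C"
    and \<phi>: "\<And>a f. a \<in> Arity p i \<Longrightarrow> f \<in> out C (c a) \<Longrightarrow> \<phi> a f \<in> X"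
    using pk_elemE[OF t X] by blast
  define x where "x = vpair i (vlam (Arity p i) c)"
  have shape_t: "shape p t = x"
    unfolding t_eq x_def by (rule shape_vpair[OF i])
  have x: "x \<in> sel_obj C p"
    using shape_in[OF t X] by (simp add: shape_t)
  have fan_x: "fan C p x = vSigma (Arity p i) (\<lambda>a. out C (c a))"
    unfolding x_def by (rule fan_vpair[OF i])
  have sel_x: "sel_ar p x = Arity p i" "\<And>a. a \<in> Arity p i \<Longrightarrow> sel_at x a = c a"
    by (simp_all add: x_def small_ar[OF i])
  have fill_t: "fill C p t (vpair a f) = \<phi> a f" if "a \<in> Arity p i" "f \<in> out C (c a)" for a f
    using that by (simp add: t_eq fill_vpair[OF i c])
  \<comment> \<open>The filling of \<open>t'\<close>: over \<open>a\<close>, the function on arrows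
    out of \<open>c a\<close> that the comultiplication of \<open>C\<close> puts there.\<close>
  define \<phi>' where "\<phi>' a f = vpair (vfst f) (vlam (out C (vfst f)) (\<lambda>f'.
    \<phi> a (vpair (vfst f') (Comp C (c a) (vfst f) (vfst f') (vsnd f') (vsnd f)))))" for a f
  define t' where "t' = farr ?P ?kX ?kkX (comult (cat_comonad C) X) t"
  have \<delta>X: "comult (cat_comonad C) X \<in> ?kX \<rightarrow>\<^sub>E ?kkX"
    using cat_comonad_is_comonad[OF C] X
      nt_PiE[of ?k "comp_functor Set_cat ?k ?k" "comult (cat_comonad C)" X]
    by (simp add: is_comonad_iff cfun_cat_comonad del: fob_poly_functor)
  have kX: "small ?kX" and kkX: "small ?kkX" and PX: "small (fob ?P X)"
    using endo_small[OF k] endo_small[OF P] X by blast+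
  have t'_eq: "t' = vpair i (vlam (Arity p i) (\<lambda>a. vpair (c a) (vlam (out C (c a)) (\<phi>' a))))"
    unfolding t'_def t_eq
    by (subst farr_poly_functor[OF p kX kkX \<delta>X i])
      (simp_all add: vpair_in_cat_comonad[OF C X] comult_cat_comonad[OF C X] c \<phi> \<phi>'_def del: fob_poly_functor)
  have t': "t' \<in> fob ?P ?kkX"
    unfolding t'_def by (rule endo_in[OF P \<delta>X t kX kkX])
  have shape_t': "shape p t' = x"
    unfolding t'_eq x_def by (rule shape_vpair[OF i])
  have fill_t': "fill C p t' (vpair a f) = \<phi>' a f" if "a \<in> Arity p i" "f \<in> out C (c a)" for a f
    using that by (simp add: t'_eq fill_vpair[OF i c])
  have fill_t'_in: "fill C p t' \<in> fan C p x \<rightarrow>\<^sub>E ?kX"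
    using fill_in[OF t' kX] by (simp add: shape_t')
  have fill_t_in: "fill C p t \<in> fan C p x \<rightarrow>\<^sub>E X"
    using fill_in[OF t X] by (simp add: shape_t)
  let ?g = "\<lambda>m. farr ?P (fan C p x) X (fill C p t) (sel_split p m)"
    and ?g' = "\<lambda>m. farr ?P (fan C p x) ?kX (fill C p t') (sel_split p m)"
  have g: "?g m \<in> fob ?P X" and g': "?g' m \<in> fob ?P ?kX" if "m \<in> out ?S x" for m
    using endo_in[OF P _ sel_split_in[OF x that] small_fan[OF x]] fill_t_in fill_t'_in X kX by blast+
  \<comment> \<open>The element \<open>?g' m\<close> has the codomain of \<open>m\<close> as its
    shape, so the inner unit ranges over the arrows \<open>m'\<close> out of that codomain. The
    composites of \<open>C\<close> inside the fillings assemble to the composite of \<open>m\<close>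
    and \<open>m'\<close>.\<close>
  have unit_g': "sel_unit C p X (?g' m) = vpair (vfst m) (vlam (out ?S (vfst m)) (\<lambda>m'.
      ?g (vpair (vfst m') (sel_comp C p x (vfst m) (vfst m') (vsnd m') (vsnd m)))))"
    if m: "m \<in> out ?S x" for m
  proof -
    obtain y h where m_eq: "m = vpair y h" and y: "y \<in> sel_obj C p" and h: "h \<in> sel_hom C p p x y"
      using m by (auto elim: outE)
    obtain j d where y_eq: "y = vpair j (vlam (Arity p j) d)" and j: "j \<in> Idx p"
      and d: "\<And>b. b \<in> Arity p j \<Longrightarrow> d b \<in> Obj C"
      using sel_objE[OF y] by blast
    have sel_y: "sel_ar p y = Arity p j" "\<And>a. a \<in> Arity p j \<Longrightarrow> sel_at y a = d a"
      by (simp_all add: y_eq small_ar[OF j])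
    define h\<^sub>1 where "h\<^sub>1 b = vfst (vapp h b)" for b
    define h\<^sub>2 where "h\<^sub>2 b = vsnd (vapp h b)" for b
    have h\<^sub>1: "h\<^sub>1 b \<in> Arity p i" and h\<^sub>2: "h\<^sub>2 b \<in> Hom C (c (h\<^sub>1 b)) (d b)"
      if "b \<in> Arity p j" for b
      using that sel_hom_fst[OF p y h, of b] sel_hom_snd[OF p y h, of b]
      by (simp_all add: sel_x sel_y h\<^sub>1_def h\<^sub>2_def)
    \<comment> \<open>The filling of \<open>?g' m\<close>: \<phi> after precomposition with the
      component \<open>h\<^sub>2 b\<close> of \<open>m\<close>. It comes from evaluating
      \<open>\<phi>'\<close> at that component.\<close>
    define \<psi> where "\<psi> b f = \<phi> (h\<^sub>1 b) (vpair (vfst f) (Comp C (c (h\<^sub>1 b)) (d b) (vfst f) (vsnd f) (h\<^sub>2 b)))" for b f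
    have split: "sel_split p m = vpair j (vlam (Arity p j) (\<lambda>b. vpair (h\<^sub>1 b) (vpair (d b) (h\<^sub>2 b))))"
      by (simp add: sel_split_def m_eq y_eq small_ar[OF j] h\<^sub>1_def h\<^sub>2_def)
    have "?g' m = vpair j (vlam (Arity p j) (\<lambda>b. fill C p t' (vpair (h\<^sub>1 b) (vpair (d b) (h\<^sub>2 b)))))"
      unfolding split by (rule farr_poly_functor[OF p small_fan[OF x] kX fill_t'_in j])
        (simp add: fan_x h\<^sub>1 h\<^sub>2 d)
    then have g'_eq: "?g' m = vpair j (vlam (Arity p j) (\<lambda>b. vpair (d b) (vlam (out C (d b)) (\<psi> b))))"
      by (simp add: fill_t' h\<^sub>1 h\<^sub>2 d \<phi>'_def \<psi>_def)
    have shape_g': "shape p (?g' m) = y"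
      unfolding g'_eq y_eq by (rule shape_vpair[OF j])
    have fill_g': "fill C p (?g' m) (vpair b f) = \<psi> b f" if "b \<in> Arity p j" "f \<in> out C (d b)" for b f
      using that by (simp add: g'_eq fill_vpair[OF j d])
    have fill_g'_in: "fill C p (?g' m) \<in> fan C p y \<rightarrow>\<^sub>E X"
      using fill_in[OF g'[OF m] X] by (simp add: shape_g')
    have "farr ?P (fan C p y) X (fill C p (?g' m)) (sel_split p m')
        = ?g (vpair (vfst m') (sel_comp C p x y (vfst m') (vsnd m') h))"
      if m': "m' \<in> out ?S y" for m'
    proof -
      obtain z l where m'_eq: "m' = vpair z l" and z: "z \<in> sel_obj C p" and l: "l \<in> sel_hom C p p y z"
        using m' by (auto elim: outE)
      obtain k e where z_eq: "z = vpair k (vlam (Arity p k) e)" and k: "k \<in> Idx p"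
        and e: "\<And>b. b \<in> Arity p k \<Longrightarrow> e b \<in> Obj C"
        using sel_objE[OF z] by blast
      have sel_z: "sel_ar p z = Arity p k" "\<And>a. a \<in> Arity p k \<Longrightarrow> sel_at z a = e a"
        by (simp_all add: z_eq small_ar[OF k])
      define l\<^sub>1 where "l\<^sub>1 b = vfst (vapp l b)" for b
      define l\<^sub>2 where "l\<^sub>2 b = vsnd (vapp l b)" for b
      have l\<^sub>1: "l\<^sub>1 b \<in> Arity p j" and l\<^sub>2: "l\<^sub>2 b \<in> Hom C (d (l\<^sub>1 b)) (e b)"
        if "b \<in> Arity p k" for b
        using that sel_hom_fst[OF p z l, of b] sel_hom_snd[OF p z l, of b]
        by (simp_all add: sel_y sel_z l\<^sub>1_def l\<^sub>2_def)
      have "sel_split p m' = vpair k (vlam (Arity p k) (\<lambda>b. vpair (l\<^sub>1 b) (vpair (e b) (l\<^sub>2 b))))"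
        by (simp add: sel_split_def m'_eq z_eq small_ar[OF k] l\<^sub>1_def l\<^sub>2_def)
      then have lhs: "farr ?P (fan C p y) X (fill C p (?g' m)) (sel_split p m')
          = vpair k (vlam (Arity p k) (\<lambda>b. \<psi> (l\<^sub>1 b) (vpair (e b) (l\<^sub>2 b))))"
        using farr_poly_functor[OF p small_fan[OF y] X fill_g'_in k, of "\<lambda>b. vpair (l\<^sub>1 b) (vpair (e b) (l\<^sub>2 b))"]
        by (simp add: y_eq fan_vpair[OF j] l\<^sub>1 l\<^sub>2 e fill_g'[OF l\<^sub>1])
      have "sel_split p (vpair z (sel_comp C p x y z l h)) = vpair k (vlam (Arity p k) (\<lambda>b.
          vpair (h\<^sub>1 (l\<^sub>1 b)) (vpair (e b) (Comp C (c (h\<^sub>1 (l\<^sub>1 b))) (d (l\<^sub>1 b)) (e b) (l\<^sub>2 b) (h\<^sub>2 (l\<^sub>1 b))))))"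
        using sel_comp_vapp[OF p z] l\<^sub>1 h\<^sub>1
        by (simp add: sel_split_def z_eq small_ar[OF k] Let_def sel_x sel_y
            l\<^sub>1_def l\<^sub>2_def h\<^sub>1_def h\<^sub>2_def)
      then have "?g (vpair z (sel_comp C p x y z l h)) = vpair k (vlam (Arity p k) (\<lambda>b. fill C p t
          (vpair (h\<^sub>1 (l\<^sub>1 b)) (vpair (e b) (Comp C (c (h\<^sub>1 (l\<^sub>1 b))) (d (l\<^sub>1 b)) (e b) (l\<^sub>2 b) (h\<^sub>2 (l\<^sub>1 b)))))))"
        using farr_poly_functor[OF p small_fan[OF x] X fill_t_in k]
        by (simp add: fan_x h\<^sub>1 l\<^sub>1 e Comp_in[OF cat h\<^sub>2 l\<^sub>2] c d)
      then show ?thesis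
        unfolding lhs by (simp add: m'_eq fill_t h\<^sub>1 l\<^sub>1 e Comp_in[OF cat h\<^sub>2 l\<^sub>2] c d \<psi>_def)
    qed
    then show ?thesis
      unfolding sel_unit_eq[OF g'[OF m] X] shape_g' by (simp add: m_eq)
  qed
  have unit_in: "sel_unit C p X \<in> fob ?P ?kX \<rightarrow>\<^sub>E fob ?L (fob ?P X)"
    using nt_PiE[OF sel_unit_nat_trans X] X by (simp del: fob_poly_functor)
  have LPX: "small (fob ?L (fob ?P X))"
    by (rule endo_small[OF cat_comonad_functor[OF S] PX])
  have "farr ?L (fob ?P ?kX) (fob ?L (fob ?P X)) (sel_unit C p X) (vpair x (vlam (out ?S x) ?g'))
    = vpair x (vlam (out ?S x) (\<lambda>m. sel_unit C p X (?g' m)))"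
    by (rule farr_cat_comonad[OF S endo_small[OF P kX] LPX unit_in])
      (use x g' in simp_all)
  moreover have "comult (cat_comonad ?S) (fob ?P X) (vpair x (vlam (out ?S x) ?g))
    = vpair x (vlam (out ?S x) (\<lambda>m. vpair (vfst m) (vlam (out ?S (vfst m)) (\<lambda>m'.
      ?g (vpair (vfst m') (sel_comp C p x (vfst m) (vfst m') (vsnd m') (vsnd m)))))))"
    using comult_cat_comonad[OF S PX, of x ?g] x g by simp
  ultimately show ?thesis
    unfolding t'_def[symmetric] sel_unit_eq[OF t X] sel_unit_eq[OF t' kX] shape_t shape_t'
    by (simp add: unit_g' del: fob_poly_functor)
qed

lemma comonad_iso_lan_comonad:
  assumes "is_lan Set_cat Set_cat Set_cat (poly_functor p)
    (comp_functor Set_cat (poly_functor p) (cfun (cat_comonad C))) L \<eta>"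
  shows "comonad_iso (cat_comonad (sel_cat C p)) (lan_comonad (poly_functor p) (cat_comonad C) L \<eta>)"
  by (rule lan_comonad_iso[OF cat_comonad_is_comonad[OF C] cat_comonad_is_comonad[OF S] _ _ _ assms,
        unfolded cfun_cat_comonad])
    (rule sel_cat_is_lan sel_unit_counit sel_unit_comult; assumption)+

end

section \<open>Profunctors and coends\<close>

context
  fixes S T :: "('u::set_universe, 'u) category" and P :: "'u profunctor"
  assumes P: "is_profunctor S T P"
begin

lemma profunctor_functor: "is_functor (prod_cat (op_cat S) T) Set_cat P"
  using P by (simp add: is_profunctor_def)

lemma prof_small: "x \<in> Obj S \<Longrightarrow> y \<in> Obj T \<Longrightarrow> small (fob P (x, y))"
  using fob_small[OF profunctor_functor, of "(x, y)"] by simp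

lemma prof_farr_PiE:
  "u \<in> Hom S x' x \<Longrightarrow> v \<in> Hom T y y' \<Longrightarrow> x \<in> Obj S \<Longrightarrow> x' \<in> Obj S \<Longrightarrow> y \<in> Obj T \<Longrightarrow> y' \<in> Obj T
    \<Longrightarrow> farr P (x, y) (x', y') (u, v) \<in> fob P (x, y) \<rightarrow>\<^sub>E fob P (x', y')"
  using farr_PiE[OF profunctor_functor, of "(u, v)" "(x, y)" "(x', y')"] by simp

lemma prof_farr_in:
  "u \<in> Hom S x' x \<Longrightarrow> v \<in> Hom T y y' \<Longrightarrow> f \<in> fob P (x, y)
    \<Longrightarrow> x \<in> Obj S \<Longrightarrow> x' \<in> Obj S \<Longrightarrow> y \<in> Obj T \<Longrightarrow> y' \<in> Obj T
    \<Longrightarrow> farr P (x, y) (x', y') (u, v) f \<in> fob P (x', y')"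
  using prof_farr_PiE by blast

lemma prof_farr_Ident:
  "f \<in> fob P (x, y) \<Longrightarrow> x \<in> Obj S \<Longrightarrow> y \<in> Obj T
    \<Longrightarrow> farr P (x, y) (x, y) (Ident S x, Ident T y) f = f"
  using farr_Ident_app[OF profunctor_functor, of f "(x, y)"] by simp

lemma prof_farr_farr:
  "u \<in> Hom S x' x \<Longrightarrow> v \<in> Hom T y y' \<Longrightarrow> u' \<in> Hom S x'' x' \<Longrightarrow> v' \<in> Hom T y' y''
    \<Longrightarrow> f \<in> fob P (x, y) \<Longrightarrow> x \<in> Obj S \<Longrightarrow> x' \<in> Obj S \<Longrightarrow> x'' \<in> Obj S
    \<Longrightarrow> y \<in> Obj T \<Longrightarrow> y' \<in> Obj T \<Longrightarrow> y'' \<in> Obj T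
    \<Longrightarrow> farr P (x', y') (x'', y'') (u', v') (farr P (x, y) (x', y') (u, v) f)
      = farr P (x, y) (x'', y'') (Comp S x'' x' x u u', Comp T y y' y'' v' v) f"
  using farr_Comp_app[OF profunctor_functor, of "(u, v)" "(x, y)" "(x', y')" "(u', v')" "(x'', y'')" f]
  by simp

end

lemma prof_dom: "is_category S \<Longrightarrow> is_category T \<Longrightarrow> is_category (prod_cat (op_cat S) T)"
  by (intro prod_cat_is_category op_cat_is_category)

lemma mk_profunctorI:
  assumes "is_category S" "is_category T"
    and "\<And>x y. x \<in> Obj S \<Longrightarrow> y \<in> Obj T \<Longrightarrow> small (F0 (x, y))"
    and "\<And>x x' y y' u v. x \<in> Obj S \<Longrightarrow> x' \<in> Obj S \<Longrightarrow> y \<in> Obj T \<Longrightarrow> y' \<in> Obj T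
      \<Longrightarrow> u \<in> Hom S x' x \<Longrightarrow> v \<in> Hom T y y'
      \<Longrightarrow> F1 (x, y) (x', y') (u, v) \<in> F0 (x, y) \<rightarrow>\<^sub>E F0 (x', y')"
    and "\<And>x y f. x \<in> Obj S \<Longrightarrow> y \<in> Obj T \<Longrightarrow> f \<in> F0 (x, y)
      \<Longrightarrow> F1 (x, y) (x, y) (Ident S x, Ident T y) f = f"
    and "\<And>x x' x'' y y' y'' u v u' v' f. x \<in> Obj S \<Longrightarrow> x' \<in> Obj S \<Longrightarrow> x'' \<in> Obj S
      \<Longrightarrow> y \<in> Obj T \<Longrightarrow> y' \<in> Obj T \<Longrightarrow> y'' \<in> Obj T \<Longrightarrow> u \<in> Hom S x' x \<Longrightarrow> v \<in> Hom T y y'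
      \<Longrightarrow> u' \<in> Hom S x'' x' \<Longrightarrow> v' \<in> Hom T y' y'' \<Longrightarrow> f \<in> F0 (x, y)
      \<Longrightarrow> F1 (x, y) (x'', y'') (Comp S x'' x' x u u', Comp T y y' y'' v' v) f
        = F1 (x', y') (x'', y'') (u', v') (F1 (x, y) (x', y') (u, v) f)"
  shows "is_profunctor S T (mk_functor (prod_cat (op_cat S) T) F0 F1)"
  unfolding is_profunctor_def
proof (rule Set_valued_functorI, goal_cases)
  case 1
  show ?case by (rule prof_dom[OF assms(1,2)])
next
  case (2 a)
  then show ?case by (cases a) (simp add: assms(3))
next
  case (3 a b f)
  then show ?case by (cases a; cases b; cases f) (simp add: assms(4))
next
  case (4 a x)
  then show ?case by (cases a) (simp add: assms(5))
next
  case (5 a b c f g x)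
  then show ?case by (cases a; cases b; cases c; cases f; cases g) (simp add: assms(6))
qed

lemma prof_mapI:
  assumes "is_profunctor S T P" "is_profunctor S T Q"
    and "\<alpha> \<in> extensional (Obj S \<times> Obj T)"
    and "\<And>x y. x \<in> Obj S \<Longrightarrow> y \<in> Obj T \<Longrightarrow> \<alpha> (x, y) \<in> extensional (fob P (x, y))"
    and "\<And>x y f. x \<in> Obj S \<Longrightarrow> y \<in> Obj T \<Longrightarrow> f \<in> fob P (x, y) \<Longrightarrow> \<alpha> (x, y) f \<in> fob Q (x, y)"
    and "\<And>x x' y y' u v f. x \<in> Obj S \<Longrightarrow> x' \<in> Obj S \<Longrightarrow> y \<in> Obj T \<Longrightarrow> y' \<in> Obj T
      \<Longrightarrow> u \<in> Hom S x' x \<Longrightarrow> v \<in> Hom T y y' \<Longrightarrow> f \<in> fob P (x, y)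
      \<Longrightarrow> \<alpha> (x', y') (farr P (x, y) (x', y') (u, v) f) = farr Q (x, y) (x', y') (u, v) (\<alpha> (x, y) f)"
  shows "prof_map S T P Q \<alpha>"
  unfolding prof_map_def
  by (rule Set_nat_transI) (use assms in \<open>auto simp: is_profunctor_def\<close>)

context
  fixes S T :: "('u::set_universe, 'u) category" and P Q :: "'u profunctor" and \<alpha>
  assumes \<alpha>: "prof_map S T P Q \<alpha>"
begin

lemma prof_map_PiE: "x \<in> Obj S \<Longrightarrow> y \<in> Obj T \<Longrightarrow> \<alpha> (x, y) \<in> fob P (x, y) \<rightarrow>\<^sub>E fob Q (x, y)"
  using nat_trans_PiE[OF \<alpha>[unfolded prof_map_def], of "(x, y)"] by simp

lemma prof_map_in:
  "f \<in> fob P (x, y) \<Longrightarrow> x \<in> Obj S \<Longrightarrow> y \<in> Obj T \<Longrightarrow> \<alpha> (x, y) f \<in> fob Q (x, y)"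
  using prof_map_PiE by blast

lemma prof_map_natural:
  "u \<in> Hom S x' x \<Longrightarrow> v \<in> Hom T y y' \<Longrightarrow> f \<in> fob P (x, y)
    \<Longrightarrow> x \<in> Obj S \<Longrightarrow> x' \<in> Obj S \<Longrightarrow> y \<in> Obj T \<Longrightarrow> y' \<in> Obj T
    \<Longrightarrow> \<alpha> (x', y') (farr P (x, y) (x', y') (u, v) f) = farr Q (x, y) (x', y') (u, v) (\<alpha> (x, y) f)"
  using nat_trans_natural[OF \<alpha>[unfolded prof_map_def], of "(u, v)" "(x, y)" "(x', y')" f] by simp

end

lemma prof_map_eqI:
  assumes \<alpha>: "prof_map S T P Q \<alpha>" and \<beta>: "prof_map S T P Q' \<beta>"
    and "\<And>x y f. x \<in> Obj S \<Longrightarrow> y \<in> Obj T \<Longrightarrow> f \<in> fob P (x, y) \<Longrightarrow> \<alpha> (x, y) f = \<beta> (x, y) f"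
  shows "\<alpha> = \<beta>"
  by (rule nat_trans_eqI[OF \<alpha>[unfolded prof_map_def] \<beta>[unfolded prof_map_def]])
    (use assms(3) in auto)

lemma fob_prof_reindex [simp]:
  "x \<in> Obj S \<Longrightarrow> y \<in> Obj T \<Longrightarrow> fob (prof_reindex S T P F G) (x, y) = fob P (fob F x, fob G y)"
  by (simp add: prof_reindex_def)

lemma farr_prof_reindex [simp]:
  "x \<in> Obj S \<Longrightarrow> x' \<in> Obj S \<Longrightarrow> y \<in> Obj T \<Longrightarrow> y' \<in> Obj T \<Longrightarrow> u \<in> Hom S x' x \<Longrightarrow> v \<in> Hom T y y'
    \<Longrightarrow> farr (prof_reindex S T P F G) (x, y) (x', y') (u, v)
      = farr P (fob F x, fob G y) (fob F x', fob G y') (farr F x' x u, farr G y y' v)"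
  by (simp add: prof_reindex_def)

lemma prof_reindex_is_profunctor:
  assumes F: "is_functor S S' F" and G: "is_functor T T' G" and P: "is_profunctor S' T' P"
  shows "is_profunctor S T (prof_reindex S T P F G)"
  unfolding prof_reindex_def
  by (rule mk_profunctorI)
    (simp_all add: functor_dom[OF F] functor_dom[OF G] prof_small[OF P] fob_in[OF F] fob_in[OF G]
      farr_in[OF F] farr_in[OF G] prof_farr_PiE[OF P] farr_Ident[OF F] farr_Ident[OF G]
      prof_farr_Ident[OF P] farr_Comp[OF F] farr_Comp[OF G] prof_farr_farr[OF P])

section \<open>Composition of profunctors by coends\<close>

context
  fixes S T U :: "('u::set_universe, 'u) category" and P Q :: "'u profunctor"
  assumes S: "is_category S" and T: "is_small_category T" and U: "is_category U"
    and P: "is_profunctor S T P" and Q: "is_profunctor T U Q"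
begin

context
  fixes x z
  assumes x: "x \<in> Obj S" and z: "z \<in> Obj U"
begin

text \<open>A code determines its set only when the set is small. Zigzags of steps that start in the
  small set \<open>coend_pre\<close> stay in it, so each class is small and can be recovered from
  its code.\<close>

private lemma steps_in_pre:
  assumes "(t, t') \<in> (coend_step S T U P Q x z \<union> (coend_step S T U P Q x z)\<inverse>)\<^sup>*"
  shows "t \<in> coend_pre T P Q x z \<Longrightarrow> t' \<in> coend_pre T P Q x z"
  using assms
proof (induction rule: rtrancl_induct)
  case (step t' t'')
  have "t' \<in> coend_pre T P Q x z \<and> t'' \<in> coend_pre T P Q x z"
    if "(t', t'') \<in> coend_step S T U P Q x z" for t' t''
    using that x z prof_farr_in[OF P] prof_farr_in[OF Q] Ident_in[OF S] Ident_in[OF U]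
    unfolding coend_step_def coend_pre_def by auto
  then show ?case
    using step by blast
qed

private lemma small_pre: "small (coend_pre T P Q x z)"
  unfolding coend_pre_def
  by (intro small_vSigma) (use T x z prof_small[OF P] prof_small[OF Q] in \<open>auto simp: is_small_category_def\<close>)

lemma elts_coend_class:
  assumes "y \<in> Obj T" "f \<in> fob P (x, y)" "g \<in> fob Q (y, z)"
  shows "elts (coend_class S T U P Q x z y f g)
    = (coend_step S T U P Q x z \<union> (coend_step S T U P Q x z)\<inverse>)\<^sup>* `` {vpair y (vpair f g)}"
  unfolding coend_class_def
proof (rule elts_vset, rule small_subset[OF small_pre])
  have "vpair y (vpair f g) \<in> coend_pre T P Q x z"
    using assms by (simp add: coend_pre_def)
  then show "(coend_step S T U P Q x z \<union> (coend_step S T U P Q x z)\<inverse>)\<^sup>* `` {vpair y (vpair f g)}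
    \<subseteq> coend_pre T P Q x z"
    using steps_in_pre by blast
qed

lemma coend_class_in:
  assumes "y \<in> Obj T" "f \<in> fob P (x, y)" "g \<in> fob Q (y, z)"
  shows "coend_class S T U P Q x z y f g \<in> coend S T U P Q x z"
  unfolding coend_def coend_pre_def
  using assms by (intro image_eqI[of _ _ "vpair y (vpair f g)"]) auto

lemma coendE:
  assumes "\<kappa> \<in> coend S T U P Q x z"
  obtains y f g where "\<kappa> = coend_class S T U P Q x z y f g"
    "y \<in> Obj T" "f \<in> fob P (x, y)" "g \<in> fob Q (y, z)"
  using assms unfolding coend_def coend_pre_def by auto

lemma small_coend: "small (coend S T U P Q x z)"
  unfolding coend_def by (rule small_image[OF small_pre])

lemma coend_class_slide:
  assumes y: "y \<in> Obj T" "y' \<in> Obj T" and u: "u \<in> Hom T y y'"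
    and f: "f \<in> fob P (x, y)" and g: "g \<in> fob Q (y', z)"
  shows "coend_class S T U P Q x z y f (farr Q (y', z) (y, z) (u, Ident U z) g)
    = coend_class S T U P Q x z y' (farr P (x, y) (x, y') (Ident S x, u) f) g"
proof -
  let ?R = "coend_step S T U P Q x z" and ?t = "vpair y (vpair f (farr Q (y', z) (y, z) (u, Ident U z) g))"
    and ?t' = "vpair y' (vpair (farr P (x, y) (x, y') (Ident S x, u) f) g)"
  have "(?t, ?t') \<in> ?R"
    using assms unfolding coend_step_def by blast
  then have "(?t, ?t') \<in> (?R \<union> ?R\<inverse>)\<^sup>*" "(?t', ?t) \<in> (?R \<union> ?R\<inverse>)\<^sup>*"
    by auto
  then have "(?R \<union> ?R\<inverse>)\<^sup>* `` {?t} = (?R \<union> ?R\<inverse>)\<^sup>* `` {?t'}"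
    by (auto intro: rtrancl_trans)
  then show ?thesis
    by (simp add: coend_class_def)
qed

text \<open>The definition of \<open>coend_lift\<close> picks a representative by choice. Invariance
  of \<open>h\<close> under a single step spreads by induction along a zigzag to the whole class, so
  any choice gives the same value.\<close>

lemma coend_lift_class:
  assumes h: "\<And>y y' u f g. y \<in> Obj T \<Longrightarrow> y' \<in> Obj T \<Longrightarrow> u \<in> Hom T y y' \<Longrightarrow> f \<in> fob P (x, y)
      \<Longrightarrow> g \<in> fob Q (y', z) \<Longrightarrow> h y f (farr Q (y', z) (y, z) (u, Ident U z) g)
        = h y' (farr P (x, y) (x, y') (Ident S x, u) f) g"
    and y: "y \<in> Obj T" "f \<in> fob P (x, y)" "g \<in> fob Q (y, z)"
  shows "coend_lift h (coend_class S T U P Q x z y f g) = h y f g"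
proof -
  let ?R = "coend_step S T U P Q x z" and ?t = "vpair y (vpair f g)"
  define H where "H t = h (vfst t) (vfst (vsnd t)) (vsnd (vsnd t))" for t
  have step: "H s = H s'" if "(s, s') \<in> ?R" for s s'
    using that h unfolding coend_step_def H_def by auto
  have const: "H s = H ?t" if "(?t, s) \<in> (?R \<union> ?R\<inverse>)\<^sup>*" for s
    using that by (induction rule: rtrancl_induct) (use step in auto)
  define s where "s = (SOME s. s \<in> elts (coend_class S T U P Q x z y f g))"
  have "?t \<in> elts (coend_class S T U P Q x z y f g)"
    unfolding elts_coend_class[OF y] by blast
  then have "s \<in> elts (coend_class S T U P Q x z y f g)"
    unfolding s_def by (rule someI)
  then have "H s = H ?t"
    unfolding elts_coend_class[OF y] using const by blast
  then show ?thesis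
    by (simp add: coend_lift_def Let_def s_def H_def)
qed

end

lemma fob_prof_comp [simp]:
  "x \<in> Obj S \<Longrightarrow> z \<in> Obj U \<Longrightarrow> fob (prof_comp S T U P Q) (x, z) = coend S T U P Q x z"
  by (simp add: prof_comp_def)

private abbreviation act where
  "act x z x' z' u v \<equiv> (\<lambda>\<kappa>\<in>coend S T U P Q x z. coend_lift (\<lambda>y f g.
    coend_class S T U P Q x' z' y
      (farr P (x, y) (x', y) (u, Ident T y) f) (farr Q (y, z) (y, z') (Ident T y, v) g)) \<kappa>)"

private lemma act_class:
  assumes o: "x \<in> Obj S" "x' \<in> Obj S" "z \<in> Obj U" "z' \<in> Obj U"
    and u: "u \<in> Hom S x' x" and v: "v \<in> Hom U z z'"
    and y: "y \<in> Obj T" "f \<in> fob P (x, y)" "g \<in> fob Q (y, z)"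
  shows "act x z x' z' u v (coend_class S T U P Q x z y f g)
    = coend_class S T U P Q x' z' y
      (farr P (x, y) (x', y) (u, Ident T y) f) (farr Q (y, z) (y, z') (Ident T y, v) g)"
proof -
  note cat = S U small_category_is_category[OF T]
  note simps = Ident_in[OF cat(1)] Ident_in[OF cat(2)] Ident_in[OF cat(3)]
    Comp_Ident_left[OF cat(1)] Comp_Ident_left[OF cat(2)] Comp_Ident_left[OF cat(3)]
    Comp_Ident_right[OF cat(1)] Comp_Ident_right[OF cat(2)] Comp_Ident_right[OF cat(3)]
  \<comment> \<open>Sliding \<open>w\<close> across the middle commutes with acting by
    \<open>u\<close> and \<open>v\<close> on the outside, because actions in the two variables of a
    profunctor commute.\<close>
  have slide: "coend_class S T U P Q x' z' y (farr P (x, y) (x', y) (u, Ident T y) f)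
        (farr Q (y, z) (y, z') (Ident T y, v) (farr Q (y', z) (y, z) (w, Ident U z) g))
      = coend_class S T U P Q x' z' y'
        (farr P (x, y') (x', y') (u, Ident T y') (farr P (x, y) (x, y') (Ident S x, w) f))
        (farr Q (y', z) (y', z') (Ident T y', v) g)"
    if y: "y \<in> Obj T" "y' \<in> Obj T" and w: "w \<in> Hom T y y'"
      and f: "f \<in> fob P (x, y)" and g: "g \<in> fob Q (y', z)" for y y' w f g
  proof -
    have "farr Q (y, z) (y, z') (Ident T y, v) (farr Q (y', z) (y, z) (w, Ident U z) g)
        = farr Q (y', z') (y, z') (w, Ident U z') (farr Q (y', z) (y', z') (Ident T y', v) g)"
      "farr P (x, y') (x', y') (u, Ident T y') (farr P (x, y) (x, y') (Ident S x, w) f)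
        = farr P (x', y) (x', y') (Ident S x', w) (farr P (x, y) (x', y) (u, Ident T y) f)"
      using o u v y w f g by (simp_all add: prof_farr_farr[OF P] prof_farr_farr[OF Q] simps)
    then show ?thesis
      using coend_class_slide[OF o(2,4) y w, of "farr P (x, y) (x', y) (u, Ident T y) f"
          "farr Q (y', z) (y', z') (Ident T y', v) g"] o u v y f g
      by (simp add: prof_farr_in[OF P] prof_farr_in[OF Q] simps)
  qed
  show ?thesis
    using coend_class_in[OF o(1,3) y] coend_lift_class[OF o(1,3) slide y] by simp
qed

lemma farr_prof_comp_class:
  assumes "x \<in> Obj S" "x' \<in> Obj S" "z \<in> Obj U" "z' \<in> Obj U"
    and "u \<in> Hom S x' x" "v \<in> Hom U z z'"
    and "y \<in> Obj T" "f \<in> fob P (x, y)" "g \<in> fob Q (y, z)"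
  shows "farr (prof_comp S T U P Q) (x, z) (x', z') (u, v) (coend_class S T U P Q x z y f g)
    = coend_class S T U P Q x' z' y
      (farr P (x, y) (x', y) (u, Ident T y) f) (farr Q (y, z) (y, z') (Ident T y, v) g)"
  using act_class[OF assms] assms by (simp add: prof_comp_def)

lemma prof_comp_is_profunctor: "is_profunctor S U (prof_comp S T U P Q)"
  unfolding prof_comp_def
proof (rule mk_profunctorI[OF S U], goal_cases)
  note cat = S U small_category_is_category[OF T]
  note simps = Ident_in[OF cat(1)] Ident_in[OF cat(2)] Ident_in[OF cat(3)]
    Comp_in[OF cat(1)] Comp_in[OF cat(2)] Comp_Ident_left[OF cat(3)]
    prof_farr_in[OF P] prof_farr_in[OF Q] prof_farr_Ident[OF P] prof_farr_Ident[OF Q]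
    prof_farr_farr[OF P] prof_farr_farr[OF Q] coend_class_in act_class
  {
    case (1 x y)
    then show ?case by (simp add: small_coend)
  next
    case (2 x x' z z' u v)
    \<comment> \<open>Every element is a class, on which \<open>act_class\<close> computes;
      \<open>restrict_apply\<close> stays out of the simpset so that \<open>act\<close> keeps the
      shape which that rule matches.\<close>
    have "act x z x' z' u v \<kappa> \<in> coend S T U P Q x' z'" if "\<kappa> \<in> coend S T U P Q x z" for \<kappa>
      by (rule coendE[OF 2(1,3) that]) (use 2 in \<open>simp add: simps del: restrict_apply\<close>)
    then have "act x z x' z' u v \<in> coend S T U P Q x z \<rightarrow>\<^sub>E coend S T U P Q x' z'"
      by (rule PiE_I) auto
    then show ?case
      by simp
  next
    case (3 x z \<kappa>)
    then have \<kappa>: "\<kappa> \<in> coend S T U P Q x z" by simp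
    show ?case
      by (rule coendE[OF 3(1,2) \<kappa>]) (use 3 in \<open>simp add: simps del: restrict_apply\<close>)
  next
    case (4 x x' x'' z z' z'' u v u' v' \<kappa>)
    then have \<kappa>: "\<kappa> \<in> coend S T U P Q x z" by simp
    show ?case
      by (rule coendE[OF 4(1,4) \<kappa>]) (use 4 in \<open>simp add: simps del: restrict_apply\<close>)
  }
qed

end

section \<open>Enriched categories and enriched functors\<close>

lemma is_prof_functorD:
  assumes F: "is_prof_functor S S' F"
  shows "is_prof_category S" "is_prof_category S'"
    and "p \<in> pob S \<Longrightarrow> pfob F p \<in> pob S'"
    and "p \<in> pob S \<Longrightarrow> is_functor (pcat S p) (pcat S' (pfob F p)) (pffun F p)"
    and "p \<in> pob S \<Longrightarrow> q \<in> pob S \<Longrightarrow> prof_map (pcat S p) (pcat S q) (phom S p q)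
      (prof_reindex (pcat S p) (pcat S q) (phom S' (pfob F p) (pfob F q)) (pffun F p) (pffun F q))
      (pfhom F p q)"
    and "p \<in> pob S \<Longrightarrow> x \<in> Obj (pcat S p) \<Longrightarrow> x' \<in> Obj (pcat S p) \<Longrightarrow> m \<in> Hom (pcat S p) x x'
      \<Longrightarrow> pfhom F p p (x, x') (pid S p (x, x') m)
        = pid S' (pfob F p) (fob (pffun F p) x, fob (pffun F p) x') (farr (pffun F p) x x' m)"
    and "p \<in> pob S \<Longrightarrow> q \<in> pob S \<Longrightarrow> r \<in> pob S \<Longrightarrow> x \<in> Obj (pcat S p) \<Longrightarrow> y \<in> Obj (pcat S q)
      \<Longrightarrow> z \<in> Obj (pcat S r) \<Longrightarrow> f \<in> fob (phom S p q) (x, y) \<Longrightarrow> g \<in> fob (phom S q r) (y, z)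
      \<Longrightarrow> pfhom F p r (x, z) (pmul S p q r x y z f g)
        = pmul S' (pfob F p) (pfob F q) (pfob F r)
            (fob (pffun F p) x) (fob (pffun F q) y) (fob (pffun F r) z)
            (pfhom F p q (x, y) f) (pfhom F q r (y, z) g)"
  using F unfolding is_prof_functor_def by (auto simp del: prod_cat_simps)

lemma is_prof_categoryD:
  assumes S: "is_prof_category S"
  shows "p \<in> pob S \<Longrightarrow> is_small_category (pcat S p)"
    and "p \<in> pob S \<Longrightarrow> q \<in> pob S \<Longrightarrow> is_profunctor (pcat S p) (pcat S q) (phom S p q)"
    and "p \<in> pob S \<Longrightarrow> prof_map (pcat S p) (pcat S p) (hom_prof (pcat S p)) (phom S p p) (pid S p)"
    and "p \<in> pob S \<Longrightarrow> q \<in> pob S \<Longrightarrow> r \<in> pob S \<Longrightarrow> prof_map (pcat S p) (pcat S r)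
        (prof_comp (pcat S p) (pcat S q) (pcat S r) (phom S p q) (phom S q r))
        (phom S p r) (pcomp S p q r)"
  using S by (simp_all add: is_prof_category_def)

text \<open>The hom components are compared as maps of profunctors, whose extensionality reduces
  equality to elements; \<open>restrict2\<close> settles the pairs outside
  \<open>pob S\<close>.\<close>

lemma prof_functor_eqI:
  assumes F: "is_prof_functor S S' F" and G: "is_prof_functor S S'' G"
    and ob: "\<And>p. p \<in> pob S \<Longrightarrow> pfob F p = pfob G p"
    and fctr: "\<And>p. p \<in> pob S \<Longrightarrow> pffun F p = pffun G p"
    and hom: "\<And>p q x y h. p \<in> pob S \<Longrightarrow> q \<in> pob S \<Longrightarrow> x \<in> Obj (pcat S p) \<Longrightarrow> y \<in> Obj (pcat S q)
      \<Longrightarrow> h \<in> fob (phom S p q) (x, y) \<Longrightarrow> pfhom F p q (x, y) h = pfhom G p q (x, y) h"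
  shows "F = G"
proof (rule prof_functor.equality)
  show "pfob F = pfob G"
    using F G ob unfolding is_prof_functor_def by (intro extensionalityI[of _ "pob S"]) (auto simp: PiE_iff)
  show "pffun F = pffun G"
    using F G fctr unfolding is_prof_functor_def by (intro extensionalityI[of _ "pob S"]) (auto simp: PiE_iff)
  have "pfhom F p q = pfhom G p q" if "p \<in> pob S" "q \<in> pob S" for p q
    by (rule prof_map_eqI[OF is_prof_functorD(5)[OF F that] is_prof_functorD(5)[OF G that]])
      (use hom that in blast)
  then have "restrict2 (pob S) (pfhom F) = restrict2 (pob S) (pfhom G)"
    by (auto simp: restrict2_def fun_eq_iff)
  then show "pfhom F = pfhom G"
    using F G unfolding is_prof_functor_def by metis
qed simp

lemma prof_functor_id_simps [simp]:
  "p \<in> pob S \<Longrightarrow> pfob (prof_functor_id S) p = p"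
  "p \<in> pob S \<Longrightarrow> pffun (prof_functor_id S) p = id_functor (pcat S p)"
  "p \<in> pob S \<Longrightarrow> q \<in> pob S \<Longrightarrow> x \<in> Obj (pcat S p) \<Longrightarrow> y \<in> Obj (pcat S q)
    \<Longrightarrow> h \<in> fob (phom S p q) (x, y) \<Longrightarrow> pfhom (prof_functor_id S) p q (x, y) h = h"
  by (simp_all add: prof_functor_id_def restrict2_def)

lemma prof_functor_comp_simps [simp]:
  "p \<in> pob S \<Longrightarrow> pfob (prof_functor_comp S G F) p = pfob G (pfob F p)"
  "p \<in> pob S \<Longrightarrow> pffun (prof_functor_comp S G F) p
    = comp_functor (pcat S p) (pffun G (pfob F p)) (pffun F p)"
  "p \<in> pob S \<Longrightarrow> q \<in> pob S \<Longrightarrow> x \<in> Obj (pcat S p) \<Longrightarrow> y \<in> Obj (pcat S q)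
    \<Longrightarrow> h \<in> fob (phom S p q) (x, y) \<Longrightarrow> pfhom (prof_functor_comp S G F) p q (x, y) h
      = pfhom G (pfob F p) (pfob F q) (fob (pffun F p) x, fob (pffun F q) y) (pfhom F p q (x, y) h)"
  by (simp_all add: prof_functor_comp_def restrict2_def)

lemma pmul_in:
  assumes S: "is_prof_category S" and p: "p \<in> pob S" "q \<in> pob S" "r \<in> pob S"
    and x: "x \<in> Obj (pcat S p)" "y \<in> Obj (pcat S q)" "z \<in> Obj (pcat S r)"
    and f: "f \<in> fob (phom S p q) (x, y)" and g: "g \<in> fob (phom S q r) (y, z)"
  shows "pmul S p q r x y z f g \<in> fob (phom S p r) (x, z)"
proof -
  note D = is_prof_categoryD[OF S]
  note args = small_category_is_category[OF D(1)[OF p(1)]] D(1)[OF p(2)]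
    small_category_is_category[OF D(1)[OF p(3)]] D(2)[OF p(1,2)] D(2)[OF p(2,3)]
  show ?thesis
    unfolding pmul_def
    using prof_map_in[OF D(4)[OF p] _ x(1,3)] coend_class_in[OF args x(1,3,2) f g]
      fob_prof_comp[OF args x(1,3)] by simp
qed

lemma pid_in:
  assumes S: "is_prof_category S" and p: "p \<in> pob S"
    and x: "x \<in> Obj (pcat S p)" "x' \<in> Obj (pcat S p)" and m: "m \<in> Hom (pcat S p) x x'"
  shows "pid S p (x, x') m \<in> fob (phom S p p) (x, x')"
  using prof_map_in[OF is_prof_categoryD(3)[OF S p] _ x, of m] m x by (simp add: hom_prof_def)

lemma prof_functor_id_is_prof_functor:
  assumes S: "is_prof_category S"
  shows "is_prof_functor S S (prof_functor_id S)"
proof -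
  note D = is_prof_categoryD[OF S]
  have cat: "is_category (pcat S p)" if "p \<in> pob S" for p
    by (rule small_category_is_category[OF D(1)[OF that]])
  have "prof_map (pcat S p) (pcat S q) (phom S p q)
      (prof_reindex (pcat S p) (pcat S q) (phom S p q) (id_functor (pcat S p)) (id_functor (pcat S q)))
      (pfhom (prof_functor_id S) p q)" if p: "p \<in> pob S" "q \<in> pob S" for p q
    by (rule prof_mapI[OF D(2)[OF p] prof_reindex_is_profunctor[OF id_functor_is_functor[OF cat[OF p(1)]]
            id_functor_is_functor[OF cat[OF p(2)]] D(2)[OF p]]])
      (simp_all add: p prof_farr_in[OF D(2)[OF p]], simp_all add: prof_functor_id_def restrict2_def p)
  then show ?thesis
    unfolding is_prof_functor_def
    by (auto simp: S id_functor_is_functor cat pmul_in[OF S] pid_in[OF S])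
      (auto simp: prof_functor_id_def restrict2_def fun_eq_iff id_functor_is_functor cat)
qed

lemma prof_functor_comp_is_prof_functor:
  assumes F: "is_prof_functor S S' F" and G: "is_prof_functor S' S'' G"
  shows "is_prof_functor S S'' (prof_functor_comp S G F)"
proof -
  note F' = is_prof_functorD[OF F] and G' = is_prof_functorD[OF G]
  let ?GF = "prof_functor_comp S G F"
  have app_in: "pfhom F p q (x, y) h \<in> fob (phom S' (pfob F p) (pfob F q)) (fob (pffun F p) x, fob (pffun F q) y)"
    if "p \<in> pob S" "q \<in> pob S" "x \<in> Obj (pcat S p)" "y \<in> Obj (pcat S q)" "h \<in> fob (phom S p q) (x, y)"
    for p q x y h
    using prof_map_in[OF F'(5)[OF that(1,2)] that(5,3,4)] that by simp
  have app_in': "pfhom G p q (x, y) h \<in> fob (phom S'' (pfob G p) (pfob G q)) (fob (pffun G p) x, fob (pffun G q) y)"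
    if "p \<in> pob S'" "q \<in> pob S'" "x \<in> Obj (pcat S' p)" "y \<in> Obj (pcat S' q)" "h \<in> fob (phom S' p q) (x, y)"
    for p q x y h
    using prof_map_in[OF G'(5)[OF that(1,2)] that(5,3,4)] that by simp
  note ob = fob_in[OF F'(4)]
  have "prof_map (pcat S p) (pcat S q) (phom S p q)
      (prof_reindex (pcat S p) (pcat S q) (phom S'' (pfob G (pfob F p)) (pfob G (pfob F q)))
        (comp_functor (pcat S p) (pffun G (pfob F p)) (pffun F p))
        (comp_functor (pcat S q) (pffun G (pfob F q)) (pffun F q)))
      (pfhom ?GF p q)" if p: "p \<in> pob S" "q \<in> pob S" for p q
  proof (rule prof_mapI[OF is_prof_categoryD(2)[OF F'(1) p]])
    show "is_profunctor (pcat S p) (pcat S q)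
      (prof_reindex (pcat S p) (pcat S q) (phom S'' (pfob G (pfob F p)) (pfob G (pfob F q)))
        (comp_functor (pcat S p) (pffun G (pfob F p)) (pffun F p))
        (comp_functor (pcat S q) (pffun G (pfob F q)) (pffun F q)))"
      by (rule prof_reindex_is_profunctor[OF
            comp_functor_is_functor[OF F'(4)[OF p(1)] G'(4)[OF F'(3)[OF p(1)]]]
            comp_functor_is_functor[OF F'(4)[OF p(2)] G'(4)[OF F'(3)[OF p(2)]]]])
        (intro is_prof_categoryD(2)[OF G'(2)] G'(3) F'(3) p)
    show "pfhom ?GF p q \<in> extensional (Obj (pcat S p) \<times> Obj (pcat S q))"
      by (simp add: prof_functor_comp_def restrict2_def p)
    fix x y assume x: "x \<in> Obj (pcat S p)" and y: "y \<in> Obj (pcat S q)"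
    then show "pfhom ?GF p q (x, y) \<in> extensional (fob (phom S p q) (x, y))"
      by (simp add: prof_functor_comp_def restrict2_def p)
    fix h assume h: "h \<in> fob (phom S p q) (x, y)"
    then show "pfhom ?GF p q (x, y) h \<in> fob (prof_reindex (pcat S p) (pcat S q)
        (phom S'' (pfob G (pfob F p)) (pfob G (pfob F q)))
        (comp_functor (pcat S p) (pffun G (pfob F p)) (pffun F p))
        (comp_functor (pcat S q) (pffun G (pfob F q)) (pffun F q))) (x, y)"
      using p x y by (simp add: app_in app_in' F'(3) ob)
    fix x' y' u v assume x': "x' \<in> Obj (pcat S p)" and y': "y' \<in> Obj (pcat S q)"
      and u: "u \<in> Hom (pcat S p) x' x" and v: "v \<in> Hom (pcat S q) y y'"
    have "farr (phom S p q) (x, y) (x', y') (u, v) h \<in> fob (phom S p q) (x', y')"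
      by (rule prof_farr_in[OF is_prof_categoryD(2)[OF F'(1) p] u v h x x' y y'])
    \<comment> \<open>Naturality of \<open>F\<close> at \<open>(u, v)\<close>, then naturality of
      \<open>G\<close> at the images of \<open>u\<close> and \<open>v\<close>. The membership just
      shown allows the composite to be evaluated at \<open>(x', y')\<close>.\<close>
    then show "pfhom ?GF p q (x', y') (farr (phom S p q) (x, y) (x', y') (u, v) h)
      = farr (prof_reindex (pcat S p) (pcat S q) (phom S'' (pfob G (pfob F p)) (pfob G (pfob F q)))
        (comp_functor (pcat S p) (pffun G (pfob F p)) (pffun F p))
        (comp_functor (pcat S q) (pffun G (pfob F q)) (pffun F q))) (x, y) (x', y') (u, v)
        (pfhom ?GF p q (x, y) h)"
      using p x y x' y' u v h
        prof_map_natural[OF F'(5)[OF p] u v h x x' y y']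
        prof_map_natural[OF G'(5)[OF F'(3)[OF p(1)] F'(3)[OF p(2)]],
          of "farr (pffun F p) x' x u" "fob (pffun F p) x'" "fob (pffun F p) x"
            "farr (pffun F q) y y' v" "fob (pffun F q) y" "fob (pffun F q) y'" "pfhom F p q (x, y) h"]
      by (simp add: app_in F'(3) ob farr_in[OF F'(4)])
  qed
  then show ?thesis
    unfolding is_prof_functor_def
    by (auto simp: F'(1,3,6,7) G'(2,3,6,7) ob app_in pmul_in[OF F'(1)] pid_in[OF F'(1)]
        farr_in[OF F'(4)] comp_functor_is_functor[OF F'(4) G'(4)])
      (auto simp: prof_functor_comp_def restrict2_def fun_eq_iff F'(3) G'(3) comp_functor_is_functor[OF F'(4) G'(4)])
qed

lemma ProfCat_simps [simp]:
  "S \<in> Obj ProfCat \<longleftrightarrow> is_prof_category S" "F' \<in> Hom ProfCat S S' \<longleftrightarrow> is_prof_functor S S' F'"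
  "Ident ProfCat S = prof_functor_id S" "Comp ProfCat S S' S'' G' F' = prof_functor_comp S G' F'"
  by (simp_all add: ProfCat_def)

lemma ProfCat_is_category: "is_category ProfCat"
proof (rule is_categoryI, simp_all only: ProfCat_simps, goal_cases)
  case (1 S)
  then show ?case by (rule prof_functor_id_is_prof_functor)
next
  case (2 S S' S'' F G)
  then show ?case by (rule_tac prof_functor_comp_is_prof_functor)
next
  case (3 S S' F)
  note F = is_prof_functorD[OF 3(3)]
  show ?case
    by (rule prof_functor_eqI[OF prof_functor_comp_is_prof_functor[OF prof_functor_id_is_prof_functor[OF 3(1)] 3(3)] 3(3)])
      (simp_all add: comp_functor_id_right[OF F(4)])
next
  case (4 S S' F)
  note F = is_prof_functorD[OF 4(3)]
  show ?case
  proof (rule prof_functor_eqI[OF prof_functor_comp_is_prof_functor[OF 4(3) prof_functor_id_is_prof_functor[OF 4(2)]] 4(3)])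
    fix p q x y h assume *: "p \<in> pob S" "q \<in> pob S" "x \<in> Obj (pcat S p)" "y \<in> Obj (pcat S q)"
      "h \<in> fob (phom S p q) (x, y)"
    then show "pfhom (prof_functor_comp S (prof_functor_id S') F) p q (x, y) h = pfhom F p q (x, y) h"
      using prof_map_in[OF F(5)[OF *(1,2)] *(5,3,4)] by (simp add: F(3) fob_in[OF F(4)])
  qed (simp_all add: F(3) comp_functor_id_left[OF F(4)])
next
  case (5 S S' S'' S''' F G H)
  note F = is_prof_functorD[OF 5(5)] and G = is_prof_functorD[OF 5(6)]
    and GF = prof_functor_comp_is_prof_functor[OF 5(5,6)]
    and HG = prof_functor_comp_is_prof_functor[OF 5(6,7)]
  show ?case
  proof (rule prof_functor_eqI[OF prof_functor_comp_is_prof_functor[OF GF 5(7)]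
        prof_functor_comp_is_prof_functor[OF 5(5) HG]])
    fix p assume p: "p \<in> pob S"
    show "pffun (prof_functor_comp S H (prof_functor_comp S G F)) p
      = pffun (prof_functor_comp S (prof_functor_comp S' H G) F) p"
      using p comp_functor_assoc[OF F(4)[OF p] G(4)[OF F(3)[OF p]]
          is_prof_functorD(4)[OF 5(7) G(3)[OF F(3)[OF p]]]]
      by (simp add: F(3))
  next
    fix p q x y h assume *: "p \<in> pob S" "q \<in> pob S" "x \<in> Obj (pcat S p)" "y \<in> Obj (pcat S q)"
      "h \<in> fob (phom S p q) (x, y)"
    then show "pfhom (prof_functor_comp S H (prof_functor_comp S G F)) p q (x, y) h
      = pfhom (prof_functor_comp S (prof_functor_comp S' H G) F) p q (x, y) h"
      using prof_map_in[OF F(5)[OF *(1,2)] *(5,3,4)] by (simp add: F(3) fob_in[OF F(4)])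
  qed (simp add: F(3))
qed

section \<open>The enriched category of selections\<close>

lemma fob_sel_prof [simp]:
  "x \<in> sel_obj C p \<Longrightarrow> y \<in> sel_obj C q \<Longrightarrow> fob (sel_prof C p q) (x, y) = sel_hom C p q x y"
  by (simp add: sel_prof_def)

lemma farr_sel_prof [simp]:
  "x \<in> sel_obj C p \<Longrightarrow> x' \<in> sel_obj C p \<Longrightarrow> y \<in> sel_obj C q \<Longrightarrow> y' \<in> sel_obj C q
    \<Longrightarrow> u \<in> sel_hom C p p x' x \<Longrightarrow> v \<in> sel_hom C q q y y' \<Longrightarrow> h \<in> sel_hom C p q x y
    \<Longrightarrow> farr (sel_prof C p q) (x, y) (x', y') (u, v) h
      = sel_comp C q x' y y' v (sel_comp C q x' x y h u)"
  by (simp add: sel_prof_def)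

text \<open>This is why identity functions can serve as the identity data of
  \<open>sel_enriched\<close>: source and target of \<open>pid\<close> are the same
  profunctor.\<close>

lemma hom_prof_sel_cat: "hom_prof (sel_cat C p) = sel_prof C p p"
  by (simp add: hom_prof_def sel_prof_def)

lemma pid_sel_enriched:
  "x \<in> sel_obj C p \<Longrightarrow> y \<in> sel_obj C p \<Longrightarrow> h \<in> sel_hom C p p x y \<Longrightarrow> pid (sel_enriched C) p (x, y) h = h"
  by (simp add: sel_enriched_def)

lemma sel_enriched_simps [simp]:
  "pob (sel_enriched C) = Obj Poly" "pcat (sel_enriched C) = sel_cat C" "phom (sel_enriched C) = sel_prof C"
  by (simp_all add: sel_enriched_def)

context
  fixes C :: "('u::set_universe, 'u) category"
  assumes C: "is_small_category C"
begin

private lemmas C_cat = small_category_is_category[OF C]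
private lemmas comp_simps = sel_id_in[OF C_cat] sel_comp_in[OF C_cat] sel_comp_id_left[OF C_cat]
  sel_comp_id_right[OF C_cat]

lemma sel_cat_is_category: "p \<in> Obj Poly \<Longrightarrow> is_category (sel_cat C p)"
  by (rule small_category_is_category[OF sel_cat_is_small_category[OF C]])

lemma sel_prof_is_profunctor:
  assumes p: "p \<in> Obj Poly" and q: "q \<in> Obj Poly"
  shows "is_profunctor (sel_cat C p) (sel_cat C q) (sel_prof C p q)"
  unfolding sel_prof_def
proof (rule mk_profunctorI[OF sel_cat_is_category[OF p] sel_cat_is_category[OF q]], goal_cases)
  case (1 x y)
  then show ?case by (simp add: small_sel_hom[OF C p q])
next
  case (2 x x' y y' u v)
  then show ?case by (simp add: comp_simps(2)[OF p p q] comp_simps(2)[OF p q q])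
next
  case (3 x y f)
  then show ?case using p q by (simp add: comp_simps)
next
  case (4 x x' x'' y y' y'' u v u' v' f)
  then have o: "x \<in> sel_obj C p" "x' \<in> sel_obj C p" "x'' \<in> sel_obj C p"
    "y \<in> sel_obj C q" "y' \<in> sel_obj C q" "y'' \<in> sel_obj C q"
    and u: "u \<in> sel_hom C p p x' x" "u' \<in> sel_hom C p p x'' x'"
    and v: "v \<in> sel_hom C q q y y'" "v' \<in> sel_hom C q q y' y''" and f: "f \<in> sel_hom C p q x y"
    by simp_all
  have fu: "sel_comp C q x' x y f u \<in> sel_hom C p q x' y"
    by (rule sel_comp_in[OF C_cat p p q o(2,1,4) u(1) f])
  have uu: "sel_comp C p x'' x' x u u' \<in> sel_hom C p p x'' x"
    by (rule sel_comp_in[OF C_cat p p p o(3,2,1) u(2,1)])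
  \<comment> \<open>The three equations bring both sides to the bracketing in which
    \<open>u\<close>, \<open>u'\<close>, \<open>v\<close>, \<open>v'\<close> are applied to
    \<open>f\<close> one after the other, the precompositions first.\<close>
  have 1: "sel_comp C q x'' x y f (sel_comp C p x'' x' x u u')
      = sel_comp C q x'' x' y (sel_comp C q x' x y f u) u'"
    by (rule sel_comp_assoc[OF C_cat p p p q o(3,2,1,4) u(2,1) f, symmetric])
  have fuu: "sel_comp C q x'' x' y (sel_comp C q x' x y f u) u' \<in> sel_hom C p q x'' y"
    by (rule sel_comp_in[OF C_cat p p q o(3,2,4) u(2) fu])
  have 2: "sel_comp C q x'' y y'' (sel_comp C q y y' y'' v' v) (sel_comp C q x'' x' y (sel_comp C q x' x y f u) u')
      = sel_comp C q x'' y' y'' v' (sel_comp C q x'' y y' v (sel_comp C q x'' x' y (sel_comp C q x' x y f u) u'))"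
    by (rule sel_comp_assoc[OF C_cat p q q q o(3,4,5,6) fuu v])
  have 3: "sel_comp C q x'' x' y' (sel_comp C q x' y y' v (sel_comp C q x' x y f u)) u'
      = sel_comp C q x'' y y' v (sel_comp C q x'' x' y (sel_comp C q x' x y f u) u')"
    by (rule sel_comp_assoc[OF C_cat p p q q o(3,2,4,5) u(2) fu v(1)])
  have vfu: "sel_comp C q x' y y' v (sel_comp C q x' x y f u) \<in> sel_hom C p q x' y'"
    by (rule sel_comp_in[OF C_cat p q q o(2,4,5) fu v(1)])
  show ?case
    using f vfu by (simp add: 1 2 3)
qed

lemma farr_sel_prof_left:
  assumes "p \<in> Obj Poly" "q \<in> Obj Poly" "x \<in> sel_obj C p" "x' \<in> sel_obj C p" "y \<in> sel_obj C q"
    and "u \<in> sel_hom C p p x' x" "h \<in> sel_hom C p q x y"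
  shows "farr (sel_prof C p q) (x, y) (x', y) (u, sel_id C q y) h = sel_comp C q x' x y h u"
  using assms by (simp add: comp_simps comp_simps(2)[of p p q])

lemma farr_sel_prof_right:
  assumes "p \<in> Obj Poly" "q \<in> Obj Poly" "x \<in> sel_obj C p" "y \<in> sel_obj C q" "y' \<in> sel_obj C q"
    and "v \<in> sel_hom C q q y y'" "h \<in> sel_hom C p q x y"
  shows "farr (sel_prof C p q) (x, y) (x, y') (sel_id C p x, v) h = sel_comp C q x y y' v h"
  using assms by (simp add: comp_simps)

section \<open>The composition data on coends\<close>

context
  fixes p q r :: "'u polyn"
  assumes p: "p \<in> Obj Poly" and q: "q \<in> Obj Poly" and r: "r \<in> Obj Poly"
begin

private lemmas coend_args = sel_cat_is_category[OF p] sel_cat_is_small_category[OF C q]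
  sel_cat_is_category[OF r] sel_prof_is_profunctor[OF p q] sel_prof_is_profunctor[OF q r]

private abbreviation "sel_class \<equiv>
  coend_class (sel_cat C p) (sel_cat C q) (sel_cat C r) (sel_prof C p q) (sel_prof C q r)"

text \<open>The two triples related by a coend step are sent to the two bracketings of the threefold
  composite of \<open>f\<close>, \<open>u\<close> and \<open>g\<close>.\<close>

lemma coend_lift_sel_comp:
  assumes x: "x \<in> sel_obj C p" and z: "z \<in> sel_obj C r" and y: "y \<in> sel_obj C q"
    and f: "f \<in> sel_hom C p q x y" and g: "g \<in> sel_hom C q r y z"
  shows "coend_lift (\<lambda>y f g. sel_comp C r x y z g f) (sel_class x z y f g) = sel_comp C r x y z g f"
proof (rule coend_lift_class[OF coend_args])
  fix y y' u f g
  assume "y \<in> Obj (sel_cat C q)" "y' \<in> Obj (sel_cat C q)" "u \<in> Hom (sel_cat C q) y y'"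
    and "f \<in> fob (sel_prof C p q) (x, y)" "g \<in> fob (sel_prof C q r) (y', z)"
  then have o: "y \<in> sel_obj C q" "y' \<in> sel_obj C q" and u: "u \<in> sel_hom C q q y y'"
    and f: "f \<in> sel_hom C p q x y" and g: "g \<in> sel_hom C q r y' z"
    using x z by simp_all
  show "sel_comp C r x y z (farr (sel_prof C q r) (y', z) (y, z) (u, Ident (sel_cat C r) z) g) f
    = sel_comp C r x y' z g (farr (sel_prof C p q) (x, y) (x, y') (Ident (sel_cat C p) x, u) f)"
    using sel_comp_assoc[OF C_cat p q q r x o z f u g]
    by (simp add: farr_sel_prof_left[OF q r o(2,1) z u g] farr_sel_prof_right[OF p q x o u f]
        del: farr_sel_prof)
qed (use assms in simp_all)

text \<open>The unit and associativity laws and the functor condition on composites are stated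
  through \<open>pmul\<close>, so for them this equation replaces coend classes by composites in
  \<open>C\<close>.\<close>

lemma pmul_sel_enriched:
  assumes x: "x \<in> sel_obj C p" and z: "z \<in> sel_obj C r" and y: "y \<in> sel_obj C q"
    and f: "f \<in> sel_hom C p q x y" and g: "g \<in> sel_hom C q r y z"
  shows "pmul (sel_enriched C) p q r x y z f g = sel_comp C r x y z g f"
proof -
  have "sel_class x z y f g
      \<in> coend (sel_cat C p) (sel_cat C q) (sel_cat C r) (sel_prof C p q) (sel_prof C q r) x z"
    by (rule coend_class_in[OF coend_args]) (use assms in simp_all)
  then show ?thesis
    using x z by (simp add: pmul_def sel_enriched_def coend_lift_sel_comp[OF assms])
qed

lemma pcomp_sel_enriched_prof_map:
  "prof_map (sel_cat C p) (sel_cat C r)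
    (prof_comp (sel_cat C p) (sel_cat C q) (sel_cat C r) (sel_prof C p q) (sel_prof C q r))
    (sel_prof C p r) (pcomp (sel_enriched C) p q r)"
proof (rule prof_mapI[OF prof_comp_is_profunctor[OF coend_args] sel_prof_is_profunctor[OF p r]])
  let ?m = "pcomp (sel_enriched C) p q r"
    and ?PQ = "prof_comp (sel_cat C p) (sel_cat C q) (sel_cat C r) (sel_prof C p q) (sel_prof C q r)"
  show "?m \<in> extensional (Obj (sel_cat C p) \<times> Obj (sel_cat C r))"
    by (simp add: sel_enriched_def)
  have app: "?m (x, z) (sel_class x z y f g) = sel_comp C r x y z g f"
    if "x \<in> sel_obj C p" "z \<in> sel_obj C r" "y \<in> sel_obj C q"
      "f \<in> sel_hom C p q x y" "g \<in> sel_hom C q r y z" for x y z f g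
    using pmul_sel_enriched[OF that] by (simp add: pmul_def sel_enriched_def)
  fix x z assume "x \<in> Obj (sel_cat C p)" and "z \<in> Obj (sel_cat C r)"
  then have x: "x \<in> sel_obj C p" and z: "z \<in> sel_obj C r"
    by simp_all
  have fob: "fob ?PQ (x, z)
      = coend (sel_cat C p) (sel_cat C q) (sel_cat C r) (sel_prof C p q) (sel_prof C q r) x z"
    by (rule fob_prof_comp[OF coend_args]) (simp_all add: x z)
  then show "?m (x, z) \<in> extensional (fob ?PQ (x, z))"
    by (simp add: sel_enriched_def x z)
  fix \<kappa> assume "\<kappa> \<in> fob ?PQ (x, z)"
  then obtain y f g where \<kappa>: "\<kappa> = sel_class x z y f g" and y: "y \<in> sel_obj C q"
    and f: "f \<in> sel_hom C p q x y" and g: "g \<in> sel_hom C q r y z"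
    unfolding fob using coendE[OF coend_args, of x z \<kappa>] x z by auto
  show "?m (x, z) \<kappa> \<in> fob (sel_prof C p r) (x, z)"
    by (simp add: \<kappa> app[OF x z y f g] x z sel_comp_in[OF C_cat p q r x y z f g])
  fix x' z' u v assume "x' \<in> Obj (sel_cat C p)" and "z' \<in> Obj (sel_cat C r)"
    and "u \<in> Hom (sel_cat C p) x' x" and "v \<in> Hom (sel_cat C r) z z'"
  then have x': "x' \<in> sel_obj C p" and z': "z' \<in> sel_obj C r"
    and u: "u \<in> sel_hom C p p x' x" and v: "v \<in> sel_hom C r r z z'"
    by simp_all
  have fu: "sel_comp C q x' x y f u \<in> sel_hom C p q x' y"
    by (rule sel_comp_in[OF C_cat p p q x' x y u f])
  have vg: "sel_comp C r y z z' v g \<in> sel_hom C q r y z'"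
    by (rule sel_comp_in[OF C_cat q r r y z z' g v])
  have gf: "sel_comp C r x y z g f \<in> sel_hom C p r x z"
    by (rule sel_comp_in[OF C_cat p q r x y z f g])
  have "farr ?PQ (x, z) (x', z') (u, v) \<kappa> = sel_class x' z' y (sel_comp C q x' x y f u) (sel_comp C r y z z' v g)"
    unfolding \<kappa>
    by (subst farr_prof_comp_class[OF coend_args])
      (use x x' z z' u v y f g in \<open>simp_all add: farr_sel_prof_left[OF p q] farr_sel_prof_right[OF q r]
        del: farr_sel_prof\<close>)
  \<comment> \<open>Naturality of the composition data: acting on the two factors separately and
    then composing rebrackets to acting on their composite.\<close>
  moreover have "sel_comp C r x' y z' (sel_comp C r y z z' v g) (sel_comp C q x' x y f u)
      = sel_comp C r x' z z' v (sel_comp C r x' x z (sel_comp C r x y z g f) u)"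
    by (simp add: sel_comp_assoc[OF C_cat p q r r x' y z z' fu g v] sel_comp_assoc[OF C_cat p p q r x' x y z u f g])
  ultimately show "?m (x', z') (farr ?PQ (x, z) (x', z') (u, v) \<kappa>)
      = farr (sel_prof C p r) (x, z) (x', z') (u, v) (?m (x, z) \<kappa>)"
    by (simp add: \<kappa> app[OF x z y f g] app[OF x' z' y fu vg] x z x' z' u v gf)
qed

end

text \<open>Since \<open>pid\<close> is the identity on arrows, the unit laws say that composing
  with an arrow of a selection category is the one-sided action of the profunctor, as in
  \<open>farr_sel_prof_left\<close> and \<open>farr_sel_prof_right\<close>.\<close>

lemma sel_enriched_is_prof_category: "is_prof_category (sel_enriched C)"
proof -
  have "prof_map (sel_cat C p) (sel_cat C p) (sel_prof C p p) (sel_prof C p p) (pid (sel_enriched C) p)"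
    if p: "p \<in> Obj Poly" for p
    by (rule prof_mapI[OF sel_prof_is_profunctor[OF p p] sel_prof_is_profunctor[OF p p]])
      (use p in \<open>simp_all add: pid_sel_enriched comp_simps(2)[of p p p]\<close>, simp_all add: sel_enriched_def)
  then show ?thesis
    unfolding is_prof_category_def
    by (auto simp: sel_cat_is_small_category[OF C] sel_prof_is_profunctor hom_prof_sel_cat
        pcomp_sel_enriched_prof_map pid_sel_enriched pmul_sel_enriched farr_sel_prof_left
        farr_sel_prof_right comp_simps sel_comp_assoc[OF C_cat] simp del: farr_sel_prof)
qed

end

section \<open>Functoriality\<close>

lemma sel_ar_map_ob [simp]: "sel_ar p (sel_map_ob F p x) = sel_ar p x"
  by (simp add: sel_ar_def sel_map_ob_def)

lemma sel_at_map_ob: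
  "p \<in> Obj Poly \<Longrightarrow> x \<in> sel_obj C p \<Longrightarrow> a \<in> sel_ar p x \<Longrightarrow> sel_at (sel_map_ob F p x) a = fob F (sel_at x a)"
  by (simp add: sel_map_ob_def small_sel_ar[of p x C])

lemma vfst_map_ob [simp]: "vfst (sel_map_ob F p x) = vfst x"
  by (simp add: sel_map_ob_def)

lemma sel_enriched_map_simps [simp]:
  "p \<in> Obj Poly \<Longrightarrow> pfob (sel_enriched_map C F) p = p"
  "p \<in> Obj Poly \<Longrightarrow> pffun (sel_enriched_map C F) p
    = mk_functor (sel_cat C p) (sel_map_ob F p) (sel_map_hom F p)"
  "p \<in> Obj Poly \<Longrightarrow> q \<in> Obj Poly \<Longrightarrow> x \<in> sel_obj C p \<Longrightarrow> y \<in> sel_obj C q \<Longrightarrow> h \<in> sel_hom C p q x y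
    \<Longrightarrow> pfhom (sel_enriched_map C F) p q (x, y) h = sel_map_hom F q x y h"
  by (simp_all add: sel_enriched_map_def restrict2_def)

context
  fixes C D :: "('u::set_universe, 'u) category" and F
  assumes F: "is_functor C D F"
begin

lemma sel_map_ob_in:
  assumes "p \<in> Obj Poly" "x \<in> sel_obj C p"
  shows "sel_map_ob F p x \<in> sel_obj D p"
proof -
  have "vfst x \<in> Idx p"
    using assms(2) by (auto simp: sel_obj_def)
  then show ?thesis
    using fob_in[OF F sel_at_in[OF assms]] Poly_small_Arity[OF assms(1)]
    by (simp add: sel_obj_def sel_map_ob_def sel_ar_def)
qed

context
  fixes p q :: "'u polyn" and x y h
  assumes p: "p \<in> Obj Poly" and q: "q \<in> Obj Poly"
    and x: "x \<in> sel_obj C p" and y: "y \<in> sel_obj C q" and h: "h \<in> sel_hom C p q x y"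
begin

lemma sel_map_hom_in: "sel_map_hom F q x y h \<in> sel_hom D p q (sel_map_ob F p x) (sel_map_ob F q y)"
  unfolding sel_map_hom_def Let_def sel_ar_map_ob[of q F y, symmetric]
  by (rule vlam_in_sel_hom)
    (simp add: sel_hom_fst[OF q y h] sel_at_map_ob[OF p x] sel_at_map_ob[OF q y]
      farr_in[OF F sel_hom_snd[OF q y h]] sel_at_in[OF p x] sel_at_in[OF q y])

lemma sel_map_hom_vapp:
  "b \<in> sel_ar q y \<Longrightarrow> vapp (sel_map_hom F q x y h) b = vpair (vfst (vapp h b))
    (farr F (sel_at x (vfst (vapp h b))) (sel_at y b) (vsnd (vapp h b)))"
  by (simp add: sel_map_hom_def Let_def small_sel_ar[OF q y])

end

lemma sel_map_hom_id:
  assumes p: "p \<in> Obj Poly" and x: "x \<in> sel_obj C p"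
  shows "sel_map_hom F p x x (sel_id C p x) = sel_id D p (sel_map_ob F p x)"
  unfolding sel_map_hom_def sel_id_def[of D] sel_ar_map_ob Let_def
  by (rule vlam_cong)
    (simp_all add: sel_id_vapp[OF p x] sel_at_map_ob[OF p x] farr_Ident[OF F] sel_at_in[OF p x])

text \<open>The functor \<open>F\<close> leaves the map of arities alone and acts on the arrows of
  \<open>C\<close> over it, so the claim over each index is functoriality of \<open>F\<close>. As
  for \<open>sel_comp\<close>, independent polynomials let one statement cover functoriality,
  naturality and enriched composition.\<close>

lemma sel_map_hom_comp:
  assumes P: "p \<in> Obj Poly" "q \<in> Obj Poly" "r \<in> Obj Poly"
    and x: "x \<in> sel_obj C p" "y \<in> sel_obj C q" "z \<in> sel_obj C r"
    and f: "f \<in> sel_hom C p q x y" and g: "g \<in> sel_hom C q r y z"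
  shows "sel_map_hom F r x z (sel_comp C r x y z g f)
    = sel_comp D r (sel_map_ob F p x) (sel_map_ob F q y) (sel_map_ob F r z)
        (sel_map_hom F r y z g) (sel_map_hom F q x y f)"
  unfolding sel_map_hom_def[of F r x z] sel_comp_def[of D] sel_ar_map_ob Let_def
  by (rule vlam_cong)
    (simp_all add: sel_comp_vapp[OF P(3) x(3)] Let_def sel_map_hom_vapp[OF P(1,2) x(1,2) f]
      sel_map_hom_vapp[OF P(2,3) x(2,3) g] sel_hom_fst[OF P(3) x(3) g] sel_hom_fst[OF P(2) x(2) f]
      sel_at_map_ob[OF P(1) x(1)] sel_at_map_ob[OF P(2) x(2)] sel_at_map_ob[OF P(3) x(3)]
      farr_Comp[OF F] sel_hom_snd[OF P(3) x(3) g] sel_hom_snd[OF P(2) x(2) f]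
      sel_at_in[OF P(1) x(1)] sel_at_in[OF P(2) x(2)] sel_at_in[OF P(3) x(3)])

lemma sel_map_is_functor:
  assumes C: "is_small_category C" and D: "is_small_category D" and p: "p \<in> Obj Poly"
  shows "is_functor (sel_cat C p) (sel_cat D p) (mk_functor (sel_cat C p) (sel_map_ob F p) (sel_map_hom F p))"
  by (rule mk_functor_is_functor[OF sel_cat_is_category[OF C p] sel_cat_is_category[OF D p]])
    (simp_all add: sel_map_ob_in[OF p] sel_map_hom_in[OF p p] sel_map_hom_id[OF p]
      sel_map_hom_comp[OF p p p])

text \<open>Naturality of the hom maps is \<open>sel_map_hom_comp\<close> applied to the inner and
  to the outer composite; the condition on composites is its general case. For the identity data,
  both \<open>pid\<close> are identities.\<close>

lemma sel_enriched_map_is_prof_functor: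
  assumes C: "is_small_category C" and D: "is_small_category D"
  shows "is_prof_functor (sel_enriched C) (sel_enriched D) (sel_enriched_map C F)"
proof -
  let ?F = "\<lambda>p. mk_functor (sel_cat C p) (sel_map_ob F p) (sel_map_hom F p)"
  note catC = small_category_is_category[OF C]
  have "prof_map (sel_cat C p) (sel_cat C q) (sel_prof C p q)
      (prof_reindex (sel_cat C p) (sel_cat C q) (sel_prof D p q) (?F p) (?F q))
      (pfhom (sel_enriched_map C F) p q)" if p: "p \<in> Obj Poly" and q: "q \<in> Obj Poly" for p q
  proof (rule prof_mapI[OF sel_prof_is_profunctor[OF C p q] prof_reindex_is_profunctor[OF
          sel_map_is_functor[OF C D p] sel_map_is_functor[OF C D q] sel_prof_is_profunctor[OF D p q]]])
    show "pfhom (sel_enriched_map C F) p q \<in> extensional (Obj (sel_cat C p) \<times> Obj (sel_cat C q))"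
      by (simp add: sel_enriched_map_def restrict2_def p q)
    fix x y assume "x \<in> Obj (sel_cat C p)" "y \<in> Obj (sel_cat C q)"
    then have x: "x \<in> sel_obj C p" and y: "y \<in> sel_obj C q" by simp_all
    then show "pfhom (sel_enriched_map C F) p q (x, y) \<in> extensional (fob (sel_prof C p q) (x, y))"
      by (simp add: sel_enriched_map_def restrict2_def p q fob_sel_prof)
    fix h assume "h \<in> fob (sel_prof C p q) (x, y)"
    then have h: "h \<in> sel_hom C p q x y"
      using x y by (simp add: fob_sel_prof)
    then show "pfhom (sel_enriched_map C F) p q (x, y) h
      \<in> fob (prof_reindex (sel_cat C p) (sel_cat C q) (sel_prof D p q) (?F p) (?F q)) (x, y)"
      using x y by (simp add: p q fob_sel_prof sel_map_ob_in sel_map_hom_in)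
    fix x' y' u v assume "x' \<in> Obj (sel_cat C p)" "y' \<in> Obj (sel_cat C q)"
      "u \<in> Hom (sel_cat C p) x' x" "v \<in> Hom (sel_cat C q) y y'"
    then have x': "x' \<in> sel_obj C p" and y': "y' \<in> sel_obj C q"
      and u: "u \<in> sel_hom C p p x' x" and v: "v \<in> sel_hom C q q y y'" by simp_all
    have hu: "sel_comp C q x' x y h u \<in> sel_hom C p q x' y"
      by (rule sel_comp_in[OF catC p p q x' x y u h])
    have vhu: "sel_comp C q x' y y' v (sel_comp C q x' x y h u) \<in> sel_hom C p q x' y'"
      by (rule sel_comp_in[OF catC p q q x' y y' hu v])
    show "pfhom (sel_enriched_map C F) p q (x', y') (farr (sel_prof C p q) (x, y) (x', y') (u, v) h)
      = farr (prof_reindex (sel_cat C p) (sel_cat C q) (sel_prof D p q) (?F p) (?F q)) (x, y) (x', y') (u, v)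
          (pfhom (sel_enriched_map C F) p q (x, y) h)"
      using x y x' y' u v h vhu
      by (simp add: p q farr_sel_prof farr_sel_prof sel_map_ob_in sel_map_hom_in
          sel_map_hom_comp[OF p q q x' y y' hu v] sel_map_hom_comp[OF p p q x' x y u h])
  qed
  moreover have "pfhom (sel_enriched_map C F) = restrict2 (Obj Poly) (pfhom (sel_enriched_map C F))"
    by (simp add: sel_enriched_map_def restrict2_def fun_eq_iff)
  moreover have "pfob (sel_enriched_map C F) \<in> Obj Poly \<rightarrow>\<^sub>E Obj Poly"
    by (simp add: sel_enriched_map_def)
  moreover have "pffun (sel_enriched_map C F) \<in> (\<Pi>\<^sub>E p\<in>Obj Poly.
      {G. is_functor (sel_cat C p) (sel_cat D (pfob (sel_enriched_map C F) p)) G})"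
    by (simp add: sel_enriched_map_def sel_map_is_functor[OF C D])
  ultimately show ?thesis
    unfolding is_prof_functor_def
    by (simp add: sel_enriched_is_prof_category[OF C] sel_enriched_is_prof_category[OF D]
        sel_enriched_simps sel_enriched_simps pid_sel_enriched pid_sel_enriched
        fob_sel_prof pmul_sel_enriched[OF C] pmul_sel_enriched[OF D] sel_map_ob_in sel_map_hom_in
        sel_comp_in[OF catC] sel_map_hom_comp)
qed

end

section \<open>Preservation of identities and composites in the functor variable\<close>

lemma sel_map_ob_id:
  assumes "p \<in> Obj Poly" "x \<in> sel_obj C p"
  shows "sel_map_ob (id_functor C) p x = x"
  using sel_obj_eta[OF assms] sel_at_in[OF assms] by (simp add: sel_map_ob_def)

lemma sel_map_hom_id_functor:
  assumes P: "p \<in> Obj Poly" "q \<in> Obj Poly" and x: "x \<in> sel_obj C p" "y \<in> sel_obj C q"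
    and h: "h \<in> sel_hom C p q x y"
  shows "sel_map_hom (id_functor C) q x y h = h"
proof -
  have "sel_map_hom (id_functor C) q x y h = vlam (sel_ar q y) (vapp h)"
    unfolding sel_map_hom_def Let_def
    by (rule vlam_cong) (simp_all add: sel_hom_fst[OF P(2) x(2) h] sel_hom_snd[OF P(2) x(2) h]
      sel_at_in[OF P(1) x(1)] sel_at_in[OF P(2) x(2)] sel_hom_vpair[OF P(2) x(2) h])
  then show ?thesis
    by (simp add: sel_hom_eta[OF P(2) x(2) h])
qed

lemma sel_map_ob_comp:
  assumes p: "p \<in> Obj Poly" and x: "x \<in> sel_obj C p"
  shows "sel_map_ob (comp_functor C G F) p x = sel_map_ob G p (sel_map_ob F p x)"
  unfolding sel_map_ob_def[of "comp_functor C G F"] sel_map_ob_def[of G]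
  by (simp add: sel_at_map_ob[OF p x] sel_at_in[OF p x])

lemma sel_map_hom_comp_functor:
  assumes F: "is_functor C D F" and P: "p \<in> Obj Poly" "q \<in> Obj Poly"
    and x: "x \<in> sel_obj C p" "y \<in> sel_obj C q" and h: "h \<in> sel_hom C p q x y"
  shows "sel_map_hom (comp_functor C G F) q x y h
    = sel_map_hom G q (sel_map_ob F p x) (sel_map_ob F q y) (sel_map_hom F q x y h)"
  unfolding sel_map_hom_def[of "comp_functor C G F"] sel_map_hom_def[of G] sel_ar_map_ob Let_def
  by (rule vlam_cong)
    (simp_all add: sel_map_hom_vapp[OF F P x h] sel_at_map_ob[OF P(1) x(1)] sel_at_map_ob[OF P(2) x(2)]
      sel_hom_fst[OF P(2) x(2) h] sel_hom_snd[OF P(2) x(2) h] sel_at_in[OF P(1) x(1)]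
      sel_at_in[OF P(2) x(2)])

lemma sel_enriched_map_id:
  assumes C: "is_small_category C"
  shows "sel_enriched_map C (id_functor C) = prof_functor_id (sel_enriched C)"
proof (rule prof_functor_eqI)
  note C_cat = small_category_is_category[OF C]
  show "is_prof_functor (sel_enriched C) (sel_enriched C) (sel_enriched_map C (id_functor C))"
    by (rule sel_enriched_map_is_prof_functor[OF id_functor_is_functor[OF C_cat] C C])
  show "is_prof_functor (sel_enriched C) (sel_enriched C) (prof_functor_id (sel_enriched C))"
    by (rule prof_functor_id_is_prof_functor[OF sel_enriched_is_prof_category[OF C]])
  fix p assume "p \<in> pob (sel_enriched C)"
  then have p: "p \<in> Obj Poly" by simp
  show "pffun (sel_enriched_map C (id_functor C)) p = pffun (prof_functor_id (sel_enriched C)) p"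
    by (simp add: p) (unfold id_functor_def[of "sel_cat C p"], rule mk_functor_cong,
      simp_all add: p sel_map_ob_id sel_map_hom_id_functor[OF p p])
next
  fix p q x y h assume "p \<in> pob (sel_enriched C)" "q \<in> pob (sel_enriched C)"
    "x \<in> Obj (pcat (sel_enriched C) p)" "y \<in> Obj (pcat (sel_enriched C) q)"
    "h \<in> fob (phom (sel_enriched C) p q) (x, y)"
  then have "p \<in> Obj Poly" "q \<in> Obj Poly" "x \<in> sel_obj C p" "y \<in> sel_obj C q" "h \<in> sel_hom C p q x y"
    by simp_all
  then show "pfhom (sel_enriched_map C (id_functor C)) p q (x, y) h
    = pfhom (prof_functor_id (sel_enriched C)) p q (x, y) h"
    by (simp add: sel_map_hom_id_functor)
qed simp

lemma sel_enriched_map_comp: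
  assumes C: "is_small_category C" and D: "is_small_category D" and E: "is_small_category E"
    and F: "is_functor C D F" and G: "is_functor D E G"
  shows "sel_enriched_map C (comp_functor C G F)
    = prof_functor_comp (sel_enriched C) (sel_enriched_map D G) (sel_enriched_map C F)"
proof (rule prof_functor_eqI)
  show "is_prof_functor (sel_enriched C) (sel_enriched E) (sel_enriched_map C (comp_functor C G F))"
    by (rule sel_enriched_map_is_prof_functor[OF comp_functor_is_functor[OF F G] C E])
  show "is_prof_functor (sel_enriched C) (sel_enriched E)
      (prof_functor_comp (sel_enriched C) (sel_enriched_map D G) (sel_enriched_map C F))"
    by (rule prof_functor_comp_is_prof_functor[OF sel_enriched_map_is_prof_functor[OF F C D]
          sel_enriched_map_is_prof_functor[OF G D E]])
  fix p assume "p \<in> pob (sel_enriched C)"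
  then have p: "p \<in> Obj Poly" by simp
  show "pffun (sel_enriched_map C (comp_functor C G F)) p
    = pffun (prof_functor_comp (sel_enriched C) (sel_enriched_map D G) (sel_enriched_map C F)) p"
    by (simp add: p) (unfold comp_functor_def[of "sel_cat C p"], rule mk_functor_cong,
      simp_all add: p sel_map_ob_comp sel_map_ob_in[OF F] sel_map_hom_comp_functor[OF F p p]
        sel_map_hom_in[OF F p p])
next
  fix p q x y h assume "p \<in> pob (sel_enriched C)" "q \<in> pob (sel_enriched C)"
    "x \<in> Obj (pcat (sel_enriched C) p)" "y \<in> Obj (pcat (sel_enriched C) q)"
    "h \<in> fob (phom (sel_enriched C) p q) (x, y)"
  then have *: "p \<in> Obj Poly" "q \<in> Obj Poly" "x \<in> sel_obj C p" "y \<in> sel_obj C q" "h \<in> sel_hom C p q x y"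
    by simp_all
  then show "pfhom (sel_enriched_map C (comp_functor C G F)) p q (x, y) h
    = pfhom (prof_functor_comp (sel_enriched C) (sel_enriched_map D G) (sel_enriched_map C F)) p q (x, y) h"
    by (simp add: sel_map_hom_comp_functor[OF F *] sel_map_ob_in[OF F] sel_map_hom_in[OF F])
qed simp

lemma Selection_is_functor: "is_functor Cat ProfCat Selection"
  unfolding Selection_def
  by (rule mk_functor_is_functor[OF Cat_is_category ProfCat_is_category])
    (simp_all add: sel_enriched_is_prof_category sel_enriched_map_is_prof_functor
      sel_enriched_map_id sel_enriched_map_comp)

text \<open>A left Kan extension is determined only up to isomorphism, so the comparison ranges over
  all extensions \<open>(L, \<eta>)\<close>, and the separate existence claim keeps it from being
  vacuous. The selection category enters through its comonad, in line with the identification of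
  categories with polynomial comonads.\<close>

theorem theorem6p1:
  shows "is_functor Cat ProfCat (Selection :: 'u::set_universe cat_to_prof_cat) \<and>
    (\<forall>C :: ('u, 'u) category \<in> Obj Cat.
       pob (fob Selection C) = Obj Poly \<and>
       (\<forall>p\<in>Obj Poly.
          pcat (fob Selection C) p = sel_cat C p \<and>
          (\<exists>L \<eta>. is_lan Set_cat Set_cat Set_cat (poly_functor p)
             (comp_functor Set_cat (poly_functor p) (cfun (cat_comonad C))) L \<eta>) \<and>
          (\<forall>L \<eta>. is_lan Set_cat Set_cat Set_cat (poly_functor p)
             (comp_functor Set_cat (poly_functor p) (cfun (cat_comonad C))) L \<eta> \<longrightarrow>
             comonad_iso (cat_comonad (sel_cat C p))
               (lan_comonad (poly_functor p) (cat_comonad C) L \<eta>))) \<and>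
       (\<forall>p\<in>Obj Poly. \<forall>q\<in>Obj Poly.
          is_profunctor (pcat (fob Selection C) p) (pcat (fob Selection C) q) (phom (fob Selection C) p q) \<and>
          (\<forall>i\<in>Idx p. \<forall>j\<in>Idx q.
             \<forall>c\<in>vPi (Arity p i) (\<lambda>_. Obj C). \<forall>d\<in>vPi (Arity q j) (\<lambda>_. Obj C).
               fob (phom (fob Selection C) p q) (vpair i c, vpair j d)
               = vPi (Arity q j) (\<lambda>b. vSigma (Arity p i) (\<lambda>a. Hom C (vapp c a) (vapp d b))))))"
proof (intro conjI ballI allI impI)
  show "is_functor Cat ProfCat (Selection :: 'u cat_to_prof_cat)"
    by (rule Selection_is_functor)
next
  fix C :: "('u, 'u) category"
  assume C: "C \<in> Obj Cat"
  then have C': "is_small_category C" and Sel: "fob Selection C = sel_enriched C"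
    by (simp_all add: Selection_def)
  show "pob (fob Selection C) = Obj Poly"
    by (simp add: Sel)
  fix p :: "'u polyn" assume p: "p \<in> Obj Poly"
  show "pcat (fob Selection C) p = sel_cat C p"
    by (simp add: Sel)
  show "\<exists>L \<eta>. is_lan Set_cat Set_cat Set_cat (poly_functor p)
      (comp_functor Set_cat (poly_functor p) (cfun (cat_comonad C))) L \<eta>"
    using sel_cat_is_lan[OF C' p] by (auto simp: cfun_cat_comonad)
  show "comonad_iso (cat_comonad (sel_cat C p)) (lan_comonad (poly_functor p) (cat_comonad C) L \<eta>)"
    if "is_lan Set_cat Set_cat Set_cat (poly_functor p)
      (comp_functor Set_cat (poly_functor p) (cfun (cat_comonad C))) L \<eta>" for L \<eta>
    by (rule comonad_iso_lan_comonad[OF C' p that])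
  fix q :: "'u polyn" assume q: "q \<in> Obj Poly"
  show "is_profunctor (pcat (fob Selection C) p) (pcat (fob Selection C) q) (phom (fob Selection C) p q)"
    by (simp add: Sel sel_prof_is_profunctor[OF C' p q])
  show "fob (phom (fob Selection C) p q) (vpair i c, vpair j d)
      = vPi (Arity q j) (\<lambda>b. vSigma (Arity p i) (\<lambda>a. Hom C (vapp c a) (vapp d b)))"
    if "i \<in> Idx p" "j \<in> Idx q" "c \<in> vPi (Arity p i) (\<lambda>_. Obj C)" "d \<in> vPi (Arity q j) (\<lambda>_. Obj C)"
    for i j c d
    using that by (simp add: Sel sel_obj_def sel_hom_def)
qed

end
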